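(* Let $\mathbf x$ be a set of indeterminates and $\lambda,q$ further indeterminates. Let $f(t)=\sum_{n\ge1}f_n\frac{t^n}{n!}$ with $f(0)=0$, $f'(0)\ne0$ and compositional inverse $\overline f$, and suppose $1/\overline f'(t)=\varphi(t)\phi(t)$ where $\varphi,\phi$ are $\mathbf x$-Pólya frequency functions. Let $[R_{n,k}]_{n,k}=(\varphi(f(t))e^{\lambda f(t)},f(t))$ (exponential Riordan array), $R_n(q)=\sum_kR_{n,k}q^k$, $R_n^*(q)=q^nR_n(1/q)$, $\varphi(f(t))e^{\lambda f(t)}=\sum_nT_n(\lambda)\frac{t^n}{n!}$, $T_n^*(\lambda)=\lambda^nT_n(1/\lambda)$. Then: (i) $[R_{n,k}]$ is coefficientwise totally positive in $(\lambda,\mathbf x)$; (ii) $(R_n(q))_{n\ge0}$ and $(R_n^*(q))_{n\ge0}$ are coefficientwise Hankel-totally positive in $(q,\lambda,\mathbf x)$; (iii) $(T_n(\lambda))_{n\ge0}$ and $(T_n^*(\lambda))_{n\ge0}$ are coefficientwise Hankel-totally positive in $(\lambda,\mathbf x)$; (iv) $(f_{n+1})_{n\ge0}$ is coefficientwise Hankel-totally positive in $\mathbf x$; (v) for all nonnegative real values of $\lambda$ and $\mathbf x$, the convolution $z_n=\sum_{k=0}^nR_{n,k}s_kt_{n-k}$ preserves the Stieltjes moment property.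
   Context: The exponential Riordan array $(g(t),f(t))$ has entries $R_{n,k}=\frac{n!}{k!}[t^n]g(t)f(t)^k$. A power series $h=\sum h_nt^n$ over $\mathbb R[\mathbf x]$ is an $\mathbf x$-Pólya frequency function if its Toeplitz matrix $[h_{i-j}]$ has all minors polynomials in $\mathbf x$ with nonnegative coefficients. Coefficientwise total positivity: all minors are polynomials with nonnegative coefficients; coefficientwise Hankel-total positivity of $(a_n)$: same for $[a_{i+j}]$. A convolution $z_n=\sum_kc_{n,k}s_kt_{n-k}$ preserves the Stieltjes moment property if $(z_n)$ is a Stieltjes moment sequence (of the form $\int_0^\infty x^nd\mu(x)$ with $\mu\ge0$) whenever $(s_n),(t_n)$ are. *)

theory Defs
  imports
    "HOL-Analysis.Analysis"
    "HOL-Computational_Algebra.Formal_Power_Series"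
    "HOL-Library.Poly_Mapping"
    "Jordan_Normal_Form.Determinant"
begin

subsection \<open>Polynomials in the indeterminates\<close>

text \<open>
  An \<open>'x rpoly\<close> is an element of the polynomial ring \<open>\<real>[x]\<close> whose indeterminates are the elements
  of \<open>'x\<close>.  The further indeterminates are adjoined one at a time: \<open>\<real>[x][\<lambda>]\<close> is \<open>'x rpoly poly\<close>
  and \<open>\<real>[x][\<lambda>][q]\<close> is \<open>'x rpoly poly poly\<close>.
\<close>

type_synonym 'x rpoly = "('x \<Rightarrow>\<^sub>0 nat) \<Rightarrow>\<^sub>0 real"

definition rconst :: "real \<Rightarrow> 'x rpoly" where
  "rconst c = Poly_Mapping.single 0 c"

definition rpoly_eval :: "('x \<Rightarrow> real) \<Rightarrow> 'x rpoly \<Rightarrow> real" where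
  "rpoly_eval v p =
    (\<Sum>m\<in>Poly_Mapping.keys p. Poly_Mapping.lookup p m *
      (\<Prod>i\<in>Poly_Mapping.keys m. v i ^ Poly_Mapping.lookup m i))"

definition nonneg_x :: "'x rpoly \<Rightarrow> bool" where
  "nonneg_x p \<longleftrightarrow> (\<forall>m. 0 \<le> Poly_Mapping.lookup p m)"

definition nonneg_lx :: "'x rpoly poly \<Rightarrow> bool" where
  "nonneg_lx p \<longleftrightarrow> (\<forall>i. nonneg_x (poly.coeff p i))"

definition nonneg_qlx :: "'x rpoly poly poly \<Rightarrow> bool" where
  "nonneg_qlx p \<longleftrightarrow> (\<forall>i. nonneg_lx (poly.coeff p i))"

text \<open>\<open>q\<^sup>n p(1/q)\<close>, for \<open>p\<close> of degree at most \<open>n\<close>.\<close>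

definition reversed_poly :: "nat \<Rightarrow> 'a::comm_monoid_add poly \<Rightarrow> 'a poly" where
  "reversed_poly n p = (\<Sum>i\<le>n. Polynomial.monom (poly.coeff p i) (n - i))"

lemma poly_reversed_poly:
  fixes p :: "'a::field poly"
  assumes "degree p \<le> n" "x \<noteq> 0"
  shows "poly (reversed_poly n p) x = x ^ n * poly p (1 / x)"
proof -
  have "poly p (1 / x) = (\<Sum>i\<le>n. poly.coeff p i * (1 / x) ^ i)"
    unfolding poly_altdef using assms(1)
    by (intro sum.mono_neutral_left) (auto simp: coeff_eq_0)
  then show ?thesis
    using assms(2)
    by (auto simp: reversed_poly_def poly_sum poly_monom sum_distrib_left power_diff field_simps
        intro!: sum.cong)
qed

subsection \<open>Total positivity\<close>

text \<open>
  \<open>P\<close> is the positivity condition on ring elements; \<open>r\<close> and \<open>c\<close> select the rows and columns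
  of a minor.
\<close>

definition totally_positive :: "('a::comm_ring_1 \<Rightarrow> bool) \<Rightarrow> (nat \<Rightarrow> nat \<Rightarrow> 'a) \<Rightarrow> bool" where
  "totally_positive P M \<longleftrightarrow>
    (\<forall>m r c. strict_mono_on {..<m} r \<and> strict_mono_on {..<m} c \<longrightarrow>
      P (Determinant.det (Matrix.mat m m (\<lambda>(i, j). M (r i) (c j)))))"

definition hankel_totally_positive :: "('a::comm_ring_1 \<Rightarrow> bool) \<Rightarrow> (nat \<Rightarrow> 'a) \<Rightarrow> bool" where
  "hankel_totally_positive P a \<longleftrightarrow> totally_positive P (\<lambda>i j. a (i + j))"

definition polya_frequency :: "'x rpoly fps \<Rightarrow> bool" where
  "polya_frequency h \<longleftrightarrow>
    totally_positive nonneg_x (\<lambda>i j. if j \<le> i then fps_nth h (i - j) else 0)"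

subsection \<open>Exponential Riordan arrays\<close>

text \<open>
  Since \<open>f'(0)\<close> need not be a unit of \<open>\<real>[x]\<close>, the compositional inverse of \<open>f\<close> has coefficients
  in a field containing \<open>\<real>[x]\<close>; \<open>map_fps\<close> along an embedding moves series into that field.
\<close>

definition map_fps :: "('a \<Rightarrow> 'b) \<Rightarrow> 'a fps \<Rightarrow> 'b fps" where
  "map_fps h F = Abs_fps (\<lambda>n. h (fps_nth F n))"

text \<open>The inclusion of \<open>\<real>[x][[t]]\<close> into \<open>\<real>[x][\<lambda>][[t]]\<close>.\<close>

definition lift_fps :: "'x rpoly fps \<Rightarrow> 'x rpoly poly fps" where
  "lift_fps = map_fps (\<lambda>a. [:a:])"

text \<open>The series \<open>e\<^bsup>\<lambda>t\<^esup>\<close> in \<open>\<real>[x][\<lambda>][[t]]\<close>.\<close>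

definition exp_lambda :: "'x rpoly poly fps" where
  "exp_lambda = Abs_fps (\<lambda>n. Polynomial.monom (rconst (1 / fact n)) n)"

definition exp_riordan ::
    "'x rpoly poly fps \<Rightarrow> 'x rpoly poly fps \<Rightarrow> nat \<Rightarrow> nat \<Rightarrow> 'x rpoly poly" where
  "exp_riordan g F n k = [:rconst (fact n / fact k):] * fps_nth (g * F ^ k) n"

text \<open>The series \<open>\<phi>(f(t)) e\<^bsup>\<lambda>f(t)\<^esup>\<close>.\<close>

definition gen_series :: "'x rpoly fps \<Rightarrow> 'x rpoly fps \<Rightarrow> 'x rpoly poly fps" where
  "gen_series \<phi> f =
    fps_compose (lift_fps \<phi>) (lift_fps f) * fps_compose exp_lambda (lift_fps f)"

definition R_entry :: "'x rpoly fps \<Rightarrow> 'x rpoly fps \<Rightarrow> nat \<Rightarrow> nat \<Rightarrow> 'x rpoly poly" where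
  "R_entry \<phi> f = exp_riordan (gen_series \<phi> f) (lift_fps f)"

text \<open>The sum stops at \<open>k = n\<close> since the array is lower triangular.\<close>

definition R_poly :: "'x rpoly fps \<Rightarrow> 'x rpoly fps \<Rightarrow> nat \<Rightarrow> 'x rpoly poly poly" where
  "R_poly \<phi> f n = (\<Sum>k\<le>n. Polynomial.monom (R_entry \<phi> f n k) k)"

definition T_poly :: "'x rpoly fps \<Rightarrow> 'x rpoly fps \<Rightarrow> nat \<Rightarrow> 'x rpoly poly" where
  "T_poly \<phi> f n = fact n * fps_nth (gen_series \<phi> f) n"

lemma R_entry_eq_0:
  assumes "fps_nth f 0 = 0" "n < k"
  shows "R_entry \<phi> f n k = 0"
proof -
  have "fps_nth (lift_fps f ^ k) i = 0" if "i \<le> n" for i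
    using assms that by (intro startsby_zero_power_prefix[rule_format])
      (auto simp: lift_fps_def map_fps_def)
  then show ?thesis
    by (simp add: R_entry_def exp_riordan_def fps_mult_nth)
qed

lemma degree_R_poly: "degree (R_poly \<phi> f n) \<le> n"
  unfolding R_poly_def by (intro degree_sum_le) (auto intro: order.trans[OF degree_monom_le])

lemma degree_T_poly: "degree (T_poly \<phi> f n) \<le> n"
proof -
  have mult: "degree (p * r) \<le> c" if "degree p \<le> a" "degree r \<le> b" "a + b \<le> c"
    for p r :: "'a rpoly poly" and a b c
    using degree_mult_le[of p r] that by linarith
  have lift: "degree (fps_nth (lift_fps F) i) \<le> 0" for F :: "'a rpoly fps" and i
    by (simp add: lift_fps_def map_fps_def)
  have pow: "degree (fps_nth (lift_fps f ^ k) i) \<le> 0" for k i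
  proof (induction k arbitrary: i)
    case (Suc k)
    show ?case
      unfolding power_Suc fps_mult_nth by (intro degree_sum_le mult[OF lift Suc]) simp_all
  qed simp
  have comp: "degree (fps_nth (fps_compose (lift_fps \<phi>) (lift_fps f)) i) \<le> 0" for i
    unfolding fps_compose_nth by (intro degree_sum_le mult[OF lift pow]) simp_all
  have e: "degree (fps_nth (fps_compose exp_lambda (lift_fps f)) i) \<le> i" for i
    unfolding fps_compose_nth exp_lambda_def fps_nth_Abs_fps
    by (intro degree_sum_le mult[OF degree_monom_le pow]) simp_all
  have "degree (fps_nth (gen_series \<phi> f) n) \<le> n"
    unfolding gen_series_def fps_mult_nth by (intro degree_sum_le mult[OF comp e]) simp_all
  moreover have "degree (fact n :: 'a rpoly poly) \<le> 0"
    by (metis degree_of_nat of_nat_fact order.refl)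
  ultimately show ?thesis
    unfolding T_poly_def by (intro mult[of _ 0 _ n]) simp_all
qed

subsection \<open>Stieltjes moment sequences\<close>

definition stieltjes_moment :: "(nat \<Rightarrow> real) \<Rightarrow> bool" where
  "stieltjes_moment s \<longleftrightarrow>
    (\<exists>\<mu> :: real measure. sets \<mu> = sets borel \<and> emeasure \<mu> {..<0} = 0 \<and>
      (\<forall>n. has_bochner_integral \<mu> (\<lambda>x. x ^ n) (s n)))"

definition preserves_stieltjes :: "(nat \<Rightarrow> nat \<Rightarrow> real) \<Rightarrow> bool" where
  "preserves_stieltjes c \<longleftrightarrow>
    (\<forall>s t. stieltjes_moment s \<and> stieltjes_moment t \<longrightarrow>
      stieltjes_moment (\<lambda>n. \<Sum>k\<le>n. c n k * s k * t (n - k)))"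

end

theory Submission
  imports
    Defs
    "HOL-Computational_Algebra.Fundamental_Theorem_Algebra"
    "HOL-Real_Asymp.Real_Asymp"
    "Jordan_Normal_Form.Char_Poly"
begin

text \<open>
  Since \<open>f' = \<phi>(f) \<psi>(f)\<close>, the row polynomials of the array \<open>(\<phi>(f) e\<^sup>\<lambda>\<^sup>f, f)\<close> arise by iterating the
  operator \<open>\<phi>(D) (\<lambda> + x) \<psi>(D)\<close> on the constant \<open>\<phi>(0)\<close>.  Its matrix is a product of two Toeplitz matrices,
  totally positive by hypothesis, and a bidiagonal one, so the array and the Hankel matrix of its first
  column are totally positive by Cauchy-Binet.  The homogeneous version \<open>\<phi>(D) (\<alpha> + \<beta> x) \<psi>(D)\<close> covers all
  the sequences of the theorem: \<open>(\<alpha>, \<beta>)\<close> is \<open>(\<lambda>, 1)\<close> for \<open>T\<close>, \<open>(1, \<lambda>)\<close> for its reversal, \<open>(\<lambda> + q, 1)\<close> for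
  \<open>R\<close>, \<open>(\<lambda>q + 1, q)\<close> for its reversal; \<open>f'\<close> itself is the case of the pair \<open>\<phi>\<psi>, 1\<close> with \<open>(0, 1)\<close>.

  For the convolution, \<open>(\<lambda>y + x, y)\<close> shows that \<open>\<Sum>k. R n k x^k y^(n - k)\<close> has nonnegative Hankel forms for
  all \<open>x, y \<ge> 0\<close>; integrating over \<open>x\<close> and \<open>y\<close>, so do the \<open>z n\<close>, and Stieltjes' theorem gives the
  measure.  The latter is proved by extending the moment functional, positive because polynomials
  nonnegative on the half-line are sums of squares \<open>a\<^sup>2 + x b\<^sup>2\<close>, to functions of polynomial growth.
\<close>

section \<open>The Cauchy-Binet formula\<close>

text \<open>The chain rule drives the recurrence: for \<Phi> = \<phi> X^m the derivative of
  \<Phi>(f) is \<Phi>'(f) f' = \<phi>(f) (\<psi> \<Phi>')(f). The factor \<phi>(f) reappears, and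
  expanding \<psi> \<Phi>' in powers of f expresses row n + 1 of the array through row n alone. This
  is why the array carries \<phi>(f) in front: it splits f' so that one frequency function stands on
  either side of the multiplication by \<alpha> + \<beta> x. The hypothesis on the compositional
  inverse lives in a field, since f'(0) need not be a unit. It yields f' = (\<phi> \<psi>)(f) there,
  and injectivity of the embedding brings this identity back to \<real>[x]. Positivity is abstracted
  to a predicate closed under sums and products, so that one argument covers the three polynomial
  rings and the real numbers; \<alpha> and \<beta> may be any elements satisfying the predicate.
  Minors are not linear in the sequence and cannot be integrated over x and y, whereas quadratic
  forms can. Hence the convolution passes from Hankel minors to forms, and must return from forms to
  a measure.\<close>

lemma det_mat_sum_rows:
  fixes A B :: "nat \<Rightarrow> nat \<Rightarrow> 'a::comm_ring_1"
  shows "Determinant.det (Matrix.mat m m (\<lambda>(i, j). \<Sum>k<N. A i k * B k j)) =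
    (\<Sum>f | (\<forall>i\<in>{0..<m}. f i \<in> {..<N}) \<and> (\<forall>i. i \<notin> {0..<m} \<longrightarrow> f i = i).
      (\<Prod>i\<in>{0..<m}. A i (f i)) * Determinant.det (Matrix.mat m m (\<lambda>(i, j). B (f i) j)))"
proof -
  let ?a = "\<lambda>i k. A i k \<cdot>\<^sub>v Matrix.vec m (B k)"
  have "Determinant.det (Matrix.mat m m (\<lambda>(i, j). \<Sum>k<N. A i k * B k j)) =
      Determinant.det (mat\<^sub>r m m (\<lambda>i. finsum_vec TYPE('a) m (?a i) {..<N}))"
    by (intro arg_cong[where f = Determinant.det] eq_matI)
      (auto simp: index_finsum_vec intro!: sum.cong)
  also have "\<dots> =
      (\<Sum>f | (\<forall>i\<in>{0..<m}. f i \<in> {..<N}) \<and> (\<forall>i. i \<notin> {0..<m} \<longrightarrow> f i = i).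
        Determinant.det (mat\<^sub>r m m (\<lambda>i. ?a i (f i))))"
    by (rule det_linear_rows_sum) auto
  also have "\<dots> = (\<Sum>f | (\<forall>i\<in>{0..<m}. f i \<in> {..<N}) \<and> (\<forall>i. i \<notin> {0..<m} \<longrightarrow> f i = i).
      (\<Prod>i\<in>{0..<m}. A i (f i)) * Determinant.det (Matrix.mat m m (\<lambda>(i, j). B (f i) j)))"
  proof (rule sum.cong[OF refl])
    fix f
    have "mat\<^sub>r m m (\<lambda>i. Matrix.vec m (B (f i))) = Matrix.mat m m (\<lambda>(i, j). B (f i) j)"
      by (rule eq_matI) simp_all
    moreover have "Determinant.det (mat\<^sub>r m m (\<lambda>i. ?a i (f i))) =
        (\<Prod>i\<in>{0..<m}. A i (f i)) * Determinant.det (mat\<^sub>r m m (\<lambda>i. Matrix.vec m (B (f i))))"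
      by (rule det_rows_mul) simp
    ultimately show "Determinant.det (mat\<^sub>r m m (\<lambda>i. ?a i (f i))) =
        (\<Prod>i\<in>{0..<m}. A i (f i)) * Determinant.det (Matrix.mat m m (\<lambda>(i, j). B (f i) j))"
      by (simp only:)
  qed
  finally show ?thesis .
qed

lemma strict_mono_on_nth_sorted_list_of_set:
  assumes "finite (I::nat set)"
  shows "strict_mono_on {..<card I} ((!) (sorted_list_of_set I))"
  using assms by (auto intro!: strict_mono_onI sorted_wrt_nth_less[of "(<)"])

lemma bij_betw_nth_sorted_list_of_set:
  assumes "finite (I::nat set)"
  shows "bij_betw ((!) (sorted_list_of_set I)) {..<card I} I"
  using assms by (intro bij_betw_nth) auto

text \<open>Expanding the rows by multilinearity gives one term for each map \<open>f\<close> from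
  rows to summation indices. Maps that are not injective repeat a row of \<open>B\<close> and
  contribute nothing; the others are grouped by their image \<open>I\<close>. Enumerating
  \<open>I\<close> increasingly produces exactly the minors that occur in
  \<open>totally_positive\<close>.\<close>

theorem Cauchy_Binet:
  fixes A B :: "nat \<Rightarrow> nat \<Rightarrow> 'a::comm_ring_1"
  shows "Determinant.det (Matrix.mat m m (\<lambda>(i, j). \<Sum>k<N. A i k * B k j)) =
    (\<Sum>I | I \<subseteq> {..<N} \<and> card I = m.
      Determinant.det (Matrix.mat m m (\<lambda>(i, j). A i (sorted_list_of_set I ! j))) *
      Determinant.det (Matrix.mat m m (\<lambda>(i, j). B (sorted_list_of_set I ! i) j)))"
proof -
  define a where "a f = (\<Prod>i\<in>{0..<m}. A i (f i))" for f
  define D where "D f = Determinant.det (Matrix.mat m m (\<lambda>(i, j). B (f i) j))" for f :: "nat \<Rightarrow> nat"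
  define F where "F = {f. (\<forall>i\<in>{0..<m}. f i \<in> {..<N}) \<and> (\<forall>i. i \<notin> {0..<m} \<longrightarrow> f i = (i::nat))}"
  define \<I> where "\<I> = {I. I \<subseteq> {..<N} \<and> card I = m}"
  have finF: "finite F"
    unfolding F_def by (rule finite_bounded_functions) auto
  have fin\<I>: "finite \<I>"
    unfolding \<I>_def by simp
  have D0: "D f = 0" if ninj: "\<not> inj_on f {0..<m}" for f
  proof -
    obtain i j where "i < m" "j < m" "i \<noteq> j" "f i = f j"
      using ninj unfolding inj_on_def by auto
    then show ?thesis
      unfolding D_def by (intro det_identical_rows[where i = i and j = j] eq_vecI) simp_all
  qed
  \<comment> \<open>A map with image \<open>I\<close> is the increasing enumeration of
    \<open>I\<close> after a permutation. Sorting the rows of \<open>B\<close> costs its sign, and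
    the signed products of entries of \<open>A\<close> sum to the Leibniz formula of a
    minor.\<close>
  have group: "(\<Sum>f | f \<in> F \<and> inj_on f {0..<m} \<and> f ` {0..<m} = I. a f * D f) =
      Determinant.det (Matrix.mat m m (\<lambda>(i, j). A i (sorted_list_of_set I ! j))) * D ((!) (sorted_list_of_set I))"
    if "I \<in> \<I>" for I
  proof -
    let ?s = "(!) (sorted_list_of_set I)"
    have I: "I \<subseteq> {..<N}" "card I = m" "finite I"
      using that finite_subset by (auto simp: \<I>_def)
    have bij: "bij_betw ?s {0..<m} I"
      using bij_betw_nth_sorted_list_of_set[OF I(3)] I(2) by (simp add: lessThan_atLeast0)
    \<comment> \<open>\<open>g\<close> and \<open>h\<close> are mutually inverse translations
      between permutations and injections with image \<open>I\<close>. Both are the identity from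
      \<open>m\<close> on, as \<open>F\<close> and \<open>permutes\<close> require.\<close>
    define g where "g p = (\<lambda>i. if i < m then ?s (p i) else i)" for p :: "nat \<Rightarrow> nat"
    define h where "h f = (\<lambda>i. if i < m then inv_into {0..<m} ?s (f i) else i)" for f :: "nat \<Rightarrow> nat"
    have "(\<Sum>f | f \<in> F \<and> inj_on f {0..<m} \<and> f ` {0..<m} = I. a f * D f) =
        (\<Sum>p | p permutes {0..<m}. a (g p) * D (g p))"
    proof (rule sum.reindex_bij_witness[of _ g h])
      fix f assume f: "f \<in> {f. f \<in> F \<and> inj_on f {0..<m} \<and> f ` {0..<m} = I}"
      then have fb: "bij_betw f {0..<m} I" by (auto simp: bij_betw_def)
      show "g (h f) = f"
      proof
        fix i
        show "g (h f) i = f i"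
        proof (cases "i < m")
          case True
          then have "f i \<in> I" using bij_betwE[OF fb] by auto
          then have "inv_into {0..<m} ?s (f i) < m" "?s (inv_into {0..<m} ?s (f i)) = f i"
            using bij_betwE[OF bij_betw_inv_into[OF bij]] bij_betw_inv_into_right[OF bij] by auto
          then show ?thesis using True by (simp add: g_def h_def)
        next
          case False
          then show ?thesis using f by (simp add: g_def h_def F_def)
        qed
      qed
      have "bij_betw (inv_into {0..<m} ?s \<circ> f) {0..<m} {0..<m}"
        using fb bij_betw_inv_into[OF bij] by (rule bij_betw_trans)
      then have "bij_betw (h f) {0..<m} {0..<m}"
        by (rule bij_betw_cong[THEN iffD1, rotated]) (auto simp: h_def)
      then show "h f \<in> {p. p permutes {0..<m}}"
        by (auto intro!: bij_imp_permutes simp: h_def)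
      show "a (g (h f)) * D (g (h f)) = a f * D f"
        using \<open>g (h f) = f\<close> by simp
    next
      fix p assume p: "p \<in> {p. p permutes {0..<m}}"
      then have pb: "bij_betw p {0..<m} {0..<m}" by (auto simp: permutes_imp_bij)
      show "h (g p) = p"
      proof
        fix i show "h (g p) i = p i"
        proof (cases "i < m")
          case True
          then have "p i \<in> {0..<m}" using bij_betwE[OF pb] by auto
          then show ?thesis
            using True bij_betw_inv_into_left[OF bij] by (simp add: g_def h_def)
        next
          case False
          then show ?thesis using p by (simp add: g_def h_def permutes_def)
        qed
      qed
      have "bij_betw (?s \<circ> p) {0..<m} I"
        using pb bij by (rule bij_betw_trans)
      then have "bij_betw (g p) {0..<m} I"
        by (rule bij_betw_cong[THEN iffD1, rotated]) (auto simp: g_def)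
      then show "g p \<in> {f. f \<in> F \<and> inj_on f {0..<m} \<and> f ` {0..<m} = I}"
        using I(1) bij_betwE[of "g p" "{0..<m}" I] by (auto simp: bij_betw_def F_def g_def)
    qed
    also have "\<dots> = (\<Sum>p | p permutes {0..<m}.
        (signof p * (\<Prod>i\<in>{0..<m}. A i (?s (p i)))) * D ?s)"
    proof (rule sum.cong[OF refl])
      fix p assume "p \<in> {p. p permutes {0..<m}}"
      then have p: "p permutes {0..<m}" by simp
      have "D (g p) = Determinant.det (Matrix.mat m m
          (\<lambda>(i, j). Matrix.mat m m (\<lambda>(i, j). B (?s i) j) $$ (p i, j)))"
        unfolding D_def
        by (intro arg_cong[where f = Determinant.det] eq_matI)
          (use permutes_in_image[OF p] in \<open>auto simp: g_def\<close>)
      also have "\<dots> = signof p * D ?s"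
        unfolding D_def by (rule det_permute_rows[OF _ p]) simp
      finally have "D (g p) = signof p * D ?s" .
      moreover have "a (g p) = (\<Prod>i\<in>{0..<m}. A i (?s (p i)))"
        by (auto simp: a_def g_def)
      ultimately show "a (g p) * D (g p) = (signof p * (\<Prod>i\<in>{0..<m}. A i (?s (p i)))) * D ?s"
        by (simp add: ac_simps)
    qed
    also have "\<dots> = Determinant.det (Matrix.mat m m (\<lambda>(i, j). A i (?s j))) * D ?s"
    proof -
      have "Determinant.det (Matrix.mat m m (\<lambda>(i, j). A i (?s j))) =
          (\<Sum>p | p permutes {0..<m}. signof p * (\<Prod>i\<in>{0..<m}. A i (?s (p i))))"
        by (subst det_def'[of _ m])
          (auto intro!: sum.cong prod.cong arg_cong2[where f = "(*)"] dest: permutes_in_image)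
      then show ?thesis by (simp add: sum_distrib_right)
    qed
    finally show ?thesis .
  qed
  have "Determinant.det (Matrix.mat m m (\<lambda>(i, j). \<Sum>k<N. A i k * B k j)) = (\<Sum>f\<in>F. a f * D f)"
    unfolding det_mat_sum_rows F_def a_def D_def ..
  also have "\<dots> = (\<Sum>f | f \<in> F \<and> inj_on f {0..<m}. a f * D f)"
    using finF D0 by (intro sum.mono_neutral_right) auto
  also have "\<dots> = (\<Sum>I\<in>\<I>. \<Sum>f | f \<in> {f \<in> F. inj_on f {0..<m}} \<and> f ` {0..<m} = I. a f * D f)"
  proof (rule sum.group[symmetric])
    show "(\<lambda>f. f ` {0..<m}) ` {f \<in> F. inj_on f {0..<m}} \<subseteq> \<I>"
      by (auto simp: \<I>_def F_def card_image)
  qed (use finF fin\<I> in auto)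
  also have "\<dots> = (\<Sum>I\<in>\<I>. Determinant.det (Matrix.mat m m (\<lambda>(i, j). A i (sorted_list_of_set I ! j))) * D ((!) (sorted_list_of_set I)))"
    by (intro sum.cong refl, subst group[symmetric]) (auto simp: conj_assoc)
  finally show ?thesis
    by (simp only: \<I>_def D_def)
qed

section \<open>Total positivity and production matrices\<close>

lemma strict_mono_on_shift:
  "strict_mono_on {..<Suc m} r \<Longrightarrow> strict_mono_on {..<m} (\<lambda>i. r (Suc i))"
  by (auto simp: strict_mono_on_def)

lemma strict_mono_on_pred:
  fixes r :: "nat \<Rightarrow> nat"
  assumes "strict_mono_on {..<m} r" "\<And>i. i < m \<Longrightarrow> 0 < r i"
  shows "strict_mono_on {..<m} (\<lambda>i. r i - 1)"
proof (rule strict_mono_onI)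
  fix i j assume "i \<in> {..<m}" "j \<in> {..<m}" "i < j"
  then show "r i - 1 < r j - 1"
    using strict_mono_onD[OF assms(1), of i j] assms(2)[of i] by auto
qed

lemma det_mat_cong:
  assumes "\<And>i j. i < m \<Longrightarrow> j < m \<Longrightarrow> G i j = H i j"
  shows "Determinant.det (Matrix.mat m m (\<lambda>(i, j). G i j)) =
    Determinant.det (Matrix.mat m m (\<lambda>(i, j). H i j))"
  by (intro arg_cong[where f = Determinant.det] eq_matI) (simp_all add: assms)

lemma det_mat_transpose:
  fixes G :: "nat \<Rightarrow> nat \<Rightarrow> 'a::comm_ring_1"
  shows "Determinant.det (Matrix.mat m m (\<lambda>(i, j). G j i)) =
    Determinant.det (Matrix.mat m m (\<lambda>(i, j). G i j))"
proof -
  have "Matrix.mat m m (\<lambda>(i, j). G j i) = transpose_mat (Matrix.mat m m (\<lambda>(i, j). G i j))"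
    by (rule eq_matI) simp_all
  then show ?thesis by (simp only: det_transpose[of _ m] mat_carrier)
qed

lemma det_mat_first_row:
  fixes G :: "nat \<Rightarrow> nat \<Rightarrow> 'a::comm_ring_1"
  assumes "\<And>j. 0 < j \<Longrightarrow> j \<le> m \<Longrightarrow> G 0 j = 0"
  shows "Determinant.det (Matrix.mat (Suc m) (Suc m) (\<lambda>(i, j). G i j)) =
    G 0 0 * Determinant.det (Matrix.mat m m (\<lambda>(i, j). G (Suc i) (Suc j)))"
proof -
  let ?A = "Matrix.mat (Suc m) (Suc m) (\<lambda>(i, j). G i j)"
  have "Determinant.det ?A = (\<Sum>j<Suc m. ?A $$ (0, j) * cofactor ?A 0 j)"
    by (rule laplace_expansion_row) simp_all
  also have "\<dots> = (\<Sum>j\<in>{0}. ?A $$ (0, j) * cofactor ?A 0 j)"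
    using assms by (intro sum.mono_neutral_right) auto
  finally have "Determinant.det ?A = G 0 0 * cofactor ?A 0 0" by simp
  moreover have "cofactor ?A 0 0 = Determinant.det (Matrix.mat m m (\<lambda>(i, j). G (Suc i) (Suc j)))"
    unfolding cofactor_def mat_delete_def
    by (simp, intro arg_cong[where f = Determinant.det] eq_matI) simp_all
  ultimately show ?thesis by simp
qed

lemma det_mat_first_column:
  fixes G :: "nat \<Rightarrow> nat \<Rightarrow> 'a::comm_ring_1"
  assumes "\<And>i. 0 < i \<Longrightarrow> i \<le> m \<Longrightarrow> G i 0 = 0"
  shows "Determinant.det (Matrix.mat (Suc m) (Suc m) (\<lambda>(i, j). G i j)) =
    G 0 0 * Determinant.det (Matrix.mat m m (\<lambda>(i, j). G (Suc i) (Suc j)))"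
  using det_mat_first_row[of m "\<lambda>i j. G j i"] assms
  by (simp add: det_mat_transpose[of _ G] det_mat_transpose[of _ "\<lambda>i j. G (Suc i) (Suc j)"])

lemma det_mat_zero_row:
  fixes G :: "nat \<Rightarrow> nat \<Rightarrow> 'a::comm_ring_1"
  assumes "i < m" "\<And>j. j < m \<Longrightarrow> G i j = 0"
  shows "Determinant.det (Matrix.mat m m (\<lambda>(i, j). G i j)) = 0"
  by (subst laplace_expansion_row[of _ m i]) (use assms in auto)

lemma totally_positive_cong:
  "(\<And>i j. M i j = M' i j) \<Longrightarrow> totally_positive P M \<longleftrightarrow> totally_positive P M'"
  by presburger

lemma totally_positive_transpose:
  assumes "totally_positive P M"
  shows "totally_positive P (\<lambda>i j. M j i)"
  unfolding totally_positive_def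
proof (intro allI impI)
  fix m :: nat and r c :: "nat \<Rightarrow> nat"
  assume "strict_mono_on {..<m} r \<and> strict_mono_on {..<m} c"
  then show "P (Determinant.det (Matrix.mat m m (\<lambda>(i, j). M (c j) (r i))))"
    using assms det_mat_transpose[of m "\<lambda>i j. M (c i) (r j)"] by (simp add: totally_positive_def)
qed

text \<open>Determinants commute with ring homomorphisms. This carries the hypothesis on \<phi> and
  \<psi> from \<real>[x] to larger polynomial rings and to numbers.\<close>

lemma totally_positive_hom:
  assumes "totally_positive P M" "comm_ring_hom \<theta>" "\<And>a. P a \<Longrightarrow> P' (\<theta> a)"
  shows "totally_positive P' (\<lambda>i j. \<theta> (M i j))"
  unfolding totally_positive_def
proof (intro allI impI)
  fix m :: nat and r c :: "nat \<Rightarrow> nat" assume rc: "strict_mono_on {..<m} r \<and> strict_mono_on {..<m} c"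
  interpret comm_ring_hom \<theta> by fact
  have "Determinant.det (Matrix.mat m m (\<lambda>(i, j). \<theta> (M (r i) (c j)))) =
      Determinant.det (map_mat \<theta> (Matrix.mat m m (\<lambda>(i, j). M (r i) (c j))))"
    by (intro arg_cong[where f = Determinant.det] eq_matI) simp_all
  also have "\<dots> = \<theta> (Determinant.det (Matrix.mat m m (\<lambda>(i, j). M (r i) (c j))))"
    by (rule hom_det)
  finally show "P' (Determinant.det (Matrix.mat m m (\<lambda>(i, j). \<theta> (M (r i) (c j)))))"
    using assms(1,3) rc by (simp add: totally_positive_def)
qed

text \<open>A minor meets only finitely many rows. The reduction allows induction on the number of
  rows of an infinite matrix.\<close>

lemma totally_positive_truncated:
  assumes "\<And>N. totally_positive P (\<lambda>i j. if i < N then M i j else 0)"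
  shows "totally_positive P M"
  unfolding totally_positive_def
proof (intro allI impI)
  fix m :: nat and r c :: "nat \<Rightarrow> nat" assume rc: "strict_mono_on {..<m} r \<and> strict_mono_on {..<m} c"
  define N where "N = Suc (\<Sum>i<m. r i)"
  have "r i < N" if "i < m" for i
    using member_le_sum[of i "{..<m}" r] that by (simp add: N_def less_Suc_eq_le)
  then have "Determinant.det (Matrix.mat m m (\<lambda>(i, j). M (r i) (c j))) =
      Determinant.det (Matrix.mat m m (\<lambda>(i, j). if r i < N then M (r i) (c j) else 0))"
    by (intro det_mat_cong) simp
  then show "P (Determinant.det (Matrix.mat m m (\<lambda>(i, j). M (r i) (c j))))"
    using assms[of N] rc by (simp add: totally_positive_def)
qed

text \<open>Neither an order nor closure under subtraction is asked, so coefficientwise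
  nonnegativity in several polynomial rings and the usual order on the reals are instances
  alike.\<close>

locale nonneg_cone =
  fixes P :: "'a::comm_ring_1 \<Rightarrow> bool"
  assumes zero: "P 0" and one: "P 1"
    and add: "P a \<Longrightarrow> P b \<Longrightarrow> P (a + b)" and mult: "P a \<Longrightarrow> P b \<Longrightarrow> P (a * b)"
begin

lemma sum: "(\<And>i. i \<in> I \<Longrightarrow> P (g i)) \<Longrightarrow> P (sum g I)"
  by (induction I rule: infinite_finite_induct) (auto intro: zero add)

lemma prod: "(\<And>i. i \<in> I \<Longrightarrow> P (g i)) \<Longrightarrow> P (prod g I)"
  by (induction I rule: infinite_finite_induct) (auto intro: one mult)

lemma of_nat: "P (of_nat n)"
  by (induction n) (auto intro: zero one add)

text \<open>Cauchy-Binet writes a minor of the product as a sum of products of minors. The bound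
  \<open>b\<close> on the row supports of \<open>A\<close> makes the product of infinite matrices a
  finite sum; within one minor all rows are extended to the common bound \<open>N\<close>.\<close>

lemma totally_positive_mult:
  assumes A: "totally_positive P A" and B: "totally_positive P B"
    and b: "\<And>i k. b i \<le> k \<Longrightarrow> A i k = 0"
  shows "totally_positive P (\<lambda>i j. \<Sum>k<b i. A i k * B k j)"
  unfolding totally_positive_def
proof (intro allI impI)
  fix m and r c :: "nat \<Rightarrow> nat"
  assume rc: "strict_mono_on {..<m} r \<and> strict_mono_on {..<m} c"
  define N where "N = (\<Sum>i<m. b (r i))"
  have N: "b (r i) \<le> N" if "i < m" for i
    using member_le_sum[of i "{..<m}" "\<lambda>i. b (r i)"] that by (simp add: N_def)
  have "Determinant.det (Matrix.mat m m (\<lambda>(i, j). \<Sum>k<b (r i). A (r i) k * B k (c j))) =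
      Determinant.det (Matrix.mat m m (\<lambda>(i, j). \<Sum>k<N. A (r i) k * B k (c j)))"
    using N b by (intro det_mat_cong sum.mono_neutral_left) (auto simp: not_less dest: order.strict_trans2)
  also have "\<dots> = (\<Sum>I | I \<subseteq> {..<N} \<and> card I = m.
      Determinant.det (Matrix.mat m m (\<lambda>(i, j). A (r i) (sorted_list_of_set I ! j))) *
      Determinant.det (Matrix.mat m m (\<lambda>(i, j). B (sorted_list_of_set I ! i) (c j))))"
    by (rule Cauchy_Binet)
  also have "P \<dots>"
  proof (rule sum, rule mult)
    fix I assume "I \<in> {I. I \<subseteq> {..<N} \<and> card I = m}"
    then have "strict_mono_on {..<m} ((!) (sorted_list_of_set I))"
      using strict_mono_on_nth_sorted_list_of_set[of I] finite_subset[of I "{..<N}"] by auto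
    then show "P (Determinant.det (Matrix.mat m m (\<lambda>(i, j). A (r i) (sorted_list_of_set I ! j))))"
      "P (Determinant.det (Matrix.mat m m (\<lambda>(i, j). B (sorted_list_of_set I ! i) (c j))))"
      using A B rc by (simp_all add: totally_positive_def)
  qed
  finally show "P (Determinant.det (Matrix.mat m m (\<lambda>(i, j). \<Sum>k<b (r i). A (r i) k * B k (c j))))" .
qed

text \<open>Serves for the factor \<open>1 / k!\<close> by which the array differs from the iterates
  of the production matrix.\<close>

lemma totally_positive_scale_columns:
  assumes "totally_positive P M" "\<And>j. P (d j)"
  shows "totally_positive P (\<lambda>i j. d j * M i j)"
  unfolding totally_positive_def
proof (intro allI impI)
  fix m and r c :: "nat \<Rightarrow> nat"
  assume rc: "strict_mono_on {..<m} r \<and> strict_mono_on {..<m} c"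
  have "Determinant.det (Matrix.mat m m (\<lambda>(i, j). d (c j) * M (r i) (c j))) =
      Determinant.det (Matrix.mat m m (\<lambda>(i, j). d (c i) * M (r j) (c i)))"
    by (rule det_mat_transpose)
  also have "\<dots> = Determinant.det (mat\<^sub>r m m (\<lambda>i. d (c i) \<cdot>\<^sub>v Matrix.vec m (\<lambda>j. M (r j) (c i))))"
    by (intro arg_cong[where f = Determinant.det] eq_matI) simp_all
  also have "\<dots> = (\<Prod>i\<in>{0..<m}. d (c i)) *
      Determinant.det (mat\<^sub>r m m (\<lambda>i. Matrix.vec m (\<lambda>j. M (r j) (c i))))"
    by (rule det_rows_mul) simp
  also have "Determinant.det (mat\<^sub>r m m (\<lambda>i. Matrix.vec m (\<lambda>j. M (r j) (c i)))) =
      Determinant.det (Matrix.mat m m (\<lambda>(i, j). M (r j) (c i)))"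
    by (intro arg_cong[where f = Determinant.det] eq_matI) simp_all
  also have "\<dots> = Determinant.det (Matrix.mat m m (\<lambda>(i, j). M (r i) (c j)))"
    by (rule det_mat_transpose)
  finally show "P (Determinant.det (Matrix.mat m m (\<lambda>(i, j). d (c j) * M (r i) (c j))))"
    using assms rc by (simp add: totally_positive_def mult prod)
qed

text \<open>Every minor is a product of entries. If \<open>c 0 \<le> r 0\<close>, column
  \<open>c 0\<close> vanishes in all later rows; otherwise row \<open>r 0\<close> vanishes in all
  later columns. Either way the expansion leaves one entry times a minor of the same kind.\<close>

lemma totally_positive_bidiagonal:
  assumes "\<And>i. P (a i)" "\<And>i. P (b i)"
  shows "totally_positive P (\<lambda>i j. if j = i then a i else if j = Suc i then b i else 0)"
proof -
  define M where "M i j = (if j = i then a i else if j = Suc i then b i else 0)" for i j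
  have "P (Determinant.det (Matrix.mat m m (\<lambda>(i, j). M (r i) (c j))))"
    if "strict_mono_on {..<m} r" "strict_mono_on {..<m} c" for m r c
    using that
  proof (induction m arbitrary: r c)
    case 0
    then show ?case by (simp add: one)
  next
    case (Suc m)
    have IH: "P (Determinant.det (Matrix.mat m m (\<lambda>(i, j). M (r (Suc i)) (c (Suc j)))))"
      by (intro Suc.IH strict_mono_on_shift Suc.prems)
    have r: "r 0 < r i" if "0 < i" "i \<le> m" for i
      using that Suc.prems(1) by (auto simp: strict_mono_on_def)
    have c: "c 0 < c i" if "0 < i" "i \<le> m" for i
      using that Suc.prems(2) by (auto simp: strict_mono_on_def)
    have PM: "P (M i j)" for i j
      using assms by (simp add: M_def zero)
    have "Determinant.det (Matrix.mat (Suc m) (Suc m) (\<lambda>(i, j). M (r i) (c j))) =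
        M (r 0) (c 0) * Determinant.det (Matrix.mat m m (\<lambda>(i, j). M (r (Suc i)) (c (Suc j))))"
    proof (cases "c 0 \<le> r 0")
      case True
      have "M (r i) (c 0) = 0" if "0 < i" "i \<le> m" for i
        using r[OF that] True by (simp add: M_def)
      then show ?thesis
        by (rule det_mat_first_column)
    next
      case False
      have "M (r 0) (c j) = 0" if "0 < j" "j \<le> m" for j
        using c[OF that] False by (simp add: M_def)
      then show ?thesis
        by (rule det_mat_first_row)
    qed
    then show ?case
      using IH PM by (simp add: mult)
  qed
  then show ?thesis
    by (simp add: totally_positive_def M_def)
qed

text \<open>In a minor that uses the new top row, all columns but the first have positive index, so
  that row has at most its first entry and the expansion leaves a minor of \<open>M\<close>.\<close>

lemma totally_positive_stack:
  assumes "totally_positive P M" "P \<kappa>"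
  shows "totally_positive P (\<lambda>i j. case i of 0 \<Rightarrow> if j = 0 then \<kappa> else 0 | Suc i \<Rightarrow> M i j)"
  unfolding totally_positive_def
proof (intro allI impI, elim conjE)
  fix m and r c :: "nat \<Rightarrow> nat"
  assume r: "strict_mono_on {..<m} r" and c: "strict_mono_on {..<m} c"
  let ?S = "\<lambda>i j. case i of 0 \<Rightarrow> if j = 0 then \<kappa> else 0 | Suc i \<Rightarrow> M i j"
  have S: "?S (r' i) j = M (r' i - 1) j" if "0 < r' i" for r' :: "nat \<Rightarrow> nat" and i j
    using that by (cases "r' i") auto
  have pos: "P (Determinant.det (Matrix.mat m m (\<lambda>(i, j). ?S (r i) (c j))))"
    if "\<And>i. i < m \<Longrightarrow> 0 < r i" "strict_mono_on {..<m} r" "strict_mono_on {..<m} c"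
    for m r and c :: "nat \<Rightarrow> nat"
  proof -
    have "Determinant.det (Matrix.mat m m (\<lambda>(i, j). ?S (r i) (c j))) =
        Determinant.det (Matrix.mat m m (\<lambda>(i, j). M (r i - 1) (c j)))"
      using that S by (intro det_mat_cong) blast
    then show ?thesis
      using assms(1) strict_mono_on_pred[OF that(2,1)] that(3) by (simp add: totally_positive_def)
  qed
  show "P (Determinant.det (Matrix.mat m m (\<lambda>(i, j). ?S (r i) (c j))))"
  proof (cases m)
    case 0
    then show ?thesis by (simp add: one)
  next
    case (Suc n)
    have r0: "r 0 < r i" if "0 < i" "i < m" for i
      using that r by (auto simp: strict_mono_on_def)
    have c0: "c 0 < c i" if "0 < i" "i < m" for i
      using that c by (auto simp: strict_mono_on_def)
    show ?thesis
    proof (cases "r 0 = 0")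
      case True
      have "?S (r 0) (c j) = 0" if "0 < j" "j \<le> n" for j
        using c0[of j] that Suc True by simp
      then have "Determinant.det (Matrix.mat (Suc n) (Suc n) (\<lambda>(i, j). ?S (r i) (c j))) =
          ?S (r 0) (c 0) * Determinant.det (Matrix.mat n n (\<lambda>(i, j). ?S (r (Suc i)) (c (Suc j))))"
        by (rule det_mat_first_row)
      moreover have "P (Determinant.det (Matrix.mat n n (\<lambda>(i, j). ?S (r (Suc i)) (c (Suc j)))))"
      proof (rule pos)
        show "0 < r (Suc i)" if "i < n" for i
          using r0[of "Suc i"] that Suc by simp
      qed (use r c Suc strict_mono_on_shift in auto)
      moreover have "P (?S (r 0) (c 0))"
        using True assms(2) by (simp add: zero)
      ultimately show ?thesis
        using Suc by (simp only: mult)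
    next
      case False
      have "0 < r i" if "i < m" for i
        using r0[of i] that False by (cases "i = 0") auto
      then show ?thesis
        using pos r c by blast
    qed
  qed
qed

lemma totally_positive_zero: "totally_positive P (\<lambda>i j. 0)"
  unfolding totally_positive_def
proof (intro allI impI)
  fix m
  show "P (Determinant.det (Matrix.mat m m (\<lambda>(i, j). 0)))"
    using det_mat_zero_row[of 0 m "\<lambda>i j. 0::'a"] by (cases "m = 0") (simp_all add: zero one)
qed

section \<open>Production matrices: total positivity of the generated array and of its Hankel
  matrix\<close>

context
  fixes Q U :: "nat \<Rightarrow> nat \<Rightarrow> 'a" and \<kappa> :: 'a
  assumes Q: "totally_positive P Q" and Q_hessenberg: "\<And>i j. Suc i < j \<Longrightarrow> Q i j = 0"
    and \<kappa>: "P \<kappa>"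
    and U_0: "\<And>k. U 0 k = (if k = 0 then \<kappa> else 0)"
    and U_Suc: "\<And>n k. U (Suc n) k = (\<Sum>i<Suc n. U n i * Q i k)"
begin

lemma production_lower_triangular: "n < k \<Longrightarrow> U n k = 0"
  by (cases n) (auto simp: U_0 U_Suc Q_hessenberg intro!: sum.neutral)

text \<open>Row \<open>n\<close> of \<open>U\<close> is \<kappa> times the first row of the
  \<open>n\<close>-th power of \<open>Q\<close>. So \<open>U\<close> is the row (\<kappa>, 0, 0,
  ...) stacked on \<open>U\<close> times \<open>Q\<close>, and its first \<open>N + 1\<close> rows
  arise from its first \<open>N\<close> rows by one product and one stacking.\<close>

lemma totally_positive_production: "totally_positive P U"
proof (rule totally_positive_truncated)
  fix N
  show "totally_positive P (\<lambda>i j. if i < N then U i j else 0)"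
  proof (induction N)
    case 0
    then show ?case by (simp add: totally_positive_zero)
  next
    case (Suc N)
    let ?V = "\<lambda>i j. if i < N then U i j else 0"
    have "totally_positive P (\<lambda>i j. \<Sum>k<Suc i. ?V i k * Q k j)"
      by (rule totally_positive_mult[OF Suc Q]) (auto simp: production_lower_triangular)
    from totally_positive_stack[OF this \<kappa>] show ?case
      by (rule totally_positive_cong[THEN iffD1, rotated]) (auto simp: U_0 U_Suc split: nat.split)
  qed
qed

text \<open>Entry \<open>k\<close> of the first column of the \<open>m\<close>-th power of
  \<open>Q\<close>.\<close>

primrec production_column :: "nat \<Rightarrow> nat \<Rightarrow> 'a" where
  "production_column 0 k = (if k = 0 then 1 else 0)"
| "production_column (Suc m) k = (\<Sum>j<Suc (Suc k). Q k j * production_column m j)"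

text \<open>The counterpart of the argument for \<open>U\<close>, with multiplication by
  \<open>Q\<close> from the left: after transposition each new column becomes a row, and stacking
  applies.\<close>

lemma totally_positive_production_column:
  "totally_positive P (\<lambda>k m. production_column m k)"
proof (rule totally_positive_transpose, rule totally_positive_truncated)
  fix N
  show "totally_positive P (\<lambda>i j. if i < N then production_column i j else 0)"
  proof (induction N)
    case 0
    then show ?case by (simp add: totally_positive_zero)
  next
    case (Suc N)
    let ?V = "\<lambda>i j. if i < N then production_column i j else 0"
    have "totally_positive P (\<lambda>k m. \<Sum>j<Suc (Suc k). Q k j * ?V m j)"
      using totally_positive_transpose[OF Suc] by (intro totally_positive_mult Q) (auto simp: Q_hessenberg)
    then have "totally_positive P (\<lambda>m k. \<Sum>j<Suc (Suc k). Q k j * ?V m j)"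
      by (rule totally_positive_transpose)
    from totally_positive_stack[OF this one] show ?case
      by (rule totally_positive_cong[THEN iffD1, rotated]) (auto split: nat.split)
  qed
qed

text \<open>Splitting the power n + m of \<open>Q\<close>: row \<open>n\<close> of \<open>U\<close>
  holds the first n factors, the column holds the other m. The Hankel matrix of the first column of
  \<open>U\<close> is thereby a product of two totally positive matrices.\<close>

lemma production_add:
  "U (n + m) 0 = (\<Sum>k<Suc n. U n k * production_column m k)"
proof (induction m arbitrary: n)
  case 0
  have "(\<Sum>k<Suc n. U n k * production_column 0 k) = (\<Sum>k\<in>{0}. U n k * production_column 0 k)"
    by (intro sum.mono_neutral_right) auto
  then show ?case by simp
next
  case (Suc m)
  have "(\<Sum>k<Suc n. U n k * production_column (Suc m) k) =
      (\<Sum>k<Suc n. \<Sum>j<Suc (Suc n). U n k * Q k j * production_column m j)"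
  proof (rule sum.cong[OF refl])
    fix k assume "k \<in> {..<Suc n}"
    then have "(\<Sum>j<Suc (Suc k). Q k j * production_column m j) =
        (\<Sum>j<Suc (Suc n). Q k j * production_column m j)"
      by (intro sum.mono_neutral_left) (auto simp: Q_hessenberg)
    then show "U n k * production_column (Suc m) k =
        (\<Sum>j<Suc (Suc n). U n k * Q k j * production_column m j)"
      by (simp only: production_column.simps sum_distrib_left mult.assoc)
  qed
  also have "\<dots> = (\<Sum>j<Suc (Suc n). U (Suc n) j * production_column m j)"
    by (subst sum.swap) (simp only: U_Suc sum_distrib_right)
  finally show ?case
    using Suc[of "Suc n"] by simp
qed

theorem hankel_totally_positive_production: "hankel_totally_positive P (\<lambda>n. U n 0)"
  unfolding hankel_totally_positive_def production_add
  by (rule totally_positive_mult[OF totally_positive_production totally_positive_production_column])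
    (simp add: production_lower_triangular)

end

end

section \<open>Positive quadratic forms and sums of squares\<close>

text \<open>One step of Gaussian elimination as a factorization: \<open>l\<close> is unit lower
  triangular with multipliers only in its first column, and \<open>u\<close> has its first column
  cleared below the pivot.\<close>

lemma det_mat_Schur_complement:
  fixes G :: "nat \<Rightarrow> nat \<Rightarrow> 'a::field"
  assumes "G 0 0 \<noteq> 0"
  shows "Determinant.det (Matrix.mat (Suc m) (Suc m) (\<lambda>(i, j). G i j)) =
    G 0 0 * Determinant.det (Matrix.mat m m
      (\<lambda>(i, j). G (Suc i) (Suc j) - G (Suc i) 0 * G 0 (Suc j) / G 0 0))"
proof -
  define l where "l i j = (if i = j then 1 else if j = 0 then G i 0 / G 0 0 else 0)" for i j :: nat
  define u where "u i j = (if i = 0 then G 0 j else if j = 0 then 0 else G i j - G i 0 * G 0 j / G 0 0)" for i j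
  let ?L = "Matrix.mat (Suc m) (Suc m) (\<lambda>(i, j). l i j)"
  let ?U = "Matrix.mat (Suc m) (Suc m) (\<lambda>(i, j). u i j)"
  have prod: "(\<Sum>k<Suc m. l i k * u k j) = G i j" if "i < Suc m" "j < Suc m" for i j
  proof -
    have "(\<Sum>k<Suc m. l i k * u k j) = (\<Sum>k\<in>{0, i}. l i k * u k j)"
      using that by (intro sum.mono_neutral_right) (auto simp: l_def)
    also have "\<dots> = G i j"
      using assms by (cases "i = 0") (auto simp: l_def u_def)
    finally show ?thesis .
  qed
  have "Matrix.mat (Suc m) (Suc m) (\<lambda>(i, j). G i j) = ?L * ?U"
    by (rule eq_matI) (simp_all add: scalar_prod_def prod[symmetric] lessThan_atLeast0 del: sum.op_ivl_Suc sum.lessThan_Suc)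
  then have "Determinant.det (Matrix.mat (Suc m) (Suc m) (\<lambda>(i, j). G i j)) =
      Determinant.det ?L * Determinant.det ?U"
    by (simp add: det_mult[of _ "Suc m"])
  also have "Determinant.det ?L = 1"
  proof -
    have "Matrix.mat m m (\<lambda>(i, j). l (Suc i) (Suc j)) = 1\<^sub>m m"
      by (rule eq_matI) (simp_all add: l_def)
    then show ?thesis
      by (subst det_mat_first_row) (simp_all add: l_def)
  qed
  also have "Determinant.det ?U = G 0 0 * Determinant.det (Matrix.mat m m
      (\<lambda>(i, j). G (Suc i) (Suc j) - G (Suc i) 0 * G 0 (Suc j) / G 0 0))"
    by (subst det_mat_first_column) (simp_all add: u_def)
  finally show ?thesis by simp
qed

lemma det_mat_2:
  fixes G :: "nat \<Rightarrow> nat \<Rightarrow> 'a::comm_ring_1"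
  shows "Determinant.det (Matrix.mat 2 2 (\<lambda>(i, j). G i j)) = G 0 0 * G 1 1 - G 0 1 * G 1 0"
  by (subst laplace_expansion_row[of _ 2 0])
    (simp_all add: numeral_2_eq_2 cofactor_def mat_delete_def det_single)

lemma quadratic_form_Suc:
  fixes M :: "nat \<Rightarrow> nat \<Rightarrow> real"
  assumes "\<And>i j. M i j = M j i"
  shows "(\<Sum>i<Suc n. \<Sum>j<Suc n. a i * a j * M i j) =
    (a 0)\<^sup>2 * M 0 0 + 2 * a 0 * (\<Sum>j<n. a (Suc j) * M 0 (Suc j)) +
    (\<Sum>i<n. \<Sum>j<n. a (Suc i) * a (Suc j) * M (Suc i) (Suc j))"
  unfolding sum.lessThan_Suc_shift
  using assms[of "Suc _" 0]
  by (simp add: sum.distrib sum_distrib_left power2_eq_square algebra_simps)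

text \<open>Induction by completing the square at the pivot \<open>M 0 0\<close>. All principal
  minors are assumed, not only the leading ones, because the pivot may vanish.\<close>

lemma nonneg_quadratic_form_of_principal_minors:
  fixes M :: "nat \<Rightarrow> nat \<Rightarrow> real"
  assumes "\<And>i j. M i j = M j i"
    and "\<And>m r. strict_mono_on {..<m} r \<Longrightarrow>
      0 \<le> Determinant.det (Matrix.mat m m (\<lambda>(i, j). M (r i) (r j)))"
  shows "0 \<le> (\<Sum>i<n. \<Sum>j<n. a i * a j * M i j)"
  using assms
proof (induction n arbitrary: M a)
  case 0
  then show ?case by simp
next
  case (Suc n)
  note sym = Suc.prems(1) and minors = Suc.prems(2)
  have M00: "0 \<le> M 0 0"
    using minors[of 1 "\<lambda>i. i"] by (simp add: det_single strict_mono_onI)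
  show ?case
  proof (cases "M 0 0 = 0")
    case True
    \<comment> \<open>With a vanishing pivot, the principal minor on the indices 0 and
      \<open>Suc j\<close> is minus a square, so the whole first row is zero.\<close>
    have row: "M 0 (Suc j) = 0" for j
    proof -
      define r where "r i = (if i = 0 then 0 else Suc j)" for i :: nat
      have "strict_mono_on {..<2} r"
        by (auto simp: strict_mono_on_def r_def)
      from minors[OF this] have "0 \<le> - (M 0 (Suc j) * M (Suc j) 0)"
        by (subst (asm) det_mat_2) (simp_all add: r_def True)
      then show ?thesis
        using sym[of 0 "Suc j"] by (auto simp: mult_le_0_iff)
    qed
    have "0 \<le> (\<Sum>i<n. \<Sum>j<n. a (Suc i) * a (Suc j) * M (Suc i) (Suc j))"
    proof (rule Suc.IH)
      fix m r assume "strict_mono_on {..<m} (r :: nat \<Rightarrow> nat)"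
      then show "0 \<le> Determinant.det (Matrix.mat m m (\<lambda>(i, j). M (Suc (r i)) (Suc (r j))))"
        by (intro minors) (auto simp: strict_mono_on_def)
    qed (rule sym)
    then show ?thesis
      by (simp only: quadratic_form_Suc[OF sym] row True) simp
  next
    case False
    define S where "S i j = M (Suc i) (Suc j) - M (Suc i) 0 * M 0 (Suc j) / M 0 0" for i j
    have "0 \<le> (\<Sum>i<n. \<Sum>j<n. a (Suc i) * a (Suc j) * S i j)"
    proof (rule Suc.IH)
      show "S i j = S j i" for i j
        unfolding S_def using sym by (metis mult.commute)
      fix m r assume r: "strict_mono_on {..<m} (r :: nat \<Rightarrow> nat)"
      \<comment> \<open>A principal minor of the Schur complement is a principal minor of
        \<open>M\<close> containing index 0, divided by the pivot.\<close>
      define r' where "r' i = (case i of 0 \<Rightarrow> 0 | Suc i \<Rightarrow> Suc (r i))" for i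
      have "strict_mono_on {..<Suc m} r'"
        using r by (auto simp: strict_mono_on_def r'_def split: nat.split)
      from minors[OF this] have "0 \<le> M 0 0 * Determinant.det (Matrix.mat m m (\<lambda>(i, j). S (r i) (r j)))"
        using False by (subst (asm) det_mat_Schur_complement) (simp_all add: r'_def S_def)
      then show "0 \<le> Determinant.det (Matrix.mat m m (\<lambda>(i, j). S (r i) (r j)))"
        using False M00 by (simp add: zero_le_mult_iff)
    qed
    also have "(\<Sum>i<n. \<Sum>j<n. a (Suc i) * a (Suc j) * S i j) =
        (\<Sum>i<n. \<Sum>j<n. a (Suc i) * a (Suc j) * M (Suc i) (Suc j)) -
        (\<Sum>j<n. a (Suc j) * M 0 (Suc j))\<^sup>2 / M 0 0"
      unfolding S_def power2_eq_square sum_product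
      using sym[of "Suc _" 0]
      by (simp add: sum_subtractf[symmetric] sum_divide_distrib algebra_simps)
    finally have "0 \<le> (M 0 0 * a 0 + (\<Sum>j<n. a (Suc j) * M 0 (Suc j)))\<^sup>2 / M 0 0 +
        ((\<Sum>i<n. \<Sum>j<n. a (Suc i) * a (Suc j) * M (Suc i) (Suc j)) -
        (\<Sum>j<n. a (Suc j) * M 0 (Suc j))\<^sup>2 / M 0 0)"
      using M00 by simp
    also have "\<dots> = (\<Sum>i<Suc n. \<Sum>j<Suc n. a i * a j * M i j)"
      unfolding quadratic_form_Suc[OF sym] using False
      by (simp add: field_simps power2_eq_square)
    finally show ?thesis .
  qed
qed

text \<open>The second form also comes from the same Hankel matrix: shifting the rows by one but not
  the columns turns a principal minor of the shifted matrix into an off-diagonal minor of the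
  original.\<close>

lemma nonneg_quadratic_form_hankel:
  fixes z :: "nat \<Rightarrow> real"
  assumes "hankel_totally_positive (\<lambda>x. 0 \<le> x) z"
  shows "0 \<le> (\<Sum>i<n. \<Sum>j<n. a i * a j * z (i + j))"
    and "0 \<le> (\<Sum>i<n. \<Sum>j<n. a i * a j * z (Suc (i + j)))"
proof -
  note minor = assms[unfolded hankel_totally_positive_def totally_positive_def, rule_format]
  show "0 \<le> (\<Sum>i<n. \<Sum>j<n. a i * a j * z (i + j))"
    by (rule nonneg_quadratic_form_of_principal_minors) (auto simp: add.commute intro: minor)
  show "0 \<le> (\<Sum>i<n. \<Sum>j<n. a i * a j * z (Suc (i + j)))"
  proof (rule nonneg_quadratic_form_of_principal_minors)
    fix m r assume "strict_mono_on {..<m} (r :: nat \<Rightarrow> nat)"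
    then have "strict_mono_on {..<m} (\<lambda>i. Suc (r i))"
      by (auto simp: strict_mono_on_def)
    then show "0 \<le> Determinant.det (Matrix.mat m m (\<lambda>(i, j). z (Suc (r i + r j))))"
      using minor[of m "\<lambda>i. Suc (r i)" r] \<open>strict_mono_on {..<m} r\<close> by simp
  qed (simp add: add.commute)
qed

section \<open>Nonnegative polynomials as sums of squares\<close>

lemma sum_of_squares_mult:
  fixes a b c d :: "'a::comm_ring_1"
  shows "(a * a + b * b) * (c * c + d * d) = (a * c - b * d) * (a * c - b * d) + (a * d + b * c) * (a * d + b * c)"
  by (simp add: algebra_simps)

lemma poly_quadratic: "poly [:c\<^sup>2 + d\<^sup>2, - 2 * c, 1:] x = (x - c)\<^sup>2 + (d::real)\<^sup>2"
  by (simp add: power2_eq_square algebra_simps)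

text \<open>Induction on the degree: a complex root w = c + i d gives the real factor h(x) = (x -
  c)^2 + d^2, itself a sum of two squares, and sums of two squares are closed under products. A real
  root must be double, so h works for d = 0 as well.\<close>

lemma nonneg_poly_eq_sum_of_squares:
  fixes p :: "real poly"
  assumes "\<And>x. 0 \<le> poly p x"
  shows "\<exists>a b. p = a * a + b * b"
  using assms
proof (induction "degree p" arbitrary: p rule: less_induct)
  case less
  show ?case
  proof (cases "degree p = 0")
    case True
    then obtain c where "p = [:c:]" by (rule degree_eq_zeroE)
    moreover from this have "0 \<le> c" using less.prems[of 0] by simp
    ultimately have "p = [:sqrt c:] * [:sqrt c:] + 0 * 0" by simp
    then show ?thesis by blast
  next
    case False
    interpret map_poly_of_real: map_poly_comm_ring_hom complex_of_real
      by unfold_locales simp_all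
    have "degree (map_poly complex_of_real p) = degree p"
      by (rule degree_map_poly) simp
    then have "\<not> constant (poly (map_poly complex_of_real p))"
      using False by (simp add: constant_degree)
    then obtain w where w: "poly (map_poly complex_of_real p) w = 0"
      using fundamental_theorem_of_algebra by blast
    define c d where "c = Re w" "d = Im w"
    define h where "h = [:c\<^sup>2 + d\<^sup>2, - 2 * c, 1:]"
    have h: "poly h x = (x - c)\<^sup>2 + d\<^sup>2" for x
      unfolding h_def by (rule poly_quadratic)
    have degh: "degree h = 2" by (simp add: h_def)
    define q r where "q = p div h" and "r = p mod h"
    have p: "p = h * q + r" by (simp add: q_def r_def)
    have "degree r < 2"
      using degree_mod_less[of h p] degh by (cases "h = 0") (auto simp: r_def)
    obtain r0 s where rs: "r = pCons r0 s" by (cases r)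
    then have "degree s = 0"
      using \<open>degree r < 2\<close> by (cases "s = 0") auto
    then obtain r1 where "s = [:r1:]" by (rule degree_eq_zeroE)
    then have r: "r = [:r0, r1:]" using rs by simp
    have "poly (map_poly complex_of_real h) w = 0"
      by (simp add: h_def map_poly_pCons c_d_def complex_eq_iff power2_eq_square algebra_simps)
    then have root: "complex_of_real r0 + w * complex_of_real r1 = 0"
      using w unfolding p r by (simp add: map_poly_of_real.hom_add map_poly_of_real.hom_mult of_real_hom.map_poly_pCons_hom)
    have r_root: "r0 + c * r1 = 0" "d * r1 = 0"
      using arg_cong[OF root, of Re] arg_cong[OF root, of Im] by (simp_all add: c_d_def)
    have polyp: "poly p x = ((x - c)\<^sup>2 + d\<^sup>2) * poly q x + r1 * (x - c)" for x
      using r_root(1) unfolding p r by (simp add: h algebra_simps)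
    \<comment> \<open>For d \<noteq> 0 the imaginary part of the root equation decides. For d = 0 a
      nonzero \<open>r1\<close> would make \<open>p\<close> change sign at the real root
      \<open>c\<close>; the one-sided limits exclude this.\<close>
    have r1: "r1 = 0"
    proof (cases "d = 0")
      case True
      have lim: "((\<lambda>x. (x - c) * poly q x + r1) \<longlongrightarrow> (c - c) * poly q c + r1) (at c within S)" for S
        by (intro tendsto_intros)
      have fac: "poly p x = (x - c) * ((x - c) * poly q x + r1)" for x
        using True by (simp add: polyp power2_eq_square algebra_simps)
      have "0 \<le> (c - c) * poly q c + r1"
      proof (rule tendsto_lowerbound[OF lim[of "{c<..}"]])
        have "0 \<le> (x - c) * poly q x + r1" if "c < x" for x
          using less.prems[of x] that unfolding fac by (simp add: zero_le_mult_iff)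
        then show "\<forall>\<^sub>F x in at_right c. 0 \<le> (x - c) * poly q x + r1"
          unfolding eventually_at_filter by (intro always_eventually) auto
      qed simp
      moreover have "(c - c) * poly q c + r1 \<le> 0"
      proof (rule tendsto_upperbound[OF lim[of "{..<c}"]])
        have "(x - c) * poly q x + r1 \<le> 0" if "x < c" for x
          using less.prems[of x] that unfolding fac by (simp add: zero_le_mult_iff)
        then show "\<forall>\<^sub>F x in at_left c. (x - c) * poly q x + r1 \<le> 0"
          unfolding eventually_at_filter by (intro always_eventually) auto
      qed simp
      ultimately show ?thesis by simp
    qed (use r_root(2) in simp)
    have pq: "p = h * q" using r r1 r_root p by simp
    \<comment> \<open>When d = 0 the factor \<open>h\<close> vanishes at \<open>c\<close>, so
      nonnegativity of \<open>q\<close> is first shown away from \<open>c\<close> and then extended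
      by continuity.\<close>
    have q_off: "0 \<le> poly q x" if "x \<noteq> c" for x
    proof -
      have "0 < (x - c)\<^sup>2 + d\<^sup>2"
        using that by (simp add: add_pos_nonneg)
      then show ?thesis
        using less.prems[of x] polyp[of x] r1 by (simp add: zero_le_mult_iff)
    qed
    have "0 \<le> poly q x" for x
    proof (cases "x = c")
      case True
      show ?thesis unfolding True
      proof (rule tendsto_lowerbound)
        show "(poly q \<longlongrightarrow> poly q c) (at c)" by (intro tendsto_intros tendsto_poly) 
        show "\<forall>\<^sub>F x in at c. 0 \<le> poly q x"
          unfolding eventually_at_filter using q_off by (intro always_eventually) auto
      qed simp
    qed (rule q_off)
    moreover have "degree q < degree p"
    proof -
      have "q \<noteq> 0" using pq False by auto
      then have "degree p = 2 + degree q"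
        unfolding pq using degh by (subst degree_mult_eq) auto
      then show ?thesis by simp
    qed
    ultimately obtain a b where "q = a * a + b * b"
      using less.hyps by blast
    moreover have "h = [:- c, 1:] * [:- c, 1:] + [:d:] * [:d:]"
      by (simp add: h_def power2_eq_square)
    ultimately show ?thesis
      unfolding pq by (metis sum_of_squares_mult)
  qed
qed

lemma poly_even_odd_parts:
  fixes a :: "real poly"
  shows "\<exists>e u. \<forall>x. poly a x = poly e (x\<^sup>2) + x * poly u (x\<^sup>2)"
proof (induction a)
  case 0
  show ?case by (intro exI[of _ 0]) simp
next
  case (pCons c a)
  then obtain e u where "poly a x = poly e (x\<^sup>2) + x * poly u (x\<^sup>2)" for x by blast
  then have "poly (pCons c a) x = poly (pCons c u) (x\<^sup>2) + x * poly e (x\<^sup>2)" for x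
    by (simp add: power2_eq_square algebra_simps)
  then show ?case by blast
qed

text \<open>The substitution of x^2 makes the polynomial nonnegative on the whole line, hence A^2 +
  B^2. Splitting A and B into even and odd parts yields the four polynomials.\<close>

lemma nonneg_poly_on_halfline_eq_sum_of_squares:
  fixes p :: "real poly"
  assumes "\<And>x. 0 \<le> x \<Longrightarrow> 0 \<le> poly p x"
  shows "\<exists>a b c d. p = (a * a + b * b) + pCons 0 (c * c + d * d)"
proof -
  have "0 \<le> poly (p \<circ>\<^sub>p [:0, 0, 1:]) x" for x
    using assms[of "x * x"] by (simp add: poly_pcompose)
  then obtain A B where AB: "p \<circ>\<^sub>p [:0, 0, 1:] = A * A + B * B"
    using nonneg_poly_eq_sum_of_squares by blast
  have val: "poly p (x\<^sup>2) = poly A x * poly A x + poly B x * poly B x" for x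
    using arg_cong[OF AB, of "\<lambda>P. poly P x"] by (simp add: poly_pcompose power2_eq_square)
  obtain a c where ac: "\<And>x. poly A x = poly a (x\<^sup>2) + x * poly c (x\<^sup>2)"
    using poly_even_odd_parts by blast
  obtain b d where bd: "\<And>x. poly B x = poly b (x\<^sup>2) + x * poly d (x\<^sup>2)"
    using poly_even_odd_parts by blast
  let ?q = "(a * a + b * b) + pCons 0 (c * c + d * d)"
  \<comment> \<open>Averaging the values at \<open>x\<close> and \<open>- x\<close> cancels the
    cross terms of even and odd parts.\<close>
  have sq: "poly p (x\<^sup>2) = poly ?q (x\<^sup>2)" for x
    using val[of x] val[of "- x"] unfolding ac bd
    by (simp add: power2_eq_square algebra_simps)
  have "poly (p - ?q) y = 0" if "y \<in> {0..}" for y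
    using sq[of "sqrt y"] that by simp
  then have "{0..} \<subseteq> {y. poly (p - ?q) y = 0}" by blast
  moreover have "infinite {0::real..}"
    by (rule infinite_Ici)
  ultimately have "p - ?q = 0"
    using poly_roots_finite finite_subset by blast
  then show ?thesis by auto
qed

section \<open>Minimal sublinear functionals\<close>

definition sublinear_on :: "('a \<Rightarrow> real) set \<Rightarrow> (('a \<Rightarrow> real) \<Rightarrow> real) \<Rightarrow> bool" where
  "sublinear_on V q \<longleftrightarrow>
    (\<forall>f\<in>V. \<forall>g\<in>V. q (\<lambda>x. f x + g x) \<le> q f + q g) \<and>
    (\<forall>f\<in>V. \<forall>c>0. q (\<lambda>x. c * f x) \<le> c * q f)"

locale function_space =
  fixes V :: "('a \<Rightarrow> real) set"
  assumes zero_mem: "(\<lambda>x. 0) \<in> V"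
    and add_mem: "f \<in> V \<Longrightarrow> g \<in> V \<Longrightarrow> (\<lambda>x. f x + g x) \<in> V"
    and scale_mem: "f \<in> V \<Longrightarrow> (\<lambda>x. c * f x) \<in> V"
begin

lemma uminus_mem: "f \<in> V \<Longrightarrow> (\<lambda>x. - f x) \<in> V"
  using scale_mem[of f "- 1"] by simp

lemma sublinear_zero:
  assumes "sublinear_on V q"
  shows "q (\<lambda>x. 0) = 0"
proof -
  have le: "q (\<lambda>x. 0) \<le> c * q (\<lambda>x. 0)" if "c > 0" for c
    using assms zero_mem that unfolding sublinear_on_def by force
  show ?thesis
    using le[of 2] le[of "1 / 2"] by simp
qed

lemma sublinear_scale:
  assumes "sublinear_on V q" "f \<in> V" "0 \<le> c"
  shows "q (\<lambda>x. c * f x) = c * q f"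
proof (cases "c = 0")
  case True
  then show ?thesis using sublinear_zero[OF assms(1)] by simp
next
  case False
  then have c: "c > 0" using assms(3) by simp
  have "q (\<lambda>x. (1 / c) * (c * f x)) \<le> (1 / c) * q (\<lambda>x. c * f x)"
    using assms(1) scale_mem[OF assms(2)] c unfolding sublinear_on_def
    by (meson zero_less_divide_1_iff)
  then have "c * q f \<le> q (\<lambda>x. c * f x)"
    using c by (simp add: field_simps)
  moreover have "q (\<lambda>x. c * f x) \<le> c * q f"
    using assms(1,2) c unfolding sublinear_on_def by blast
  ultimately show ?thesis by simp
qed

lemma sublinear_add:
  "sublinear_on V q \<Longrightarrow> f \<in> V \<Longrightarrow> g \<in> V \<Longrightarrow> q (\<lambda>x. f x + g x) \<le> q f + q g"
  unfolding sublinear_on_def by blast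

lemma sublinear_neg:
  assumes "sublinear_on V q" "f \<in> V"
  shows "- q (\<lambda>x. - f x) \<le> q f"
  using sublinear_add[OF assms uminus_mem[OF assms(2)]] sublinear_zero[OF assms(1)] by simp

text \<open>
  A sublinear functional \<open>q\<close> that is not additive is not minimal: lower it in the direction \<open>h\<close>.
\<close>

definition lowered :: "(('a \<Rightarrow> real) \<Rightarrow> real) \<Rightarrow> ('a \<Rightarrow> real) \<Rightarrow> ('a \<Rightarrow> real) \<Rightarrow> real" where
  "lowered q h f = (if f \<in> V then INF t\<in>{0..}. q (\<lambda>x. f x + t * h x) - t * q h else 0)"

context
  fixes q h assumes q: "sublinear_on V q" and h: "h \<in> V"
begin

lemma lowered_bdd_below:
  assumes "f \<in> V"
  shows "bdd_below ((\<lambda>t. q (\<lambda>x. f x + t * h x) - t * q h) ` {0..})"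
proof (rule bdd_belowI2)
  fix t :: real assume "t \<in> {0..}"
  then have "t * q h = q (\<lambda>x. t * h x)"
    using sublinear_scale[OF q h] by simp
  \<comment> \<open>Writing t h as the sum of f + t h and - f gives a lower bound independent of
    t.\<close>
  also have "\<dots> \<le> q (\<lambda>x. f x + t * h x) + q (\<lambda>x. - f x)"
    using sublinear_add[OF q add_mem[OF assms scale_mem[OF h]] uminus_mem[OF assms], of t] by simp
  finally show "- q (\<lambda>x. - f x) \<le> q (\<lambda>x. f x + t * h x) - t * q h" by simp
qed

lemma lowered_le:
  "f \<in> V \<Longrightarrow> 0 \<le> t \<Longrightarrow> lowered q h f \<le> q (\<lambda>x. f x + t * h x) - t * q h"
  unfolding lowered_def using lowered_bdd_below by (auto intro!: cINF_lower)

lemma lowered_ge: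
  "f \<in> V \<Longrightarrow> (\<And>t. 0 \<le> t \<Longrightarrow> b \<le> q (\<lambda>x. f x + t * h x) - t * q h) \<Longrightarrow> b \<le> lowered q h f"
  unfolding lowered_def by (auto intro!: cINF_greatest)

lemma sublinear_lowered: "sublinear_on V (lowered q h)"
  unfolding sublinear_on_def
proof (intro conjI ballI allI impI)
  fix f g assume f: "f \<in> V" and g: "g \<in> V"
  have "lowered q h (\<lambda>x. f x + g x) - (q (\<lambda>x. g x + s * h x) - s * q h) \<le> lowered q h f"
    if "0 \<le> s" for s
  proof (rule lowered_ge[OF f])
    fix t :: real assume "0 \<le> t"
    have "lowered q h (\<lambda>x. f x + g x) \<le> q (\<lambda>x. f x + g x + (t + s) * h x) - (t + s) * q h"
      using \<open>0 \<le> t\<close> that by (intro lowered_le add_mem f g) simp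
    also have "q (\<lambda>x. f x + g x + (t + s) * h x) = q (\<lambda>x. (f x + t * h x) + (g x + s * h x))"
      by (simp add: algebra_simps)
    also have "\<dots> \<le> q (\<lambda>x. f x + t * h x) + q (\<lambda>x. g x + s * h x)"
      by (intro sublinear_add q add_mem scale_mem f g h)
    finally show "lowered q h (\<lambda>x. f x + g x) - (q (\<lambda>x. g x + s * h x) - s * q h) \<le>
        q (\<lambda>x. f x + t * h x) - t * q h"
      by (simp add: algebra_simps)
  qed
  then have "lowered q h (\<lambda>x. f x + g x) - lowered q h f \<le> lowered q h g"
    by (intro lowered_ge g) (simp add: algebra_simps)
  then show "lowered q h (\<lambda>x. f x + g x) \<le> lowered q h f + lowered q h g" by simp
next
  fix f and c :: real assume f: "f \<in> V" and c: "0 < c"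
  have "lowered q h (\<lambda>x. c * f x) / c \<le> lowered q h f"
  proof (rule lowered_ge[OF f])
    fix t :: real assume t: "0 \<le> t"
    have "lowered q h (\<lambda>x. c * f x) \<le> q (\<lambda>x. c * f x + (c * t) * h x) - (c * t) * q h"
      using t c by (intro lowered_le scale_mem f) simp
    also have "q (\<lambda>x. c * f x + (c * t) * h x) = q (\<lambda>x. c * (f x + t * h x))"
      by (simp add: algebra_simps)
    also have "\<dots> = c * q (\<lambda>x. f x + t * h x)"
      using c by (intro sublinear_scale q add_mem scale_mem f h) simp
    finally show "lowered q h (\<lambda>x. c * f x) / c \<le> q (\<lambda>x. f x + t * h x) - t * q h"
      using c by (simp add: field_simps)
  qed
  then show "lowered q h (\<lambda>x. c * f x) \<le> c * lowered q h f"
    using c by (simp add: field_simps)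
qed

end

text \<open>Zorn's lemma needs the pointwise infimum of a chain. It is finite because a sublinear
  \<open>q \<le> p\<close> satisfies \<open>q f \<ge> - q (- f) \<ge> - p (- f)\<close>.\<close>

lemma chain_lower_bound:
  assumes "C \<noteq> {}" "\<forall>q\<in>C. sublinear_on V q" "\<forall>q\<in>C. \<forall>f\<in>V. q f \<le> p f"
    and "\<forall>q\<in>C. \<forall>q'\<in>C. (\<forall>f. q f \<le> q' f) \<or> (\<forall>f. q' f \<le> q f)"
  defines "u \<equiv> \<lambda>f. if f \<in> V then INF q\<in>C. q f else 0"
  shows "sublinear_on V u" and "\<And>q f. q \<in> C \<Longrightarrow> f \<in> V \<Longrightarrow> u f \<le> q f"
proof -
  have C: "C \<noteq> {}" "\<And>q. q \<in> C \<Longrightarrow> sublinear_on V q"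
    and p: "\<And>q f. q \<in> C \<Longrightarrow> f \<in> V \<Longrightarrow> q f \<le> p f"
    and chain: "\<And>q q'. q \<in> C \<Longrightarrow> q' \<in> C \<Longrightarrow> (\<forall>f. q f \<le> q' f) \<or> (\<forall>f. q' f \<le> q f)"
    using assms(1-4) by blast+
  have bdd: "bdd_below ((\<lambda>q. q f) ` C)" if "f \<in> V" for f
  proof (rule bdd_belowI2)
    fix q assume "q \<in> C"
    then show "- p (\<lambda>x. - f x) \<le> q f"
      using sublinear_neg[OF C(2) that] p[OF _ uminus_mem[OF that]] by force
  qed
  show lower: "u f \<le> q f" if "q \<in> C" "f \<in> V" for q f
    using that bdd by (auto simp: u_def intro: cINF_lower)
  have greatest: "b \<le> u f" if "f \<in> V" "\<And>q. q \<in> C \<Longrightarrow> b \<le> q f" for b f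
    using that C(1) by (auto simp: u_def intro: cINF_greatest)
  show "sublinear_on V u"
    unfolding sublinear_on_def
  proof (intro conjI ballI allI impI)
    fix f g assume f: "f \<in> V" and g: "g \<in> V"
    \<comment> \<open>Comparability in the chain enters here: the smaller of \<open>q\<close> and
      \<open>q'\<close> serves for both summands, and it is subadditive.\<close>
    have "u (\<lambda>x. f x + g x) \<le> q f + q' g" if qq': "q \<in> C" "q' \<in> C" for q q'
    proof -
      obtain r where r: "r \<in> C" "r f \<le> q f" "r g \<le> q' g"
        using chain[OF qq'] qq' by blast
      show ?thesis
        using lower[OF r(1) add_mem[OF f g]] sublinear_add[OF C(2)[OF r(1)] f g] r(2,3) by linarith
    qed
    then have "u (\<lambda>x. f x + g x) - q' g \<le> u f" if "q' \<in> C" for q'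
      using that by (intro greatest f) (simp add: algebra_simps)
    then have "u (\<lambda>x. f x + g x) - u f \<le> u g"
      by (intro greatest g) (simp add: algebra_simps)
    then show "u (\<lambda>x. f x + g x) \<le> u f + u g" by simp
  next
    fix f and c :: real assume f: "f \<in> V" and c: "0 < c"
    have "u (\<lambda>x. c * f x) / c \<le> u f"
    proof (rule greatest[OF f])
      fix q assume "q \<in> C"
      then show "u (\<lambda>x. c * f x) / c \<le> q f"
        using lower[OF _ scale_mem[OF f], of q c] sublinear_scale[OF C(2) f, of q c] c
        by (simp add: field_simps)
    qed
    then show "u (\<lambda>x. c * f x) \<le> c * u f"
      using c by (simp add: field_simps)
  qed
qed

theorem Hahn_Banach_sublinear:
  assumes p: "sublinear_on V p"
  obtains L where "\<And>f g. f \<in> V \<Longrightarrow> g \<in> V \<Longrightarrow> L (\<lambda>x. f x + g x) = L f + L g"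
    and "\<And>f c. f \<in> V \<Longrightarrow> L (\<lambda>x. c * f x) = c * L f"
    and "\<And>f. f \<in> V \<Longrightarrow> L f \<le> p f"
proof -
  \<comment> \<open>Values off \<open>V\<close> are pinned to 0, so comparison on \<open>V\<close>
    settles comparison everywhere. The order \<open>below\<close> is reversed because Zorn's lemma
    supplies a maximal element and a minimal functional is wanted.\<close>
  define S where "S = {q. sublinear_on V q \<and> (\<forall>f\<in>V. q f \<le> p f) \<and> (\<forall>f. f \<notin> V \<longrightarrow> q f = 0)}"
  define below where "below q q' \<longleftrightarrow> (\<forall>f. q' f \<le> q f)" for q q' :: "('a \<Rightarrow> real) \<Rightarrow> real"
  define p0 where "p0 f = (if f \<in> V then p f else 0)" for f
  have "p0 \<in> S"
    using p by (auto simp: S_def p0_def sublinear_on_def add_mem scale_mem)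
  have "\<exists>m\<in>S. \<forall>a\<in>S. below m a \<longrightarrow> a = m"
  proof (rule predicate_Zorn)
    show "partial_order_on S (relation_of below S)"
      unfolding partial_order_on_def preorder_on_def refl_on_def trans_def antisym_def
        relation_of_def below_def
      by (auto simp: fun_eq_iff intro: order.trans order.antisym)
    fix C assume C: "C \<in> Chains (relation_of below S)"
    then have CS: "C \<subseteq> S" by (auto simp: Chains_def relation_of_def)
    show "\<exists>u\<in>S. \<forall>a\<in>C. below a u"
    proof (cases "C = {}")
      case True
      then show ?thesis using \<open>p0 \<in> S\<close> by blast
    next
      case False
      let ?u = "\<lambda>f. if f \<in> V then INF q\<in>C. q f else 0"
      have chain: "(\<forall>f. q f \<le> q' f) \<or> (\<forall>f. q' f \<le> q f)" if "q \<in> C" "q' \<in> C" for q q'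
        using C that by (auto simp: Chains_def relation_of_def below_def)
      have C1: "sublinear_on V q" "f \<in> V \<Longrightarrow> q f \<le> p f" "f \<notin> V \<Longrightarrow> q f = 0"
        if "q \<in> C" for q f
        using CS that by (auto simp: S_def)
      have u: "sublinear_on V ?u" "\<And>q f. q \<in> C \<Longrightarrow> f \<in> V \<Longrightarrow> ?u f \<le> q f"
        by (rule chain_lower_bound[of C p]; use False C1 chain in blast)+
      have below: "below a ?u" if "a \<in> C" for a
        using u(2)[OF that] C1(3)[OF that] by (auto simp: below_def)
      obtain a where "a \<in> C" using False by blast
      then have "?u f \<le> p f" if "f \<in> V" for f
        using below[OF \<open>a \<in> C\<close>] C1(2)[OF \<open>a \<in> C\<close> that] unfolding below_def by (meson order.trans)
      then have "?u \<in> S"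
        using u(1) by (auto simp: S_def)
      then show ?thesis using below by blast
    qed
  qed
  then obtain L where "L \<in> S" and min: "\<And>q. q \<in> S \<Longrightarrow> below L q \<Longrightarrow> q = L" by blast
  then have L: "sublinear_on V L" "\<And>f. f \<in> V \<Longrightarrow> L f \<le> p f" "\<And>f. f \<notin> V \<Longrightarrow> L f = 0"
    by (auto simp: S_def)
  have add: "L (\<lambda>x. f x + h x) = L f + L h" if f: "f \<in> V" and h: "h \<in> V" for f h
  proof -
    have le: "lowered L h g \<le> L g" if "g \<in> V" for g
      using lowered_le[OF L(1) h that, of 0] by simp
    have "lowered L h \<in> S"
      using sublinear_lowered[OF L(1) h] le L(2) by (force simp: S_def lowered_def)
    moreover have "below L (lowered L h)"
      unfolding below_def using le L(3) by (metis lowered_def order.refl)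
    ultimately have "lowered L h = L" by (rule min)
    \<comment> \<open>The value t = 1 in the infimum gives the inequality opposite to
      subadditivity.\<close>
    then have "L f \<le> L (\<lambda>x. f x + h x) - L h"
      using lowered_le[OF L(1) h f, of 1] by simp
    then show ?thesis
      using sublinear_add[OF L(1) f h] by simp
  qed
  have neg: "L (\<lambda>x. - f x) = - L f" if "f \<in> V" for f
    using add[OF that uminus_mem[OF that]] sublinear_zero[OF L(1)] by simp
  have scale: "L (\<lambda>x. c * f x) = c * L f" if "f \<in> V" for f c
  proof (cases "0 \<le> c")
    case True
    then show ?thesis using sublinear_scale[OF L(1) that] by simp
  next
    case False
    then have "L (\<lambda>x. (- c) * f x) = - c * L f"
      using sublinear_scale[OF L(1) that, of "- c"] by simp
    then show ?thesis
      using neg[OF scale_mem[OF that], of c] by simp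
  qed
  show ?thesis
    by (rule that[OF add scale L(2)])
qed

end

section \<open>Stieltjes' moment theorem\<close>

text \<open>The linear functional x^n \<mapsto> z n applied to x^k p. The shift \<open>k\<close>
  absorbs the factor x that \<open>pCons\<close> introduces, which makes induction on
  \<open>p\<close> possible.\<close>

definition moment_functional :: "(nat \<Rightarrow> real) \<Rightarrow> nat \<Rightarrow> real poly \<Rightarrow> real" where
  "moment_functional z k p = (\<Sum>i\<le>degree p. poly.coeff p i * z (k + i))"

lemma moment_functional_eq:
  "degree p < N \<Longrightarrow> moment_functional z k p = (\<Sum>i<N. poly.coeff p i * z (k + i))"
  unfolding moment_functional_def
  by (rule sum.mono_neutral_left) (auto simp: coeff_eq_0)

lemma moment_functional_add:
  "moment_functional z k (p + q) = moment_functional z k p + moment_functional z k q"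
proof -
  define N where "N = Suc (max (degree p) (degree q))"
  have "degree p < N" "degree q < N" "degree (p + q) < N"
    using degree_add_le_max[of p q] by (auto simp: N_def)
  then show ?thesis
    by (simp only: moment_functional_eq) (simp add: sum.distrib algebra_simps)
qed

lemma moment_functional_smult: "moment_functional z k (Polynomial.smult c p) = c * moment_functional z k p"
proof -
  have "degree p < Suc (degree p)" "degree (Polynomial.smult c p) < Suc (degree p)"
    using degree_smult_le[of c p] by auto
  then show ?thesis
    by (simp only: moment_functional_eq) (simp add: sum_distrib_left algebra_simps)
qed

lemma moment_functional_pCons:
  "moment_functional z k (pCons c p) = c * z k + moment_functional z (Suc k) p"
proof -
  have "degree p < Suc (degree p)" "degree (pCons c p) < Suc (Suc (degree p))"
    using degree_pCons_le[of c p] by auto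
  then show ?thesis
    by (simp only: moment_functional_eq sum.lessThan_Suc_shift) (simp add: coeff_pCons)
qed

lemma moment_functional_0: "moment_functional z k 0 = 0"
  by (simp add: moment_functional_def)

lemma moment_functional_mult:
  assumes "degree p < N"
  shows "moment_functional z k (p * q) = (\<Sum>i<N. poly.coeff p i * moment_functional z (k + i) q)"
  using assms
proof (induction p arbitrary: k N)
  case 0
  then show ?case by (simp add: moment_functional_0)
next
  case (pCons c p)
  obtain N' where N: "N = Suc N'" using pCons.prems by (cases N) auto
  have sum: "(\<Sum>i<N'. poly.coeff p i * moment_functional z (Suc k + i) q) = moment_functional z (Suc k) (p * q)"
  proof (cases "p = 0")
    case True
    then show ?thesis by (simp add: moment_functional_0)
  next
    case False
    then show ?thesis using pCons.prems N pCons.IH[of N' "Suc k"] by simp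
  qed
  have "moment_functional z k (pCons c p * q) = c * moment_functional z k q + moment_functional z (Suc k) (p * q)"
    by (simp add: moment_functional_add moment_functional_smult moment_functional_pCons)
  also have "\<dots> = (\<Sum>i<N. poly.coeff (pCons c p) i * moment_functional z (k + i) q)"
    unfolding N sum.lessThan_Suc_shift sum[symmetric] by (simp add: coeff_pCons)
  finally show ?case .
qed

lemma moment_functional_square:
  "moment_functional z k (a * a) =
    (\<Sum>i<Suc (degree a). \<Sum>j<Suc (degree a). poly.coeff a i * poly.coeff a j * z (k + (i + j)))"
proof -
  have "moment_functional z k (a * a) =
      (\<Sum>i<Suc (degree a). poly.coeff a i * moment_functional z (k + i) a)"
    by (rule moment_functional_mult) simp
  also have "\<dots> = (\<Sum>i<Suc (degree a). \<Sum>j<Suc (degree a).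
      poly.coeff a i * poly.coeff a j * z (k + (i + j)))"
    by (simp only: moment_functional_eq[of a "Suc (degree a)"] lessI sum_distrib_left mult.assoc add.assoc)
  finally show ?thesis .
qed

text \<open>Large enough to contain the polynomials, the indicators from which a distribution
  function is read off and the truncated powers; small enough that each member has a polynomial
  majorant on the half-line.\<close>

definition poly_growth :: "(real \<Rightarrow> real) set" where
  "poly_growth = {g. \<exists>p. \<forall>x\<ge>0. \<bar>g x\<bar> \<le> poly p x}"

lemma poly_growthI: "(\<And>x. 0 \<le> x \<Longrightarrow> \<bar>g x\<bar> \<le> poly p x) \<Longrightarrow> g \<in> poly_growth"
  unfolding poly_growth_def by blast

lemma poly_growth_bounded:
  assumes "\<And>x. 0 \<le> x \<Longrightarrow> \<bar>g x\<bar> \<le> c"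
  shows "g \<in> poly_growth"
  by (rule poly_growthI[of _ "[:c:]"]) (simp add: assms)

lemma poly_growth_poly: "poly p \<in> poly_growth"
proof (rule poly_growthI[of _ "p * p + 1"])
  fix x :: real
  have "0 \<le> (\<bar>poly p x\<bar> - 1)\<^sup>2" by simp
  then show "\<bar>poly p x\<bar> \<le> poly (p * p + 1) x"
    using abs_mult_self_eq[of "poly p x"] by (simp add: power2_eq_square algebra_simps) 
qed

lemma poly_growth_power: "(\<lambda>x. x ^ n) \<in> poly_growth"
proof -
  have "poly (Polynomial.monom 1 n) = (\<lambda>x::real. x ^ n)"
    by (simp add: fun_eq_iff poly_monom)
  then show ?thesis using poly_growth_poly by metis
qed

interpretation poly_growth: function_space poly_growth
proof
  show "(\<lambda>x. 0) \<in> poly_growth"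
    by (rule poly_growth_bounded[of _ 0]) simp
next
  fix f g assume "f \<in> poly_growth" "g \<in> poly_growth"
  then obtain p q where "\<And>x. 0 \<le> x \<Longrightarrow> \<bar>f x\<bar> \<le> poly p x" "\<And>x. 0 \<le> x \<Longrightarrow> \<bar>g x\<bar> \<le> poly q x"
    by (auto simp: poly_growth_def)
  then show "(\<lambda>x. f x + g x) \<in> poly_growth"
    by (intro poly_growthI[of _ "p + q"]) (simp, smt (verit))
next
  fix f and c :: real assume "f \<in> poly_growth"
  then obtain p where "\<And>x. 0 \<le> x \<Longrightarrow> \<bar>f x\<bar> \<le> poly p x"
    by (auto simp: poly_growth_def)
  then show "(\<lambda>x. c * f x) \<in> poly_growth"
    by (intro poly_growthI[of _ "Polynomial.smult \<bar>c\<bar> p"]) (simp add: abs_mult mult_left_mono)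
qed

text \<open>Monotonicity is required for functions compared on the half-line only; this later keeps
  the measure off the negative reals.\<close>

locale positive_functional =
  fixes L :: "(real \<Rightarrow> real) \<Rightarrow> real" and z :: "nat \<Rightarrow> real"
  assumes add: "f \<in> poly_growth \<Longrightarrow> g \<in> poly_growth \<Longrightarrow> L (\<lambda>x. f x + g x) = L f + L g"
    and scale: "f \<in> poly_growth \<Longrightarrow> L (\<lambda>x. c * f x) = c * L f"
    and mono: "f \<in> poly_growth \<Longrightarrow> g \<in> poly_growth \<Longrightarrow> (\<And>x. 0 \<le> x \<Longrightarrow> f x \<le> g x) \<Longrightarrow> L f \<le> L g"
    and moment: "L (\<lambda>x. x ^ n) = z n"

context
  fixes z :: "nat \<Rightarrow> real"
  assumes form: "\<And>n a. 0 \<le> (\<Sum>i<n. \<Sum>j<n. a i * a j * z (i + j))"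
    and form_Suc: "\<And>n a. 0 \<le> (\<Sum>i<n. \<Sum>j<n. a i * a j * z (Suc (i + j)))"
begin

lemma moment_functional_nonneg:
  assumes "\<And>x. 0 \<le> x \<Longrightarrow> 0 \<le> poly p x"
  shows "0 \<le> moment_functional z 0 p"
proof -
  obtain a b c d where "p = (a * a + b * b) + pCons 0 (c * c + d * d)"
    using nonneg_poly_on_halfline_eq_sum_of_squares[OF assms] by blast
  then show ?thesis
    using form form_Suc
    by (simp only: moment_functional_add moment_functional_pCons moment_functional_square)
      (simp del: sum.lessThan_Suc)
qed

lemma moment_functional_mono:
  assumes "\<And>x. 0 \<le> x \<Longrightarrow> poly p x \<le> poly q x"
  shows "moment_functional z 0 p \<le> moment_functional z 0 q"
  using moment_functional_nonneg[of "q + Polynomial.smult (- 1) p"] assms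
  unfolding moment_functional_add moment_functional_smult by simp

text \<open>The sublinear bound of the M. Riesz extension theorem. Polynomial minorants, on which
  the moment functional is monotone, keep the infimum finite.\<close>

definition upper_functional :: "(real \<Rightarrow> real) \<Rightarrow> real" where
  "upper_functional g = (INF p\<in>{p. \<forall>x\<ge>0. g x \<le> poly p x}. moment_functional z 0 p)"

lemma upper_functional_le:
  assumes "g \<in> poly_growth" "\<And>x. 0 \<le> x \<Longrightarrow> g x \<le> poly p x"
  shows "upper_functional g \<le> moment_functional z 0 p"
  unfolding upper_functional_def
proof (rule cINF_lower)
  obtain r where r: "\<And>x. 0 \<le> x \<Longrightarrow> \<bar>g x\<bar> \<le> poly r x"
    using assms(1) by (auto simp: poly_growth_def)
  show "bdd_below (moment_functional z 0 ` {p. \<forall>x\<ge>0. g x \<le> poly p x})"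
  proof (rule bdd_belowI2)
    fix p assume p: "p \<in> {p. \<forall>x\<ge>0. g x \<le> poly p x}"
    show "moment_functional z 0 (- r) \<le> moment_functional z 0 p"
    proof (rule moment_functional_mono)
      fix x :: real assume "0 \<le> x"
      then show "poly (- r) x \<le> poly p x" using r[of x] p by force
    qed
  qed
qed (use assms(2) in simp)

lemma upper_functional_ge:
  assumes "g \<in> poly_growth"
    and "\<And>p. (\<And>x. 0 \<le> x \<Longrightarrow> g x \<le> poly p x) \<Longrightarrow> b \<le> moment_functional z 0 p"
  shows "b \<le> upper_functional g"
  unfolding upper_functional_def
proof (rule cINF_greatest)
  obtain r where r: "\<And>x. 0 \<le> x \<Longrightarrow> \<bar>g x\<bar> \<le> poly r x"
    using assms(1) by (auto simp: poly_growth_def)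
  then have "\<forall>x\<ge>0. g x \<le> poly r x" by (metis abs_le_D1)
  then show "{p. \<forall>x\<ge>0. g x \<le> poly p x} \<noteq> {}" by blast
qed (use assms(2) in simp)

lemma sublinear_upper_functional: "sublinear_on poly_growth upper_functional"
  unfolding sublinear_on_def
proof (intro conjI ballI allI impI)
  fix f g assume f: "f \<in> poly_growth" and g: "g \<in> poly_growth"
  have "upper_functional (\<lambda>x. f x + g x) - moment_functional z 0 q \<le> upper_functional f"
    if q: "\<And>x. 0 \<le> x \<Longrightarrow> g x \<le> poly q x" for q
  proof (rule upper_functional_ge[OF f])
    fix p assume p: "\<And>x. 0 \<le> x \<Longrightarrow> f x \<le> poly p x"
    have "upper_functional (\<lambda>x. f x + g x) \<le> moment_functional z 0 (p + q)"
      using p q by (intro upper_functional_le poly_growth.add_mem f g) (simp add: add_mono)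
    then show "upper_functional (\<lambda>x. f x + g x) - moment_functional z 0 q \<le> moment_functional z 0 p"
      by (simp add: moment_functional_add)
  qed
  then have "upper_functional (\<lambda>x. f x + g x) - upper_functional f \<le> upper_functional g"
    by (intro upper_functional_ge g) (simp add: algebra_simps)
  then show "upper_functional (\<lambda>x. f x + g x) \<le> upper_functional f + upper_functional g"
    by simp
next
  fix f and c :: real assume f: "f \<in> poly_growth" and c: "0 < c"
  have "upper_functional (\<lambda>x. c * f x) / c \<le> upper_functional f"
  proof (rule upper_functional_ge[OF f])
    fix p assume p: "\<And>x. 0 \<le> x \<Longrightarrow> f x \<le> poly p x"
    have "upper_functional (\<lambda>x. c * f x) \<le> moment_functional z 0 (Polynomial.smult c p)"
      using p c by (intro upper_functional_le poly_growth.scale_mem f) simp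
    then show "upper_functional (\<lambda>x. c * f x) / c \<le> moment_functional z 0 p"
      using c by (simp add: moment_functional_smult field_simps)
  qed
  then show "upper_functional (\<lambda>x. c * f x) \<le> c * upper_functional f"
    using c by (simp add: field_simps)
qed

text \<open>Domination by the upper functional alone suffices: f - g has the majorant 0 when f \<le>
  g, which gives monotonicity, and x^n and - x^n are their own majorants, which fixes the
  moments.\<close>

lemma positive_functional_exists: "\<exists>L. positive_functional L z"
proof -
  obtain L where add: "\<And>f g. f \<in> poly_growth \<Longrightarrow> g \<in> poly_growth \<Longrightarrow> L (\<lambda>x. f x + g x) = L f + L g"
    and scale: "\<And>f c. f \<in> poly_growth \<Longrightarrow> L (\<lambda>x. c * f x) = c * L f"
    and le: "\<And>f. f \<in> poly_growth \<Longrightarrow> L f \<le> upper_functional f"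
    using poly_growth.Hahn_Banach_sublinear[OF sublinear_upper_functional] by blast
  have le_poly: "L g \<le> moment_functional z 0 p"
    if "g \<in> poly_growth" "\<And>x. 0 \<le> x \<Longrightarrow> g x \<le> poly p x" for g p
    using le[OF that(1)] upper_functional_le[OF that] by linarith
  have "positive_functional L z"
  proof
    fix f g assume f: "f \<in> poly_growth" and g: "g \<in> poly_growth"
      and fg: "\<And>x. 0 \<le> x \<Longrightarrow> f x \<le> g x"
    have "L (\<lambda>x. f x + (- 1) * g x) \<le> moment_functional z 0 0"
      using fg by (intro le_poly poly_growth.add_mem poly_growth.scale_mem f g) simp
    also have "L (\<lambda>x. f x + (- 1) * g x) = L f - L g"
      unfolding add[OF f poly_growth.scale_mem[OF g]] scale[OF g] by simp
    finally show "L f \<le> L g" by (simp add: moment_functional_0)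
  next
    fix n
    have mf: "moment_functional z 0 (Polynomial.monom 1 n) = z n"
      by (simp add: moment_functional_eq[of _ "Suc n"] degree_monom_eq)
    have "L (\<lambda>x. x ^ n) \<le> z n"
      using le_poly[OF poly_growth_power, of n "Polynomial.monom 1 n"] mf by (simp add: poly_monom)
    moreover have "L (\<lambda>x. (- 1) * x ^ n) \<le> moment_functional z 0 (Polynomial.smult (- 1) (Polynomial.monom 1 n))"
      by (intro le_poly poly_growth.scale_mem poly_growth_power) (simp add: poly_monom)
    ultimately show "L (\<lambda>x. x ^ n) = z n"
      unfolding moment_functional_smult mf scale[OF poly_growth_power] by simp
  qed (use add scale in auto)
  then show ?thesis by blast
qed

end

text \<open>The count is the ceiling of u / \<delta> minus one. Thus u is approximated from below
  within \<delta> by a step function that can be written as a sum of indicators of tails.\<close>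

lemma card_multiples_below:
  fixes \<delta> u :: real
  assumes "0 < \<delta>" "0 \<le> u"
  defines "c \<equiv> real (card {i::nat. 1 \<le> i \<and> real i * \<delta> < u})"
  shows "\<delta> * c \<le> u" and "u \<le> \<delta> * c + \<delta>"
proof -
  have "{i::nat. 1 \<le> i \<and> real i * \<delta> < u} = {1..<nat \<lceil>u / \<delta>\<rceil>}"
    using assms(1) by (auto simp: pos_less_divide_eq[symmetric] less_ceiling_iff zless_nat_eq_int_zless)
  then have c: "c = real (nat \<lceil>u / \<delta>\<rceil> - 1)"
    by (simp add: c_def)
  have "0 \<le> u / \<delta>" using assms by simp
  then have ceil: "0 \<le> \<lceil>u / \<delta>\<rceil>" "real (nat \<lceil>u / \<delta>\<rceil>) = \<lceil>u / \<delta>\<rceil>"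
    by linarith+
  have "c \<le> u / \<delta>"
  proof (cases "nat \<lceil>u / \<delta>\<rceil> = 0")
    case False
    then have "1 \<le> nat \<lceil>u / \<delta>\<rceil>" by linarith
    from of_nat_diff[OF this, where ?'a = real] have "c = real_of_int \<lceil>u / \<delta>\<rceil> - 1"
      using c ceil(2) by linarith
    then show ?thesis using ceiling_correct[of "u / \<delta>"] by linarith
  qed (use c assms in simp)
  then show "\<delta> * c \<le> u"
    using assms(1) by (simp add: field_simps)
  have "u / \<delta> \<le> c + 1"
    using c ceil ceiling_correct[of "u / \<delta>"] by linarith
  then show "u \<le> \<delta> * c + \<delta>"
    using assms(1) by (simp add: field_simps)
qed

section \<open>The representing measure of a positive functional\<close>

context positive_functional
begin

lemma zero: "L (\<lambda>x. 0) = 0"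
  using scale[OF poly_growth.zero_mem, of 0] by simp

lemma const: "L (\<lambda>x. c) = c * z 0"
  using scale[OF poly_growth_power[of 0], of c] moment[of 0] by simp

lemma L_sum:
  assumes "finite I" "\<And>i. i \<in> I \<Longrightarrow> g i \<in> poly_growth"
  shows "(\<lambda>x. \<Sum>i\<in>I. g i x) \<in> poly_growth \<and> L (\<lambda>x. \<Sum>i\<in>I. g i x) = (\<Sum>i\<in>I. L (g i))"
  using assms
proof (induction I)
  case empty
  then show ?case by (simp add: poly_growth.zero_mem zero)
next
  case (insert i I)
  then have IH: "(\<lambda>x. \<Sum>i\<in>I. g i x) \<in> poly_growth" "L (\<lambda>x. \<Sum>i\<in>I. g i x) = (\<Sum>i\<in>I. L (g i))"
    and i: "g i \<in> poly_growth"
    by auto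
  show ?case
    using insert.hyps poly_growth.add_mem[OF i IH(1)] add[OF i IH(1)] IH(2) by simp
qed

lemma indicator_mem: "indicator A \<in> poly_growth"
  by (rule poly_growth_bounded[of _ 1]) (simp add: indicator_def)

definition F :: "real \<Rightarrow> real" where
  "F q = L (indicator {..q})"

lemma F_mono: "q \<le> q' \<Longrightarrow> F q \<le> F q'"
  unfolding F_def by (rule mono[OF indicator_mem indicator_mem]) (simp add: indicator_def)

lemma F_nonneg: "0 \<le> F q"
  using mono[OF poly_growth.zero_mem indicator_mem[of "{..q}"]] by (simp add: F_def zero)

lemma F_neg: "q < 0 \<Longrightarrow> F q = 0"
  using mono[OF indicator_mem[of "{..q}"] poly_growth.zero_mem] F_nonneg[of q]
  by (simp add: F_def zero indicator_def)

lemma L_tail: "L (indicator {q<..}) = z 0 - F q"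
proof -
  have "(\<lambda>x. indicator {q<..} x + indicator {..q} x) = (\<lambda>x. x ^ 0 :: real)"
    by (auto simp: indicator_def fun_eq_iff)
  then show ?thesis
    using add[OF indicator_mem[of "{q<..}"] indicator_mem[of "{..q}"]] moment[of 0] by (simp add: F_def)
qed

lemma F_le: "F q \<le> z 0"
  using mono[OF poly_growth.zero_mem indicator_mem[of "{q<..}"]] L_tail[of q] by (simp add: zero)

text \<open>Markov's inequality. It prevents mass from escaping to infinity, so the measure has
  total mass \<open>z 0\<close>.\<close>

lemma F_tail: "0 < q \<Longrightarrow> z 0 - z 1 / q \<le> F q"
proof -
  assume q: "0 < q"
  have "L (indicator {q<..}) \<le> L (\<lambda>x. (1 / q) * x ^ 1)"
    using q by (intro mono indicator_mem poly_growth.scale_mem poly_growth_power)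
      (auto simp: indicator_def field_simps)
  then show ?thesis
    unfolding L_tail scale[OF poly_growth_power] moment by simp
qed

text \<open>The right-continuous version of \<open>F\<close>. Since \<open>L\<close> is only known
  to be finitely additive, \<open>F\<close> itself may fail to be right-continuous.\<close>

definition G :: "real \<Rightarrow> real" where
  "G q = (INF y\<in>{q<..}. F y)"

lemma F_bdd_below: "bdd_below (F ` S)"
  using F_nonneg by (intro bdd_belowI2[of _ 0]) auto

lemma G_le: "q < y \<Longrightarrow> G q \<le> F y"
  unfolding G_def by (intro cINF_lower F_bdd_below) simp

lemma F_le_G: "F q \<le> G q"
  unfolding G_def by (rule cINF_greatest) (auto intro: F_mono)

lemma G_mono: "q \<le> q' \<Longrightarrow> G q \<le> G q'"
  unfolding G_def[of q'] by (rule cINF_greatest) (auto intro: G_le)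

lemma G_neg: "q < 0 \<Longrightarrow> G q = 0"
  using G_le[of q "q / 2"] F_le_G[of q] F_neg[of q] F_neg[of "q / 2"] by simp

lemma G_le_total: "G q \<le> z 0"
  using G_le[of q "q + 1"] F_le[of "q + 1"] by simp

lemma G_right_continuous: "continuous (at_right a) G"
  unfolding continuous_within
proof (rule order_tendstoI)
  fix l assume "l < G a"
  then have "l < G x" if "a < x" for x
    using G_mono[of a x] that by simp
  then show "\<forall>\<^sub>F x in at_right a. l < G x"
    unfolding eventually_at_filter by (intro always_eventually) auto
next
  fix u assume "G a < u"
  then obtain y where y: "a < y" "F y < u"
    unfolding G_def using cINF_less_iff[OF _ F_bdd_below, of "{a<..}"] by auto
  then have "G x < u" if "x < y" for x
    using G_le[OF that] by simp
  then show "\<forall>\<^sub>F x in at_right a. G x < u"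
    using y(1) by (auto simp: eventually_at_right)
qed

lemma G_eq_F: "isCont F q \<Longrightarrow> G q = F q"
proof (rule order.antisym)
  assume "isCont F q"
  then have lim: "(F \<longlongrightarrow> F q) (at_right q)"
    by (metis continuous_within isContD tendsto_within_subset top_greatest continuous_at_imp_continuous_at_within)
  show "G q \<le> F q"
  proof (rule tendsto_lowerbound[OF lim])
    show "\<forall>\<^sub>F x in at_right q. G q \<le> F x"
      unfolding eventually_at_filter using G_le by (intro always_eventually) auto
  qed simp
qed (rule F_le_G)

definition \<mu> :: "real measure" where
  "\<mu> = interval_measure G"

lemma sets_\<mu>: "sets \<mu> = sets borel"
  by (simp add: \<mu>_def)

lemma space_\<mu>: "space \<mu> = UNIV"
  by (simp add: \<mu>_def)

lemma emeasure_Ioc: "a \<le> b \<Longrightarrow> emeasure \<mu> {a<..b} = ennreal (G b - G a)"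
  unfolding \<mu>_def by (rule emeasure_interval_measure_Ioc) (auto intro: G_mono G_right_continuous)

lemma emeasure_tail: "emeasure \<mu> {q<..} = ennreal (z 0 - G q)"
proof -
  have "(\<lambda>n. emeasure \<mu> {q<..q + real n}) \<longlonglongrightarrow> emeasure \<mu> (\<Union>n. {q<..q + real n})"
    by (rule Lim_emeasure_incseq) (auto simp: incseq_def sets_\<mu>)
  moreover have "(\<Union>n. {q<..q + real n}) = {q<..}"
  proof (intro Set.set_eqI iffI)
    fix x assume "x \<in> {q<..}"
    then have "x \<in> {q<..q + real (nat \<lceil>x - q\<rceil>)}" by (simp; linarith)
    then show "x \<in> (\<Union>n. {q<..q + real n})" by blast
  qed auto
  moreover have "(\<lambda>n. ennreal (G (q + real n) - G q)) \<longlonglongrightarrow> ennreal (z 0 - G q)"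
  proof (intro tendsto_ennrealI tendsto_diff tendsto_const)
    show "(\<lambda>n. G (q + real n)) \<longlonglongrightarrow> z 0"
    proof (rule tendsto_sandwich)
      show "(\<lambda>n. z 0 - z 1 / (q + real n)) \<longlonglongrightarrow> z 0" by real_asymp
      have "\<forall>\<^sub>F n in sequentially. 0 < q + real n" by real_asymp
      then show "\<forall>\<^sub>F n in sequentially. z 0 - z 1 / (q + real n) \<le> G (q + real n)"
        by eventually_elim (meson F_tail F_le_G order.trans)
      show "\<forall>\<^sub>F n in sequentially. G (q + real n) \<le> z 0"
        using G_le_total by simp
    qed simp
  qed
  moreover have "emeasure \<mu> {q<..q + real n} = ennreal (G (q + real n) - G q)" for n
    by (rule emeasure_Ioc) simp
  ultimately show ?thesis
    using LIMSEQ_unique by auto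
qed

lemma emeasure_negative: "emeasure \<mu> {..<0} = 0"
proof -
  \<comment> \<open>The right end points stay strictly negative, because \<open>G\<close> may have a
    jump at 0.\<close>
  have "(\<Union>n. {- real n - 1<..- 1 / (real n + 1)}) = {..<0::real}"
  proof (intro Set.set_eqI iffI)
    fix x :: real assume "x \<in> {..<0}"
    then have x: "x < 0" by simp
    obtain n where "max (- x) (1 / - x) \<le> real n" using real_arch_simple by blast
    then have "- x \<le> real n" "1 / - x \<le> real n" by simp_all
    then have "x \<in> {- real n - 1<..- 1 / (real n + 1)}"
      using x by (auto simp: field_simps)
    then show "x \<in> (\<Union>n. {- real n - 1<..- 1 / (real n + 1)})" by blast
  next
    fix x :: real assume "x \<in> (\<Union>n. {- real n - 1<..- 1 / (real n + 1)})"
    then obtain n where "x \<le> - 1 / (real n + 1)" by auto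
    also have "\<dots> < 0" by (simp add: divide_simps)
    finally show "x \<in> {..<0}" by simp
  qed
  moreover have "emeasure \<mu> {- real n - 1<..- 1 / (real n + 1)} = 0" for n
  proof -
    have "- 1 / (real n + 1) < 0" "- real n - 1 \<le> - 1 / (real n + 1)"
      by (simp_all add: field_simps)
    then show ?thesis
      using emeasure_Ioc[of "- real n - 1" "- 1 / (real n + 1)"] by (simp add: G_neg)
  qed
  then have "emeasure \<mu> (\<Union>n. {- real n - 1<..- 1 / (real n + 1)}) = 0"
    by (intro emeasure_UN_eq_0) (auto simp: sets_\<mu>)
  ultimately show ?thesis by simp
qed

lemma AE_nonneg: "AE x in \<mu>. 0 \<le> x"
proof (rule AE_I)
  show "{x \<in> space \<mu>. \<not> 0 \<le> x} \<subseteq> {..<0}" by auto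
qed (simp_all add: emeasure_negative sets_\<mu>)

lemma emeasure_UNIV: "emeasure \<mu> UNIV = ennreal (z 0)"
proof -
  have "emeasure \<mu> UNIV = emeasure \<mu> {-1<..}"
  proof (rule emeasure_eq_AE)
    show "AE x in \<mu>. (x \<in> UNIV) = (x \<in> {-1<..})"
      using AE_nonneg by eventually_elim auto
  qed (simp_all add: sets_\<mu>)
  then show ?thesis by (simp add: emeasure_tail G_neg)
qed

lemma finite_measure_\<mu>: "finite_measure \<mu>"
  by (rule finite_measureI) (simp add: space_\<mu> emeasure_UNIV)

lemma z0_nonneg: "0 \<le> z 0"
  using F_nonneg F_le order.trans by blast

lemma has_integral_const: "has_bochner_integral \<mu> (\<lambda>x. c) (c * z 0)"
proof -
  interpret finite_measure \<mu> by (rule finite_measure_\<mu>)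
  show ?thesis
    by (simp add: has_bochner_integral_iff space_\<mu> measure_def emeasure_UNIV z0_nonneg)
qed

lemma has_integral_tail: "has_bochner_integral \<mu> (indicator {q<..}) (z 0 - G q)"
proof -
  have "has_bochner_integral \<mu> (indicator {q<..}) (measure \<mu> {q<..})"
    by (rule has_bochner_integral_real_indicator) (simp_all add: sets_\<mu> emeasure_tail)
  then show ?thesis
    using G_le_total[of q] by (simp add: measure_def emeasure_tail)
qed

text \<open>Truncation at \<open>K\<close> makes the power bounded and integrable before anything is
  known about moments of \<mu>; the maximum removes negative arguments, whose odd powers would spoil
  monotonicity in \<open>K\<close>.\<close>

definition truncated_power :: "nat \<Rightarrow> nat \<Rightarrow> real \<Rightarrow> real" where
  "truncated_power n K x = min (max 0 x ^ n) (real K)"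

lemma truncated_power_mem: "truncated_power n K \<in> poly_growth"
  by (rule poly_growth_bounded[of _ "real K"]) (simp add: truncated_power_def)

lemma truncated_power_measurable: "truncated_power n K \<in> borel_measurable \<mu>"
proof -
  have "truncated_power n K \<in> borel_measurable borel"
    unfolding truncated_power_def[abs_def] by measurable
  then show ?thesis
    using measurable_cong_sets[OF sets_\<mu> refl] by blast
qed

lemma truncated_power_integrable: "integrable \<mu> (truncated_power n K)"
proof -
  interpret finite_measure \<mu> by (rule finite_measure_\<mu>)
  show ?thesis
    by (rule integrable_const_bound[of _ "real K"])
      (auto simp: truncated_power_def truncated_power_measurable)
qed

text \<open>
  Both sides are compared with the same step function, whose jumps lie at continuity points of \<open>F\<close>,
  where \<open>L\<close> and \<open>\<mu>\<close> agree on tails.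
\<close>

lemma integral_truncated_power:
  assumes n: "0 < n"
  shows "integral\<^sup>L \<mu> (truncated_power n K) = L (truncated_power n K)"
proof -
  let ?u = "truncated_power n K"
  define bad where "bad = {a. \<not> isCont F a}"
  have "countable bad"
    unfolding bad_def by (rule mono_ctble_discont) (auto intro: monoI F_mono)
  have step: "\<exists>\<delta>. 0 < \<delta> \<and> \<delta> < \<epsilon> \<and> \<bar>integral\<^sup>L \<mu> ?u - L ?u\<bar> \<le> \<delta> * z 0" if \<epsilon>: "0 < \<epsilon>" for \<epsilon>
  proof -
    \<comment> \<open>The monotone \<open>F\<close> has countably many discontinuities. Avoiding the
      countably many values b^n / i as \<delta> makes every threshold
      \<open>root n (i * \<delta>)\<close> a continuity point.\<close>
    have "countable (\<Union>i::nat. (\<lambda>b. b ^ n / real i) ` bad)"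
      using \<open>countable bad\<close> by auto
    then have "\<not> {0<..<\<epsilon>} \<subseteq> (\<Union>i::nat. (\<lambda>b. b ^ n / real i) ` bad)"
      using \<epsilon> uncountable_open_interval countable_subset by blast
    then obtain \<delta> where \<delta>: "0 < \<delta>" "\<delta> < \<epsilon>" and nb: "\<delta> \<notin> (\<Union>i::nat. (\<lambda>b. b ^ n / real i) ` bad)"
      by (auto simp: subset_iff)
    have good: "isCont F (root n (real i * \<delta>))" if "1 \<le> i" for i
    proof (rule ccontr)
      assume "\<not> isCont F (root n (real i * \<delta>))"
      then have "root n (real i * \<delta>) \<in> bad" by (simp add: bad_def)
      moreover have "\<delta> = root n (real i * \<delta>) ^ n / real i"
        using that \<delta> n by simp
      ultimately show False using nb by blast
    qed
    define I where "I = {i::nat. 1 \<le> i \<and> real i * \<delta> < real K}"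
    have "I \<subseteq> {..nat \<lceil>real K / \<delta>\<rceil>}"
      using \<delta> by (auto simp: I_def pos_less_divide_eq[symmetric] nat_le_iff le_nat_iff) linarith
    then have finI: "finite I" by (rule finite_subset) simp
    \<comment> \<open>The layers of height \<delta>: x lies beyond the i-th threshold exactly when i
      \<delta> is below the truncated power. Positive thresholds make \<open>S\<close> vanish for
      negative x, and \<open>K\<close> makes the number of layers finite.\<close>
    define S where "S x = (\<Sum>i\<in>I. \<delta> * indicator {root n (real i * \<delta>)<..} x)" for x
    have S_eq: "S x = \<delta> * real (card {i::nat. 1 \<le> i \<and> real i * \<delta> < ?u x})" for x
    proof -
      have iff: "root n (real i * \<delta>) < x \<longleftrightarrow> real i * \<delta> < max 0 x ^ n" if "i \<in> I" for i
      proof -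
        have pos: "0 < real i * \<delta>" using that \<delta> by (simp add: I_def)
        show ?thesis
        proof (cases "0 < x")
          case True
          then have "root n (real i * \<delta>) < root n (x ^ n) \<longleftrightarrow> real i * \<delta> < x ^ n"
            using n by simp
          then show ?thesis using True n by (simp add: real_root_power_cancel)
        next
          case False
          then have "max 0 x ^ n = 0" using n by simp
          moreover have "0 < root n (real i * \<delta>)"
            using n pos by (rule real_root_gt_zero)
          then have "\<not> root n (real i * \<delta>) < x" using False by linarith
          ultimately show ?thesis using pos by linarith
        qed
      qed
      have "S x = \<delta> * (\<Sum>i\<in>I. indicator {i. real i * \<delta> < max 0 x ^ n} i)"
        unfolding S_def sum_distrib_left
        by (intro sum.cong refl) (auto simp: indicator_def iff)
      also have "(\<Sum>i\<in>I. indicator {i. real i * \<delta> < max 0 x ^ n} i :: real) =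
          real (card {i \<in> I. real i * \<delta> < max 0 x ^ n})"
        using finI by (simp add: indicator_def sum.If_cases Int_def)
      also have "{i \<in> I. real i * \<delta> < max 0 x ^ n} = {i::nat. 1 \<le> i \<and> real i * \<delta> < ?u x}"
        by (auto simp: I_def truncated_power_def)
      finally show ?thesis .
    qed
    have u_nonneg: "0 \<le> ?u x" for x by (simp add: truncated_power_def)
    have lower: "S x \<le> ?u x" and upper: "?u x \<le> S x + \<delta>" for x
      unfolding S_eq using card_multiples_below[OF \<delta>(1) u_nonneg] by auto
    let ?s = "\<Sum>i\<in>I. \<delta> * (z 0 - F (root n (real i * \<delta>)))"
    have S_mem: "S \<in> poly_growth" and LS: "L S = ?s"
      using L_sum[OF finI, of "\<lambda>i x. \<delta> * indicator {root n (real i * \<delta>)<..} x"]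
      unfolding S_def[abs_def] by (simp_all add: poly_growth.scale_mem indicator_mem scale L_tail)
    have \<delta>_mem: "(\<lambda>x. \<delta>) \<in> poly_growth"
      by (rule poly_growth_bounded[of _ "\<bar>\<delta>\<bar>"]) simp
    have "L S \<le> L ?u"
      by (rule mono[OF S_mem truncated_power_mem lower])
    moreover have "L ?u \<le> L (\<lambda>x. S x + \<delta>)"
      by (rule mono[OF truncated_power_mem poly_growth.add_mem[OF S_mem \<delta>_mem] upper])
    moreover have "L (\<lambda>x. S x + \<delta>) = ?s + \<delta> * z 0"
      by (simp add: add[OF S_mem \<delta>_mem] LS const)
    moreover have IS: "has_bochner_integral \<mu> S ?s"
      unfolding S_def[abs_def]
    proof (rule has_bochner_integral_sum)
      fix i assume "i \<in> I"
      then have "G (root n (real i * \<delta>)) = F (root n (real i * \<delta>))"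
        by (intro G_eq_F good) (simp add: I_def)
      then show "has_bochner_integral \<mu> (\<lambda>x. \<delta> * indicator {root n (real i * \<delta>)<..} x)
          (\<delta> * (z 0 - F (root n (real i * \<delta>))))"
        using has_bochner_integral_mult_right[OF has_integral_tail[of "root n (real i * \<delta>)"], of \<delta>] by simp
    qed
    have IS\<delta>: "has_bochner_integral \<mu> (\<lambda>x. S x + \<delta>) (?s + \<delta> * z 0)"
      by (rule has_bochner_integral_add[OF IS has_integral_const])
    have "?s \<le> integral\<^sup>L \<mu> ?u"
      using integral_mono[OF _ truncated_power_integrable lower] IS
      by (auto simp: has_bochner_integral_iff)
    moreover have "integral\<^sup>L \<mu> ?u \<le> ?s + \<delta> * z 0"
      using integral_mono[OF truncated_power_integrable _ upper] IS\<delta>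
      by (auto simp: has_bochner_integral_iff)
    ultimately have "\<bar>integral\<^sup>L \<mu> ?u - L ?u\<bar> \<le> \<delta> * z 0"
      using LS by linarith
    then show ?thesis using \<delta> by blast
  qed
  \<comment> \<open>Letting \<delta> tend to 0. The denominator \<open>z 0 + 1\<close> stays
    positive even if the total mass is 0.\<close>
  have "\<bar>integral\<^sup>L \<mu> ?u - L ?u\<bar> \<le> 0 + e" if e: "0 < e" for e
  proof -
    obtain \<delta> where \<delta>: "0 < \<delta>" "\<delta> < e / (z 0 + 1)" "\<bar>integral\<^sup>L \<mu> ?u - L ?u\<bar> \<le> \<delta> * z 0"
      using step[of "e / (z 0 + 1)"] e z0_nonneg by auto
    have "\<delta> * z 0 \<le> \<delta> * (z 0 + 1)" using \<delta> by simp
    also have "\<dots> \<le> e" using \<delta>(2) z0_nonneg by (simp add: field_simps)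
    finally show ?thesis using \<delta>(3) by simp
  qed
  then have "\<bar>integral\<^sup>L \<mu> ?u - L ?u\<bar> \<le> 0" by (rule field_le_epsilon)
  then show ?thesis by simp
qed

lemma has_integral_power: "has_bochner_integral \<mu> (\<lambda>x. x ^ n) (z n)"
proof (cases "n = 0")
  case True
  then show ?thesis using has_integral_const[of 1] by simp
next
  case False
  have measurable: "(\<lambda>x. max 0 x ^ n) \<in> borel_measurable \<mu>" "(\<lambda>x. x ^ n) \<in> borel_measurable \<mu>"
    unfolding measurable_cong_sets[OF sets_\<mu> refl] by measurable
  have "has_bochner_integral \<mu> (\<lambda>x. max 0 x ^ n) (z n)"
  proof (rule has_bochner_integral_monotone_convergence)
    show "integrable \<mu> (truncated_power n K)" for K
      by (rule truncated_power_integrable)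
    show "AE x in \<mu>. mono (\<lambda>K. truncated_power n K x)"
      by (auto simp: truncated_power_def mono_def min_le_iff_disj)
    have "(\<lambda>K. truncated_power n K x) \<longlonglongrightarrow> max 0 x ^ n" for x
    proof (rule tendsto_eventually)
      show "\<forall>\<^sub>F K in sequentially. truncated_power n K x = max 0 x ^ n"
        using eventually_ge_at_top[of "nat \<lceil>max 0 x ^ n\<rceil>"]
        by eventually_elim (simp add: truncated_power_def min_def nat_le_iff ceiling_le_iff)
    qed
    then show "AE x in \<mu>. (\<lambda>K. truncated_power n K x) \<longlonglongrightarrow> max 0 x ^ n" by simp
    show "(\<lambda>K. integral\<^sup>L \<mu> (truncated_power n K)) \<longlonglongrightarrow> z n"
    proof (rule tendsto_sandwich)
      show "(\<lambda>K. z n - z (n + n) / real K) \<longlonglongrightarrow> z n" by real_asymp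
      \<comment> \<open>The moment of order 2 n controls the loss by truncation: where x^n exceeds K
        it is at most x^(2n) / K. Hence the integrals of the truncations converge to
        \<open>z n\<close> itself.\<close>
      have "z n \<le> L (truncated_power n K) + (1 / real K) * z (n + n)" if "0 < K" for K
      proof -
        have "x ^ n \<le> truncated_power n K x + (1 / real K) * x ^ (n + n)" if "0 \<le> x" for x
        proof (cases "x ^ n \<le> real K")
          case True
          then show ?thesis using that by (simp add: truncated_power_def min_def)
        next
          case False
          have "x ^ n * real K \<le> x ^ n * x ^ n"
            using False that by (intro mult_left_mono) auto
          then have "x ^ n \<le> (1 / real K) * x ^ (n + n)"
            using \<open>0 < K\<close> by (simp add: field_simps power_add)
          moreover have "0 \<le> truncated_power n K x" by (simp add: truncated_power_def)
          ultimately show ?thesis by simp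
        qed
        then have "L (\<lambda>x. x ^ n) \<le> L (\<lambda>x. truncated_power n K x + (1 / real K) * x ^ (n + n))"
          by (intro mono poly_growth_power poly_growth.add_mem poly_growth.scale_mem truncated_power_mem)
        also have "\<dots> = L (truncated_power n K) + (1 / real K) * z (n + n)"
          by (simp only: add[OF truncated_power_mem poly_growth.scale_mem[OF poly_growth_power]]
              scale[OF poly_growth_power] moment)
        finally show ?thesis by (simp only: moment)
      qed
      then have "z n - z (n + n) / real K \<le> integral\<^sup>L \<mu> (truncated_power n K)" if "0 < K" for K
        using that False by (simp add: integral_truncated_power algebra_simps)
      then show "\<forall>\<^sub>F K in sequentially. z n - z (n + n) / real K \<le> integral\<^sup>L \<mu> (truncated_power n K)"
        using eventually_gt_at_top[of 0] by (rule eventually_mono[rotated])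
      have "L (truncated_power n K) \<le> L (\<lambda>x. x ^ n)" for K
        by (rule mono[OF truncated_power_mem poly_growth_power]) (simp add: truncated_power_def)
      then show "\<forall>\<^sub>F K in sequentially. integral\<^sup>L \<mu> (truncated_power n K) \<le> z n"
        using False by (simp add: integral_truncated_power moment)
    qed simp
    show "(\<lambda>x. max 0 x ^ n) \<in> borel_measurable \<mu>"
      by (rule measurable)
  qed
  moreover have "AE x in \<mu>. max 0 x ^ n = x ^ n"
    using AE_nonneg by eventually_elim simp
  ultimately show ?thesis
    using has_bochner_integral_cong_AE[OF measurable] by blast
qed

lemma stieltjes: "stieltjes_moment z"
  unfolding stieltjes_moment_def using sets_\<mu> emeasure_negative has_integral_power by blast

end

theorem stieltjes_momentI:
  fixes z :: "nat \<Rightarrow> real"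
  assumes "\<And>n a. 0 \<le> (\<Sum>i<n. \<Sum>j<n. a i * a j * z (i + j))"
    and "\<And>n a. 0 \<le> (\<Sum>i<n. \<Sum>j<n. a i * a j * z (Suc (i + j)))"
  shows "stieltjes_moment z"
  using positive_functional_exists[OF assms] positive_functional.stieltjes by blast

section \<open>Riordan arrays\<close>

lemma fps_nth_power_eq_0:
  fixes f :: "'a::comm_ring_1 fps"
  assumes "fps_nth f 0 = 0" "n < k"
  shows "fps_nth (f ^ k) n = 0"
  using startsby_zero_power_prefix[OF assms(1), of k] assms(2) by blast

lemma fps_nth_mult_power_eq_0:
  fixes f :: "'a::comm_ring_1 fps"
  assumes "fps_nth f 0 = 0" "n < k"
  shows "fps_nth (H * f ^ k) n = 0"
  using assms by (simp add: fps_mult_nth fps_nth_power_eq_0)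

text \<open>With \<open>H\<close> = \<phi>(f) times a power of f, the right-hand side is a
  combination of entries of one row of the array.\<close>

lemma fps_nth_mult_compose:
  fixes f :: "'a::comm_ring_1 fps"
  assumes "fps_nth f 0 = 0"
  shows "fps_nth (H * (a oo f)) n = (\<Sum>i\<le>n. fps_nth a i * fps_nth (H * f ^ i) n)"
proof -
  have "fps_nth (a oo f) m = (\<Sum>i\<le>n. fps_nth a i * fps_nth (f ^ i) m)" if "m \<le> n" for m
    unfolding fps_compose_nth using that assms
    by (intro sum.mono_neutral_left) (auto simp: fps_nth_power_eq_0)
  then have "fps_nth (H * (a oo f)) n =
      (\<Sum>l=0..n. fps_nth H l * (\<Sum>i\<le>n. fps_nth a i * fps_nth (f ^ i) (n - l)))"
    unfolding fps_mult_nth by (intro sum.cong refl) simp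
  also have "\<dots> = (\<Sum>i\<le>n. \<Sum>l=0..n. fps_nth H l * (fps_nth a i * fps_nth (f ^ i) (n - l)))"
    unfolding sum_distrib_left by (rule sum.swap)
  also have "\<dots> = (\<Sum>i\<le>n. fps_nth a i * fps_nth (H * f ^ i) n)"
    unfolding fps_mult_nth sum_distrib_left by (intro sum.cong refl) (rule mult.left_commute)
  finally show ?thesis .
qed

lemma fps_nth_map_fps [simp]: "fps_nth (map_fps h f) n = h (fps_nth f n)"
  by (simp add: map_fps_def)

context comm_ring_hom
begin

lemma map_fps_mult: "map_fps hom (f * g) = map_fps hom f * map_fps hom g"
  by (rule fps_ext) (simp add: fps_mult_nth hom_sum hom_mult)

lemma map_fps_1: "map_fps hom 1 = 1"
  by (rule fps_ext) simp

lemma map_fps_power: "map_fps hom (f ^ n) = map_fps hom f ^ n"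
  by (induction n) (simp_all add: map_fps_mult map_fps_1)

lemma map_fps_compose: "map_fps hom (f oo g) = map_fps hom f oo map_fps hom g"
  by (rule fps_ext) (simp add: fps_compose_nth hom_sum hom_mult flip: map_fps_power)

lemma hom_of_nat_eq: "hom (of_nat n) = of_nat n"
  by (induction n) (simp_all add: hom_add)

lemma map_fps_deriv: "map_fps hom (fps_deriv f) = fps_deriv (map_fps hom f)"
  by (rule fps_ext) (simp add: hom_mult hom_add hom_of_nat_eq)

lemma map_fps_X: "map_fps hom fps_X = fps_X"
  by (rule fps_ext) (simp add: fps_X_def)

end

lemma (in inj_comm_ring_hom) map_fps_inject: "map_fps hom f = map_fps hom g \<longleftrightarrow> f = g"
  by (auto simp: fps_eq_iff)

text \<open>The chain rule applied to the compositional identity. It also shows that the derivative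
  of the inverse has nonzero constant term, so that its \<open>inverse\<close> is a true
  inverse.\<close>

lemma fps_deriv_of_inverse_deriv_fps_inv:
  fixes f :: "'a::field fps"
  assumes "fps_nth f 0 = 0" "fps_nth f 1 \<noteq> 0"
  shows "fps_deriv f = inverse (fps_deriv (fps_inv f)) oo f"
proof -
  let ?D = "fps_deriv (fps_inv f)"
  have "fps_deriv (fps_inv f oo f) = 1"
    unfolding fps_inv[OF assms] by (rule fps_deriv_fps_X)
  then have D: "(?D oo f) * fps_deriv f = 1"
    unfolding fps_compose_deriv[OF assms(1)] .
  have "fps_nth ((?D oo f) * fps_deriv f) 0 = 1"
    unfolding D by (rule fps_one_nth[THEN trans]) simp
  then have "fps_nth ?D 0 * fps_nth (fps_deriv f) 0 = 1"
    unfolding fps_mult_nth_0 fps_compose_nth_0 .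
  then have "fps_nth ?D 0 \<noteq> 0" by auto
  then have "inverse ?D * ?D = 1" by (rule inverse_mult_eq_1)
  then have "(inverse ?D oo f) * (?D oo f) = 1"
    unfolding fps_compose_mult_distrib[OF assms(1), symmetric] by (simp only: fps_compose_1)
  have "fps_deriv f = ((inverse ?D oo f) * (?D oo f)) * fps_deriv f"
    unfolding \<open>(inverse ?D oo f) * (?D oo f) = 1\<close> by (rule mult_1[symmetric])
  also have "\<dots> = inverse ?D oo f"
    unfolding mult.assoc D by (rule mult_1_right)
  finally show ?thesis .
qed

text \<open>This is \<open>m!\<close> times the entry of the exponential Riordan array (\<phi>(f),
  f). Leaving out the denominator \<open>m!\<close> makes sense in any commutative ring.\<close>

definition riordan_coeff :: "'a::comm_ring_1 fps \<Rightarrow> 'a fps \<Rightarrow> nat \<Rightarrow> nat \<Rightarrow> 'a" where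
  "riordan_coeff \<phi> f n m = of_nat (fact n) * fps_nth ((\<phi> oo f) * f ^ m) n"

lemma riordan_coeff_eq_0: "fps_nth f 0 = 0 \<Longrightarrow> n < m \<Longrightarrow> riordan_coeff \<phi> f n m = 0"
  by (simp add: riordan_coeff_def fps_nth_mult_power_eq_0)

lemma riordan_coeff_0: "fps_nth f 0 = 0 \<Longrightarrow> riordan_coeff \<phi> f 0 m = (if m = 0 then fps_nth \<phi> 0 else 0)"
  by (cases "m = 0") (simp_all add: riordan_coeff_eq_0, simp add: riordan_coeff_def)

text \<open>Row n + 1 is obtained by differentiating \<Phi>(f) with \<Phi> = \<phi> X^m; since f'
  contributes a fresh \<phi>(f), the result expands again in the products \<phi>(f) f^i of row
  n.\<close>

lemma riordan_coeff_Suc_idom: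
  fixes f \<phi> \<psi> :: "'a::idom fps"
  assumes f0: "fps_nth f 0 = 0" and f': "fps_deriv f = (\<phi> * \<psi>) oo f"
  shows "riordan_coeff \<phi> f (Suc n) m =
    (\<Sum>i\<le>n. riordan_coeff \<phi> f n i * fps_nth (\<psi> * fps_deriv (\<phi> * fps_X ^ m)) i)"
proof -
  have pow: "(\<phi> oo f) * f ^ m = (\<phi> * fps_X ^ m) oo f"
    unfolding fps_compose_mult_distrib[OF f0] fps_compose_power[OF f0, symmetric]
      fps_X_fps_compose_startby0[OF f0] ..
  have "fps_deriv ((\<phi> oo f) * f ^ m) = (fps_deriv (\<phi> * fps_X ^ m) oo f) * ((\<phi> * \<psi>) oo f)"
    unfolding pow fps_compose_deriv[OF f0] f' ..
  also have "\<dots> = (\<phi> oo f) * ((\<psi> * fps_deriv (\<phi> * fps_X ^ m)) oo f)"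
    unfolding fps_compose_mult_distrib[OF f0] by (simp only: ac_simps)
  finally have "fps_nth (fps_deriv ((\<phi> oo f) * f ^ m)) n =
      (\<Sum>i\<le>n. fps_nth (\<psi> * fps_deriv (\<phi> * fps_X ^ m)) i * fps_nth ((\<phi> oo f) * f ^ i) n)"
    using fps_nth_mult_compose[OF f0, of "\<phi> oo f" "\<psi> * fps_deriv (\<phi> * fps_X ^ m)" n] by presburger
  moreover have "riordan_coeff \<phi> f (Suc n) m = of_nat (fact n) * fps_nth (fps_deriv ((\<phi> oo f) * f ^ m)) n"
    unfolding riordan_coeff_def fps_deriv_nth fact_Suc of_nat_mult of_nat_id by (simp only: Suc_eq_plus1 ac_simps)
  ultimately have "riordan_coeff \<phi> f (Suc n) m = of_nat (fact n) *
      (\<Sum>i\<le>n. fps_nth (\<psi> * fps_deriv (\<phi> * fps_X ^ m)) i * fps_nth ((\<phi> oo f) * f ^ i) n)"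
    by (rule trans[rotated, OF arg_cong[where f = "(*) (of_nat (fact n))"]])
  also have "\<dots> = (\<Sum>i\<le>n. riordan_coeff \<phi> f n i * fps_nth (\<psi> * fps_deriv (\<phi> * fps_X ^ m)) i)"
    unfolding riordan_coeff_def sum_distrib_left
    by (rule sum.cong[OF refl]) (simp only: mult.assoc mult.commute mult.left_commute)
  finally show ?thesis .
qed

lemma (in comm_ring_hom) hom_riordan_coeff:
  "hom (riordan_coeff \<phi> f n m) = riordan_coeff (map_fps hom \<phi>) (map_fps hom f) n m"
  by (simp add: riordan_coeff_def hom_mult hom_of_nat_eq flip: map_fps_mult map_fps_power map_fps_compose)

text \<open>The composition rules behind the recurrence were used over an integral domain; the
  identity is checked after the embedding into the field and pulled back by injectivity.\<close>

lemma riordan_coeff_Suc: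
  fixes f \<phi> \<psi> :: "'a::comm_ring_1 fps" and \<iota> :: "'a \<Rightarrow> 'k::field"
  assumes \<iota>: "inj_comm_ring_hom \<iota>" and f0: "fps_nth f 0 = 0"
    and f': "fps_deriv f = (\<phi> * \<psi>) oo f"
  shows "riordan_coeff \<phi> f (Suc n) m =
    (\<Sum>i\<le>n. riordan_coeff \<phi> f n i * fps_nth (\<psi> * fps_deriv (\<phi> * fps_X ^ m)) i)"
proof -
  interpret inj_comm_ring_hom \<iota> by fact
  let ?m = "map_fps \<iota>"
  have "fps_deriv (?m f) = (?m \<phi> * ?m \<psi>) oo ?m f"
    by (simp only: f' map_fps_compose map_fps_mult map_fps_deriv[symmetric])
  moreover have "fps_nth (?m f) 0 = 0" by (simp add: f0)
  ultimately have "\<iota> (riordan_coeff \<phi> f (Suc n) m) = (\<Sum>i\<le>n. riordan_coeff (?m \<phi>) (?m f) n i *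
      fps_nth (?m \<psi> * fps_deriv (?m \<phi> * fps_X ^ m)) i)"
    unfolding hom_riordan_coeff by (intro riordan_coeff_Suc_idom)
  also have "?m \<psi> * fps_deriv (?m \<phi> * fps_X ^ m) = ?m (\<psi> * fps_deriv (\<phi> * fps_X ^ m))"
    by (simp only: map_fps_mult map_fps_deriv map_fps_power map_fps_X)
  also have "(\<Sum>i\<le>n. riordan_coeff (?m \<phi>) (?m f) n i * fps_nth (?m (\<psi> * fps_deriv (\<phi> * fps_X ^ m))) i) =
      \<iota> (\<Sum>i\<le>n. riordan_coeff \<phi> f n i * fps_nth (\<psi> * fps_deriv (\<phi> * fps_X ^ m)) i)"
    by (simp only: hom_sum hom_mult hom_riordan_coeff fps_nth_map_fps)
  finally show ?thesis by simp
qed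

text \<open>
  The two sums come from the Leibniz rule for the factor \<open>X^j\<close> of \<open>\<phi> X^(k + j)\<close>; weighted by \<open>\<alpha>^j / j!\<close>, they
  become the terms \<open>x\<close> and \<open>\<alpha>\<close> of the operator.
\<close>

lemma riordan_coeff_Suc_shift:
  fixes f \<phi> \<psi> :: "'a::comm_ring_1 fps" and \<iota> :: "'a \<Rightarrow> 'k::field"
  assumes "inj_comm_ring_hom \<iota>" and f0: "fps_nth f 0 = 0"
    and "fps_deriv f = (\<phi> * \<psi>) oo f"
  shows "riordan_coeff \<phi> f (Suc n) (k + j) =
    (\<Sum>i\<le>n. riordan_coeff \<phi> f n (i + j) * fps_nth (\<psi> * fps_deriv (\<phi> * fps_X ^ k)) i) +
    of_nat j * (\<Sum>i\<le>n. riordan_coeff \<phi> f n (i + (j - 1)) * fps_nth (\<psi> * (\<phi> * fps_X ^ k)) i)"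
proof -
  \<comment> \<open>Terms with i < l vanish by the power of X and those with i > n by triangularity,
    so the range may be moved by l.\<close>
  have shift: "(\<Sum>i\<le>n. riordan_coeff \<phi> f n i * fps_nth (g * fps_X ^ l) i) =
      (\<Sum>i\<le>n. riordan_coeff \<phi> f n (i + l) * fps_nth g i)" for g l
  proof -
    have "(\<Sum>i\<le>n. riordan_coeff \<phi> f n i * fps_nth (g * fps_X ^ l) i) =
        (\<Sum>i\<in>{l..<Suc n + l}. riordan_coeff \<phi> f n i * fps_nth (g * fps_X ^ l) i)"
      by (rule sum.mono_neutral_cong)
        (auto simp: fps_X_power_mult_right_nth riordan_coeff_eq_0[OF f0])
    also have "\<dots> = (\<Sum>i<Suc n. riordan_coeff \<phi> f n (i + l) * fps_nth (g * fps_X ^ l) (i + l))"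
      using sum.shift_bounds_nat_ivl[of _ 0 l "Suc n"] by (simp add: lessThan_atLeast0 del: sum.op_ivl_Suc)
    finally show ?thesis
      by (simp add: fps_X_power_mult_right_nth lessThan_Suc_atMost)
  qed
  \<comment> \<open>At j = 0 the exponent \<open>j - 1\<close> is truncated to 0, but there the
    factor \<open>of_nat j\<close> vanishes.\<close>
  have "\<psi> * fps_deriv (\<phi> * fps_X ^ (k + j)) =
      (\<psi> * fps_deriv (\<phi> * fps_X ^ k)) * fps_X ^ j + of_nat j * ((\<psi> * (\<phi> * fps_X ^ k)) * fps_X ^ (j - 1))"
    unfolding power_add mult.assoc[symmetric] fps_deriv_mult fps_deriv_power' fps_deriv_fps_X
    by (simp add: ring_distribs ac_simps)
  then have "fps_nth (\<psi> * fps_deriv (\<phi> * fps_X ^ (k + j))) i =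
      fps_nth ((\<psi> * fps_deriv (\<phi> * fps_X ^ k)) * fps_X ^ j) i +
      of_nat j * fps_nth ((\<psi> * (\<phi> * fps_X ^ k)) * fps_X ^ (j - 1)) i" for i
    by (simp only: fps_add_nth fps_of_nat[symmetric] fps_mult_left_const_nth)
  then have "riordan_coeff \<phi> f (Suc n) (k + j) =
      (\<Sum>i\<le>n. riordan_coeff \<phi> f n i * fps_nth ((\<psi> * fps_deriv (\<phi> * fps_X ^ k)) * fps_X ^ j) i) +
      of_nat j * (\<Sum>i\<le>n. riordan_coeff \<phi> f n i * fps_nth ((\<psi> * (\<phi> * fps_X ^ k)) * fps_X ^ (j - 1)) i)"
    unfolding riordan_coeff_Suc[OF assms]
    by (simp only: distrib_left sum.distrib sum_distrib_left mult.left_commute[of _ "of_nat j"])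
  then show ?thesis
    by (simp only: shift)
qed

definition toeplitz :: "(nat \<Rightarrow> 'a::zero) \<Rightarrow> nat \<Rightarrow> nat \<Rightarrow> 'a" where
  "toeplitz h i j = (if j \<le> i then h (i - j) else 0)"

lemma totally_positive_entry:
  assumes "totally_positive P M"
  shows "P (M i j)"
proof -
  have "strict_mono_on {..<1::nat} g" for g :: "nat \<Rightarrow> nat"
    by (auto simp: strict_mono_on_def)
  then have "P (Determinant.det (Matrix.mat 1 1 (\<lambda>(a, b). M i j)))"
    using assms[unfolded totally_positive_def, rule_format, of 1 "\<lambda>_. i" "\<lambda>_. j"] by blast
  then show ?thesis by (simp add: det_single)
qed

text \<open>
  Here \<open>d j\<close> stands for \<open>1 / j!\<close>.  Up to the factor \<open>k!\<close>, this is the coefficient of \<open>x^k\<close> in the \<open>n\<close>-th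
  iterate of the operator \<open>\<phi>(D) (\<alpha> + \<beta> x) \<psi>(D)\<close> on the constant \<open>\<phi>(0)\<close>.
\<close>

definition riordan_eval ::
    "('a::comm_ring_1 \<Rightarrow> 'b::comm_ring_1) \<Rightarrow> (nat \<Rightarrow> 'b) \<Rightarrow> 'a fps \<Rightarrow> 'a fps \<Rightarrow> 'b \<Rightarrow> 'b \<Rightarrow> nat \<Rightarrow> nat \<Rightarrow> 'b" where
  "riordan_eval \<theta> d \<phi> f \<alpha> \<beta> n k =
    (\<Sum>j\<le>n. \<theta> (riordan_coeff \<phi> f n (k + j)) * d j * \<alpha> ^ j * \<beta> ^ (n - j))"

lemma (in comm_ring_hom) hom_riordan_eval:
  "hom (riordan_eval \<theta> d \<phi> f \<alpha> \<beta> n k) =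
    riordan_eval (\<lambda>a. hom (\<theta> a)) (\<lambda>j. hom (d j)) \<phi> f (hom \<alpha>) (hom \<beta>) n k"
  by (simp add: riordan_eval_def hom_sum hom_mult hom_power)

text \<open>\<theta> moves coefficients to the ring in which positivity is measured and the
  parameters live. In an arbitrary commutative ring the inverse factorials \<open>d\<close> are
  specified by an equation.\<close>

locale riordan_production = nonneg_cone P + comm_ring_hom \<theta>
  for P :: "'b::comm_ring_1 \<Rightarrow> bool" and \<theta> :: "'a::comm_ring_1 \<Rightarrow> 'b" +
  fixes \<phi> \<psi> f :: "'a fps" and \<iota> :: "'a \<Rightarrow> 'k::field" and d :: "nat \<Rightarrow> 'b"
  assumes \<iota>: "inj_comm_ring_hom \<iota>" and f0: "fps_nth f 0 = 0"
    and f': "fps_deriv f = (\<phi> * \<psi>) oo f"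
    and tp_\<phi>: "totally_positive P (toeplitz (\<lambda>n. \<theta> (fps_nth \<phi> n)))"
    and tp_\<psi>: "totally_positive P (toeplitz (\<lambda>n. \<theta> (fps_nth \<psi> n)))"
    and d: "d n * of_nat (fact n) = 1"
begin

lemma d_0: "d 0 = 1"
  using d[of 0] by simp

lemma d_Suc: "of_nat (Suc n) * d (Suc n) = d n"
proof -
  have "of_nat (Suc n) * d (Suc n) = of_nat (Suc n) * d (Suc n) * (d n * of_nat (fact n))"
    by (simp only: d mult_1_right)
  also have "\<dots> = (d (Suc n) * of_nat (fact (Suc n))) * d n"
    by (simp only: fact_Suc of_nat_mult of_nat_id ac_simps)
  finally show ?thesis by (simp only: d mult_1_left)
qed

lemma d_choose:
  assumes "k \<le> m"
  shows "d m * of_nat (m choose k) = d k * d (m - k)"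
proof -
  have fact: "of_nat (fact k) * of_nat (fact (m - k)) * of_nat (m choose k) = (of_nat (fact m) :: 'b)"
    using binomial_fact_lemma[OF assms] by (simp only: of_nat_mult[symmetric])
  have "d m * of_nat (m choose k) =
      d m * of_nat (m choose k) * (d k * of_nat (fact k)) * (d (m - k) * of_nat (fact (m - k)))"
    by (simp only: d mult_1_right)
  also have "\<dots> = d m * (of_nat (fact k) * of_nat (fact (m - k)) * of_nat (m choose k)) * (d k * d (m - k))"
    by (simp only: ac_simps)
  also have "\<dots> = d k * d (m - k)"
    by (simp only: fact d mult_1_left)
  finally show ?thesis .
qed

abbreviation c :: "nat \<Rightarrow> nat \<Rightarrow> 'a" where
  "c \<equiv> riordan_coeff \<phi> f"

abbreviation U :: "'b \<Rightarrow> 'b \<Rightarrow> nat \<Rightarrow> nat \<Rightarrow> 'b" where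
  "U \<equiv> riordan_eval \<theta> d \<phi> f"

text \<open>Multiplication by \<alpha> + \<beta> x in the basis x^i / i!, where x times the i-th
  basis element is i + 1 times the next one.\<close>

definition bidiagonal :: "'b \<Rightarrow> 'b \<Rightarrow> nat \<Rightarrow> nat \<Rightarrow> 'b" where
  "bidiagonal \<alpha> \<beta> i j = (if j = i then \<alpha> else if j = Suc i then of_nat (Suc i) * \<beta> else 0)"

definition production :: "'b \<Rightarrow> 'b \<Rightarrow> nat \<Rightarrow> nat \<Rightarrow> 'b" where
  "production \<alpha> \<beta> i k = (\<Sum>l<Suc i. toeplitz (\<lambda>n. \<theta> (fps_nth \<psi> n)) i l *
    (\<Sum>e<Suc (Suc l). bidiagonal \<alpha> \<beta> l e * toeplitz (\<lambda>n. \<theta> (fps_nth \<phi> n)) e k))"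

text \<open>Read by columns: column \<open>k\<close> of the Toeplitz matrix of \<phi> is the series
  \<phi> X^k, the bidiagonal matrix sends a column g to \<alpha> g + \<beta> g', and the Toeplitz
  matrix of \<psi> multiplies by \<psi>.\<close>

lemma production_eq:
  "production \<alpha> \<beta> i k = \<beta> * \<theta> (fps_nth (\<psi> * fps_deriv (\<phi> * fps_X ^ k)) i) +
    \<alpha> * \<theta> (fps_nth (\<psi> * (\<phi> * fps_X ^ k)) i)"
proof -
  have \<phi>: "toeplitz (\<lambda>n. \<theta> (fps_nth \<phi> n)) e k = \<theta> (fps_nth (\<phi> * fps_X ^ k) e)" for e
    by (simp add: toeplitz_def fps_X_power_mult_right_nth not_less)
  have inner: "(\<Sum>e<Suc (Suc l). bidiagonal \<alpha> \<beta> l e * toeplitz (\<lambda>n. \<theta> (fps_nth \<phi> n)) e k) =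
      \<alpha> * \<theta> (fps_nth (\<phi> * fps_X ^ k) l) + \<beta> * \<theta> (fps_nth (fps_deriv (\<phi> * fps_X ^ k)) l)" for l
  proof -
    have "(\<Sum>e<l. bidiagonal \<alpha> \<beta> l e * toeplitz (\<lambda>n. \<theta> (fps_nth \<phi> n)) e k) = 0"
      by (intro sum.neutral) (auto simp: bidiagonal_def)
    moreover have "\<theta> (fps_nth (fps_deriv (\<phi> * fps_X ^ k)) l) = of_nat (Suc l) * \<theta> (fps_nth (\<phi> * fps_X ^ k) (Suc l))"
      by (simp only: fps_deriv_nth hom_mult hom_of_nat_eq Suc_eq_plus1)
    ultimately show ?thesis
      by (simp only: sum.lessThan_Suc \<phi> bidiagonal_def)
        (simp only: refl if_True if_False n_not_Suc_n n_not_Suc_n[symmetric] add_0_left ac_simps)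
  qed
  have mult: "\<theta> (fps_nth (\<psi> * g) i) = (\<Sum>l<Suc i. \<theta> (fps_nth \<psi> (i - l)) * \<theta> (fps_nth g l))" for g
  proof -
    have "fps_nth (\<psi> * g) i = (\<Sum>l<Suc i. fps_nth g l * fps_nth \<psi> (i - l))"
      by (simp only: mult.commute[of \<psi>] fps_mult_nth lessThan_Suc_atMost atMost_atLeast0)
    then show ?thesis
      by (simp only: hom_sum hom_mult mult.commute)
  qed
  have "production \<alpha> \<beta> i k = (\<Sum>l<Suc i. \<theta> (fps_nth \<psi> (i - l)) *
      (\<alpha> * \<theta> (fps_nth (\<phi> * fps_X ^ k) l) + \<beta> * \<theta> (fps_nth (fps_deriv (\<phi> * fps_X ^ k)) l)))"
    unfolding production_def inner by (intro sum.cong refl) (simp add: toeplitz_def)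
  then show ?thesis
    unfolding mult sum_distrib_left distrib_left sum.distrib
    by (simp only: mult.left_commute[of _ \<alpha>] mult.left_commute[of _ \<beta>] add.commute)
qed

lemma U_0: "U \<alpha> \<beta> 0 k = (if k = 0 then \<theta> (fps_nth \<phi> 0) else 0)"
  by (simp add: riordan_eval_def riordan_coeff_0[OF f0] d_0)

lemma U_Suc: "U \<alpha> \<beta> (Suc n) k = (\<Sum>i<Suc n. U \<alpha> \<beta> n i * production \<alpha> \<beta> i k)"
proof -
  let ?g = "\<lambda>i. \<theta> (fps_nth (\<psi> * fps_deriv (\<phi> * fps_X ^ k)) i)"
  let ?h = "\<lambda>i. \<theta> (fps_nth (\<psi> * (\<phi> * fps_X ^ k)) i)"
  have c_Suc: "\<theta> (c (Suc n) (k + j)) = (\<Sum>i\<le>n. \<theta> (c n (i + j)) * ?g i) +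
      of_nat j * (\<Sum>i\<le>n. \<theta> (c n (i + (j - 1))) * ?h i)" for j
    unfolding riordan_coeff_Suc_shift[OF \<iota> f0 f'] by (simp only: hom_add hom_mult hom_sum hom_of_nat_eq)
  \<comment> \<open>These terms keep the index j while the degree grows from n to n + 1, which frees
    one factor \<beta>; the term j = n + 1 vanishes by triangularity.\<close>
  have first: "(\<Sum>j\<le>Suc n. (\<Sum>i\<le>n. \<theta> (c n (i + j)) * ?g i) * d j * \<alpha> ^ j * \<beta> ^ (Suc n - j)) =
      (\<Sum>i\<le>n. U \<alpha> \<beta> n i * (\<beta> * ?g i))"
  proof -
    have "(\<Sum>i\<le>n. \<theta> (c n (i + Suc n)) * ?g i) = 0"
      by (intro sum.neutral) (simp add: riordan_coeff_eq_0[OF f0])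
    then have "(\<Sum>j\<le>Suc n. (\<Sum>i\<le>n. \<theta> (c n (i + j)) * ?g i) * d j * \<alpha> ^ j * \<beta> ^ (Suc n - j)) =
        (\<Sum>j\<le>n. (\<Sum>i\<le>n. \<theta> (c n (i + j)) * ?g i) * d j * \<alpha> ^ j * \<beta> ^ (Suc n - j))"
      by (simp only: sum.atMost_Suc mult_zero_left add_0_right)
    also have "\<dots> = (\<Sum>j\<le>n. \<Sum>i\<le>n. (\<theta> (c n (i + j)) * d j * \<alpha> ^ j * \<beta> ^ (n - j)) * (\<beta> * ?g i))"
      unfolding sum_distrib_right
      by (intro sum.cong refl) (simp add: Suc_diff_le ac_simps)
    also have "\<dots> = (\<Sum>i\<le>n. U \<alpha> \<beta> n i * (\<beta> * ?g i))"
      unfolding riordan_eval_def sum_distrib_right by (rule sum.swap)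
    finally show ?thesis .
  qed
  \<comment> \<open>Here the index drops by one: the factor j turns \<open>d j\<close> into
    \<open>d (j - 1)\<close>, and one factor \<alpha> is freed.\<close>
  have second: "(\<Sum>j\<le>Suc n. of_nat j * (\<Sum>i\<le>n. \<theta> (c n (i + (j - 1))) * ?h i) * d j * \<alpha> ^ j * \<beta> ^ (Suc n - j)) =
      (\<Sum>i\<le>n. U \<alpha> \<beta> n i * (\<alpha> * ?h i))"
  proof -
    have "(\<Sum>j\<le>Suc n. of_nat j * (\<Sum>i\<le>n. \<theta> (c n (i + (j - 1))) * ?h i) * d j * \<alpha> ^ j * \<beta> ^ (Suc n - j)) =
        (\<Sum>j\<le>n. of_nat (Suc j) * (\<Sum>i\<le>n. \<theta> (c n (i + j)) * ?h i) * d (Suc j) * \<alpha> ^ Suc j * \<beta> ^ (n - j))"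
      unfolding sum.atMost_Suc_shift by simp
    also have "\<dots> = (\<Sum>j\<le>n. (\<Sum>i\<le>n. \<theta> (c n (i + j)) * ?h i) * (of_nat (Suc j) * d (Suc j)) *
        \<alpha> ^ Suc j * \<beta> ^ (n - j))"
      by (intro sum.cong refl) (simp only: ac_simps)
    also have "\<dots> = (\<Sum>j\<le>n. \<Sum>i\<le>n. (\<theta> (c n (i + j)) * d j * \<alpha> ^ j * \<beta> ^ (n - j)) * (\<alpha> * ?h i))"
      unfolding d_Suc sum_distrib_left sum_distrib_right
      by (intro sum.cong refl) (simp only: power_Suc ac_simps)
    also have "\<dots> = (\<Sum>i\<le>n. U \<alpha> \<beta> n i * (\<alpha> * ?h i))"
      unfolding riordan_eval_def sum_distrib_right by (rule sum.swap)
    finally show ?thesis .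
  qed
  have "U \<alpha> \<beta> (Suc n) k = (\<Sum>i\<le>n. U \<alpha> \<beta> n i * (\<beta> * ?g i)) + (\<Sum>i\<le>n. U \<alpha> \<beta> n i * (\<alpha> * ?h i))"
    unfolding riordan_eval_def[where n = "Suc n"] c_Suc distrib_right sum.distrib first second ..
  then show ?thesis
    by (simp only: production_eq lessThan_Suc_atMost distrib_left sum.distrib)
qed

lemma production_hessenberg: "Suc i < k \<Longrightarrow> production \<alpha> \<beta> i k = 0"
  unfolding production_def toeplitz_def by (intro sum.neutral) (auto intro!: sum.neutral)

lemma totally_positive_production_matrix:
  assumes "P \<alpha>" "P \<beta>"
  shows "totally_positive P (production \<alpha> \<beta>)"
proof -
  have "totally_positive P (bidiagonal \<alpha> \<beta>)"
    unfolding bidiagonal_def[abs_def]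
    by (rule totally_positive_bidiagonal) (intro assms mult of_nat)+
  then have "totally_positive P (\<lambda>l k. \<Sum>e<Suc (Suc l). bidiagonal \<alpha> \<beta> l e * toeplitz (\<lambda>n. \<theta> (fps_nth \<phi> n)) e k)"
    by (rule totally_positive_mult[OF _ tp_\<phi>]) (auto simp: bidiagonal_def)
  then show ?thesis
    unfolding production_def[abs_def]
    by (rule totally_positive_mult[OF tp_\<psi>]) (auto simp: toeplitz_def)
qed

lemma \<phi>0: "P (\<theta> (fps_nth \<phi> 0))"
  using totally_positive_entry[OF tp_\<phi>, of 0 0] by (simp add: toeplitz_def)

theorem totally_positive_U:
  assumes "P \<alpha>" "P \<beta>"
  shows "totally_positive P (U \<alpha> \<beta>)"
  by (rule totally_positive_production[OF totally_positive_production_matrix[OF assms]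
        production_hessenberg \<phi>0 U_0 U_Suc])

theorem hankel_totally_positive_U:
  assumes "P \<alpha>" "P \<beta>"
  shows "hankel_totally_positive P (\<lambda>n. U \<alpha> \<beta> n 0)"
  by (rule hankel_totally_positive_production[OF totally_positive_production_matrix[OF assms]
        production_hessenberg \<phi>0 U_0 U_Suc])

text \<open>By the binomial theorem the pairs with k + j = m combine to (l y + x)^m / m!. Thus every
  homogenized row polynomial is an entry of a first column with other parameters, to which Hankel
  positivity applies.\<close>

lemma sum_U_eq:
  "(\<Sum>k\<le>n. d k * U l 1 n k * x ^ k * y ^ (n - k)) = U (l * y + x) y n 0"
proof -
  define g where "g k j = \<theta> (c n (k + j)) * d k * d j * l ^ j * x ^ k * y ^ (n - k)" for k j
  have "(\<Sum>k\<le>n. d k * U l 1 n k * x ^ k * y ^ (n - k)) = (\<Sum>k\<le>n. \<Sum>j\<le>n. g k j)"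
    unfolding riordan_eval_def g_def sum_distrib_left sum_distrib_right
    by (intro sum.cong refl) (simp add: ac_simps)
  \<comment> \<open>Triangularity cuts the square down to the triangle k + j \<le> n, which can be
    summed along antidiagonals.\<close>
  also have "\<dots> = (\<Sum>k\<le>n. \<Sum>j\<le>n - k. g k j)"
  proof (rule sum.cong[OF refl])
    fix k assume "k \<in> {..n}"
    have "g k j = 0" if "n - k < j" for j
      using that by (simp add: g_def riordan_coeff_eq_0[OF f0])
    then show "(\<Sum>j\<le>n. g k j) = (\<Sum>j\<le>n - k. g k j)"
      by (intro sum.mono_neutral_right) auto
  qed
  also have "\<dots> = (\<Sum>(k, j)\<in>(SIGMA k:{..n}. {..n - k}). g k j)"
    by (rule sum.Sigma) auto
  also have "\<dots> = (\<Sum>(k, j)\<in>{(k, j). k + j \<le> n}. g k j)"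
    by (rule sum.cong) auto
  also have "\<dots> = (\<Sum>m\<le>n. \<Sum>k\<le>m. g k (m - k))"
    by (rule sum.triangle_reindex_eq)
  also have "\<dots> = (\<Sum>m\<le>n. \<theta> (c n m) * d m * (l * y + x) ^ m * y ^ (n - m))"
  proof (rule sum.cong[OF refl])
    fix m assume "m \<in> {..n}"
    then have m: "m \<le> n" by simp
    have "(\<Sum>k\<le>m. g k (m - k)) =
        (\<Sum>k\<le>m. \<theta> (c n m) * d m * (of_nat (m choose k) * x ^ k * (l * y) ^ (m - k)) * y ^ (n - m))"
    proof (rule sum.cong[OF refl])
      fix k assume "k \<in> {..m}"
      then have k: "k \<le> m" by simp
      then have "y ^ (n - k) = y ^ (m - k) * y ^ (n - m)"
        using m by (simp flip: power_add)
      then show "g k (m - k) = \<theta> (c n m) * d m * (of_nat (m choose k) * x ^ k * (l * y) ^ (m - k)) * y ^ (n - m)"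
        using k unfolding g_def mult.assoc[of _ "d k"] d_choose[OF k, symmetric]
        by (simp only: le_add_diff_inverse power_mult_distrib ac_simps)
    qed
    then show "(\<Sum>k\<le>m. g k (m - k)) = \<theta> (c n m) * d m * (l * y + x) ^ m * y ^ (n - m)"
      by (simp only: add.commute[of "l * y"] binomial_ring sum_distrib_left sum_distrib_right)
  qed
  finally show ?thesis
    by (simp add: riordan_eval_def)
qed

end

section \<open>Polynomial rings, their nonnegative cones and evaluation maps\<close>

lemma poly_mapping_eq_sum_single:
  "p = (\<Sum>m\<in>Poly_Mapping.keys p. Poly_Mapping.single m (Poly_Mapping.lookup p m))"
  by (rule poly_mapping_eqI)
    (simp add: lookup_sum lookup_single when_def in_keys_iff)

lemma poly_mapping_mult_eq_sum_single:
  fixes p q :: "'m::comm_monoid_add \<Rightarrow>\<^sub>0 'a::comm_ring_1"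
  shows "p * q = (\<Sum>a\<in>Poly_Mapping.keys p. \<Sum>b\<in>Poly_Mapping.keys q.
    Poly_Mapping.single (a + b) (Poly_Mapping.lookup p a * Poly_Mapping.lookup q b))"
  unfolding mult_single[symmetric] sum_product[symmetric]
  using poly_mapping_eq_sum_single[of p] poly_mapping_eq_sum_single[of q] by simp

lemma nonneg_cone_nonneg_x: "nonneg_cone (nonneg_x :: 'x rpoly \<Rightarrow> bool)"
proof
  show "nonneg_x (a * b)" if "nonneg_x a" "nonneg_x b" for a b :: "'x rpoly"
    using that unfolding nonneg_x_def poly_mapping_mult_eq_sum_single lookup_sum lookup_single
    by (auto intro!: sum_nonneg simp: when_def)
qed (auto simp: nonneg_x_def lookup_add lookup_one when_def)

lemma nonneg_cone_poly:
  assumes "nonneg_cone P"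
  shows "nonneg_cone (\<lambda>p. \<forall>i. P (poly.coeff p i))"
proof -
  interpret nonneg_cone P by fact
  show ?thesis
    by unfold_locales (auto simp: coeff_mult coeff_1 zero one add intro!: sum mult)
qed

lemma nonneg_cone_nonneg_lx: "nonneg_cone nonneg_lx"
  using nonneg_cone_poly[OF nonneg_cone_nonneg_x] unfolding nonneg_lx_def[abs_def] .

lemma nonneg_cone_nonneg_qlx: "nonneg_cone nonneg_qlx"
  using nonneg_cone_poly[OF nonneg_cone_nonneg_lx] unfolding nonneg_qlx_def[abs_def] .

lemma nonneg_cone_real: "nonneg_cone (\<lambda>x::real. 0 \<le> x)"
  by unfold_locales auto

lemma comm_ring_hom_const_poly: "comm_ring_hom (\<lambda>a::'a::comm_ring_1. [:a:])"
  by unfold_locales (simp_all add: one_pCons)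

lemma comm_ring_hom_poly: "comm_ring_hom (\<lambda>p. poly p (a::'a::comm_ring_1))"
  by unfold_locales simp_all

lemma comm_ring_hom_compose:
  assumes "comm_ring_hom g" "comm_ring_hom h"
  shows "comm_ring_hom (\<lambda>a. g (h a))"
proof -
  interpret g: comm_ring_hom g by fact
  interpret h: comm_ring_hom h by fact
  show ?thesis
    by unfold_locales (simp_all add: g.hom_add h.hom_add g.hom_mult h.hom_mult)
qed

lemma comm_ring_hom_rpoly_eval: "comm_ring_hom (rpoly_eval v)"
proof -
  define w where "w m = (\<Prod>i\<in>Poly_Mapping.keys m. v i ^ Poly_Mapping.lookup m i)" for m
  have w_eq: "w m = (\<Prod>i\<in>S. v i ^ Poly_Mapping.lookup m i)"
    if "finite S" "Poly_Mapping.keys m \<subseteq> S" for m S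
    unfolding w_def using that by (intro prod.mono_neutral_left) (auto simp: in_keys_iff)
  have w_add: "w (a + b) = w a * w b" for a b
  proof -
    let ?S = "Poly_Mapping.keys a \<union> Poly_Mapping.keys b"
    have "w (a + b) = (\<Prod>i\<in>?S. v i ^ Poly_Mapping.lookup (a + b) i)"
      by (rule w_eq) (simp_all add: Poly_Mapping.keys_add)
    also have "\<dots> = (\<Prod>i\<in>?S. v i ^ Poly_Mapping.lookup a i) * (\<Prod>i\<in>?S. v i ^ Poly_Mapping.lookup b i)"
      by (simp add: lookup_add power_add prod.distrib)
    also have "\<dots> = w a * w b"
      by (subst (1 2) w_eq[of ?S]) simp_all
    finally show ?thesis .
  qed
  \<comment> \<open>Coefficients may cancel in a sum, so evaluation is allowed over any finite set
    containing the support.\<close>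
  have eval_eq: "rpoly_eval v p = (\<Sum>m\<in>S. Poly_Mapping.lookup p m * w m)"
    if "finite S" "Poly_Mapping.keys p \<subseteq> S" for p S
    unfolding rpoly_eval_def w_def[symmetric]
    using that by (intro sum.mono_neutral_left) (auto simp: in_keys_iff)
  have add: "rpoly_eval v (p + q) = rpoly_eval v p + rpoly_eval v q" for p q
  proof -
    let ?S = "Poly_Mapping.keys p \<union> Poly_Mapping.keys q"
    have "rpoly_eval v (p + q) = (\<Sum>m\<in>?S. Poly_Mapping.lookup (p + q) m * w m)"
      by (rule eval_eq) (simp_all add: Poly_Mapping.keys_add)
    also have "\<dots> = (\<Sum>m\<in>?S. Poly_Mapping.lookup p m * w m) + (\<Sum>m\<in>?S. Poly_Mapping.lookup q m * w m)"
      by (simp add: lookup_add distrib_right sum.distrib)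
    also have "\<dots> = rpoly_eval v p + rpoly_eval v q"
      by (subst (1 2) eval_eq[of ?S]) simp_all
    finally show ?thesis .
  qed
  have zero: "rpoly_eval v 0 = 0"
    by (simp add: rpoly_eval_def)
  have single: "rpoly_eval v (Poly_Mapping.single m c) = c * w m" for m c
    by (subst eval_eq[of "{m}"]) (auto split: if_splits)
  have sum: "rpoly_eval v (sum g I) = (\<Sum>i\<in>I. rpoly_eval v (g i))" for g and I :: "('x \<Rightarrow>\<^sub>0 nat) set"
    by (induction I rule: infinite_finite_induct) (simp_all add: zero add)
  have mult: "rpoly_eval v (p * q) = rpoly_eval v p * rpoly_eval v q" for p q
  proof -
    have "rpoly_eval v (p * q) = (\<Sum>a\<in>Poly_Mapping.keys p. \<Sum>b\<in>Poly_Mapping.keys q.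
        Poly_Mapping.lookup p a * w a * (Poly_Mapping.lookup q b * w b))"
      unfolding poly_mapping_mult_eq_sum_single sum single w_add by (simp only: ac_simps)
    also have "\<dots> = rpoly_eval v p * rpoly_eval v q"
      by (simp add: rpoly_eval_def w_def sum_product)
    finally show ?thesis .
  qed
  have one: "rpoly_eval v 1 = 1"
    using single[of 0 1] by (simp add: w_def)
  show ?thesis
    by unfold_locales (simp_all add: add mult one zero)
qed

lemma rpoly_eval_rconst: "rpoly_eval v (rconst c) = c"
  by (simp add: rpoly_eval_def rconst_def)

lemma rpoly_eval_nonneg: "nonneg_x p \<Longrightarrow> (\<And>i. 0 \<le> v i) \<Longrightarrow> 0 \<le> rpoly_eval v p"
  unfolding rpoly_eval_def nonneg_x_def
  by (intro sum_nonneg mult_nonneg_nonneg prod_nonneg zero_le_power) auto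

lemma rconst_mult: "rconst a * rconst b = rconst (a * b)"
  by (simp add: rconst_def mult_single)

lemma rconst_of_nat: "rconst (of_nat n) = of_nat n"
  by (simp add: rconst_def)

lemma rconst_1: "rconst 1 = 1"
  by (simp add: rconst_def)

lemma nonneg_x_rconst: "0 \<le> c \<Longrightarrow> nonneg_x (rconst c)"
  by (simp add: nonneg_x_def rconst_def lookup_single when_def)

section \<open>Polya frequency series and the array of the theorem\<close>

lemma polya_frequency_eq_toeplitz:
  "polya_frequency h \<longleftrightarrow> totally_positive nonneg_x (toeplitz (fps_nth h))"
  by (simp add: polya_frequency_def toeplitz_def[abs_def])

lemma polya_frequency_1: "polya_frequency 1"
proof -
  interpret nonneg_cone nonneg_x by (rule nonneg_cone_nonneg_x)
  have "totally_positive nonneg_x (\<lambda>i j. if j = i then 1 else if j = Suc i then 0 else 0)"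
    by (rule totally_positive_bidiagonal) (rule one zero)+
  then show ?thesis
    unfolding polya_frequency_eq_toeplitz
    by (rule totally_positive_cong[THEN iffD1, rotated]) (auto simp: toeplitz_def)
qed

text \<open>The Toeplitz matrix of a product is the product of the Toeplitz matrices. Used for the
  pair \<phi> \<psi>, 1 that treats f'.\<close>

lemma polya_frequency_mult:
  assumes "polya_frequency \<phi>" "polya_frequency \<psi>"
  shows "polya_frequency (\<phi> * \<psi>)"
proof -
  interpret nonneg_cone nonneg_x by (rule nonneg_cone_nonneg_x)
  have "totally_positive nonneg_x (\<lambda>i j. \<Sum>k<Suc i. toeplitz (fps_nth \<phi>) i k * toeplitz (fps_nth \<psi>) k j)"
    by (rule totally_positive_mult[OF assms[unfolded polya_frequency_eq_toeplitz]]) (simp add: toeplitz_def)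
  then show ?thesis
    unfolding polya_frequency_eq_toeplitz
  proof (rule totally_positive_cong[THEN iffD1, rotated])
    fix i j
    show "(\<Sum>k<Suc i. toeplitz (fps_nth \<phi>) i k * toeplitz (fps_nth \<psi>) k j) = toeplitz (fps_nth (\<phi> * \<psi>)) i j"
    proof (cases "j \<le> i")
      case True
      have "(\<Sum>k<Suc i. toeplitz (fps_nth \<phi>) i k * toeplitz (fps_nth \<psi>) k j) =
          (\<Sum>k\<in>{0 + j..i - j + j}. fps_nth \<phi> (i - k) * fps_nth \<psi> (k - j))"
        using True by (intro sum.mono_neutral_cong_right) (auto simp: toeplitz_def)
      also have "\<dots> = (\<Sum>k=0..i - j. fps_nth \<phi> (i - (k + j)) * fps_nth \<psi> k)"
        unfolding sum.shift_bounds_cl_nat_ivl by simp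
      also have "\<dots> = fps_nth (\<psi> * \<phi>) (i - j)"
        unfolding fps_mult_nth by (intro sum.cong refl) (simp add: mult.commute add.commute)
      finally show ?thesis
        using True by (simp add: toeplitz_def mult.commute)
    next
      case False
      then show ?thesis
        by (auto simp: toeplitz_def intro!: sum.neutral)
    qed
  qed
qed

lemma riordan_productionI:
  fixes f \<phi> \<psi> :: "'x rpoly fps" and \<iota> :: "'x rpoly \<Rightarrow> 'k::field"
  assumes "nonneg_cone P" "comm_ring_hom \<theta>" "\<And>a. nonneg_x a \<Longrightarrow> P (\<theta> a)"
    and "inj_comm_ring_hom \<iota>" "fps_nth f 0 = 0" "fps_deriv f = (\<phi> * \<psi>) oo f"
    and "polya_frequency \<phi>" "polya_frequency \<psi>"
  shows "riordan_production P \<theta> \<phi> \<psi> f \<iota> (\<lambda>n. \<theta> (rconst (1 / fact n)))"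
proof -
  interpret nonneg_cone P by fact
  interpret comm_ring_hom \<theta> by fact
  have toeplitz: "totally_positive P (toeplitz (\<lambda>n. \<theta> (fps_nth h n)))" if "polya_frequency h" for h
  proof -
    have "totally_positive P (\<lambda>i j. \<theta> (toeplitz (fps_nth h) i j))"
      using that unfolding polya_frequency_eq_toeplitz
      by (rule totally_positive_hom[where \<theta> = \<theta>]) (use assms(2,3) in auto)
    then show ?thesis
      by (rule totally_positive_cong[THEN iffD1, rotated]) (simp add: toeplitz_def)
  qed
  have "\<theta> (rconst (1 / fact n)) * of_nat (fact n) = 1" for n
  proof -
    have "\<theta> (rconst (1 / fact n)) * of_nat (fact n) = \<theta> (rconst (1 / fact n) * rconst (of_nat (fact n)))"
      by (simp only: hom_mult rconst_of_nat hom_of_nat_eq)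
    also have "\<dots> = \<theta> (rconst 1)"
      unfolding rconst_mult by simp
    finally show ?thesis by (simp add: rconst_1)
  qed
  then show ?thesis
    by (intro riordan_production.intro riordan_production_axioms.intro assms(1,2,4-8) toeplitz)
qed

text \<open>Expanding the exponential of \<lambda> f in powers of f supplies the sum over j with the
  weights \<lambda>^j / j!; the denominator k! of the array stays outside as a column
  factor.\<close>

lemma R_entry_eq_riordan_eval:
  fixes f \<phi> :: "'x rpoly fps"
  assumes f0: "fps_nth f 0 = 0"
  shows "R_entry \<phi> f n k =
    [:rconst (1 / fact k):] * riordan_eval (\<lambda>a. [:a:]) (\<lambda>j. [:rconst (1 / fact j):]) \<phi> f [:0, 1:] 1 n k"
proof -
  interpret comm_ring_hom "\<lambda>a::'x rpoly. [:a:]" by (rule comm_ring_hom_const_poly)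
  have "gen_series \<phi> f * lift_fps f ^ k =
      (lift_fps (\<phi> oo f) * lift_fps f ^ k) * (exp_lambda oo lift_fps f)"
    unfolding gen_series_def lift_fps_def map_fps_compose by (simp only: ac_simps)
  then have "fps_nth (gen_series \<phi> f * lift_fps f ^ k) n =
      (\<Sum>j\<le>n. fps_nth exp_lambda j * fps_nth ((lift_fps (\<phi> oo f) * lift_fps f ^ k) * lift_fps f ^ j) n)"
    using fps_nth_mult_compose[of "lift_fps f" "lift_fps (\<phi> oo f) * lift_fps f ^ k" exp_lambda n] f0
    by (simp add: lift_fps_def)
  also have "\<dots> = (\<Sum>j\<le>n. [:fps_nth ((\<phi> oo f) * f ^ (k + j)) n:] * [:rconst (1 / fact j):] * [:0, 1:] ^ j)"
  proof (rule sum.cong[OF refl])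
    fix j
    have pow: "(lift_fps (\<phi> oo f) * lift_fps f ^ k) * lift_fps f ^ j = lift_fps ((\<phi> oo f) * f ^ (k + j))"
      unfolding lift_fps_def map_fps_mult map_fps_power power_add by (simp only: ac_simps)
    have exp: "fps_nth exp_lambda j = [:rconst (1 / fact j):] * [:0, 1:] ^ j"
      by (simp add: exp_lambda_def monom_altdef)
    show "fps_nth exp_lambda j * fps_nth ((lift_fps (\<phi> oo f) * lift_fps f ^ k) * lift_fps f ^ j) n =
        [:fps_nth ((\<phi> oo f) * f ^ (k + j)) n:] * [:rconst (1 / fact j):] * [:0, 1:] ^ j"
      unfolding pow exp by (simp only: lift_fps_def fps_nth_map_fps ac_simps)
  qed
  finally have nth: "fps_nth (gen_series \<phi> f * lift_fps f ^ k) n =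
      (\<Sum>j\<le>n. [:fps_nth ((\<phi> oo f) * f ^ (k + j)) n:] * [:rconst (1 / fact j):] * [:0, 1:] ^ j)" .
  have "rconst (fact n / fact k) = (rconst (1 / fact k) * of_nat (fact n) :: 'x rpoly)"
    unfolding rconst_of_nat[symmetric] rconst_mult by simp
  then have coeff: "[:rconst (fact n / fact k) :: 'x rpoly:] = [:rconst (1 / fact k):] * [:of_nat (fact n):]"
    by (simp only: hom_mult)
  show ?thesis
    unfolding R_entry_def exp_riordan_def nth coeff riordan_eval_def riordan_coeff_def hom_mult
      mult.assoc sum_distrib_left power_one mult_1_right ..
qed

lemma T_poly_eq_R_entry: "T_poly \<phi> f n = R_entry \<phi> f n 0"
proof -
  have "rconst (fact n) = (of_nat (fact n) :: 'a rpoly)"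
    unfolding rconst_of_nat[symmetric] by simp
  then have "[:rconst (fact n) :: 'a rpoly:] = fact n"
    by (metis of_nat_fact of_nat_poly)
  then show ?thesis
    by (simp add: T_poly_def R_entry_def exp_riordan_def)
qed

text \<open>Quadratic forms are linear in the sequence, so their nonnegativity survives integration.
  Integrating first over y and then over x replaces x^k y^(n - k) by \<open>s k * t (n - k)\<close>
  without a product measure.\<close>

lemma preserves_stieltjesI:
  assumes "\<And>x y. 0 \<le> x \<Longrightarrow> 0 \<le> y \<Longrightarrow>
    hankel_totally_positive (\<lambda>x. 0 \<le> x) (\<lambda>n. \<Sum>k\<le>n. r n k * x ^ k * y ^ (n - k))"
  shows "preserves_stieltjes r"
  unfolding preserves_stieltjes_def
proof (intro allI impI, elim conjE)
  fix s t :: "nat \<Rightarrow> real"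
  assume "stieltjes_moment s"
  then obtain \<mu> where \<mu>: "sets \<mu> = sets borel" "emeasure \<mu> {..<0} = 0"
    "\<And>n. has_bochner_integral \<mu> (\<lambda>x. x ^ n) (s n)"
    by (auto simp: stieltjes_moment_def)
  assume "stieltjes_moment t"
  then obtain \<nu> where \<nu>: "sets \<nu> = sets borel" "emeasure \<nu> {..<0} = 0"
    "\<And>n. has_bochner_integral \<nu> (\<lambda>x. x ^ n) (t n)"
    by (auto simp: stieltjes_moment_def)
  have AE: "AE x in M. 0 \<le> x" if "sets M = sets borel" "emeasure M {..<0} = 0" for M :: "real measure"
  proof (rule AE_I)
    show "{x \<in> space M. \<not> 0 \<le> x} \<subseteq> {..<0}" by auto
  qed (use that in simp_all)
  have nonneg: "0 \<le> I" if "has_bochner_integral M g I" "sets M = sets borel" "emeasure M {..<0} = 0"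
    "\<And>x. 0 \<le> x \<Longrightarrow> 0 \<le> g x" for M :: "real measure" and g :: "real \<Rightarrow> real" and I
  proof -
    have "AE x in M. 0 \<le> g x"
      using AE[OF that(2,3)] by eventually_elim (rule that(4))
    then have "0 \<le> integral\<^sup>L M g" by (rule integral_nonneg_AE)
    then show ?thesis using that(1) by (simp add: has_bochner_integral_iff)
  qed
  define w where "w x y n = (\<Sum>k\<le>n. r n k * x ^ k * y ^ (n - k))" for x y :: real and n
  define z where "z n = (\<Sum>k\<le>n. r n k * s k * t (n - k))" for n
  \<comment> \<open>The index function \<open>e\<close> lets one argument serve the Hankel form and
    its shift.\<close>
  have form: "0 \<le> (\<Sum>i<n. \<Sum>j<n. a i * a j * z (e i j))"
    if pos: "\<And>x y. 0 \<le> x \<Longrightarrow> 0 \<le> y \<Longrightarrow> 0 \<le> (\<Sum>i<n. \<Sum>j<n. a i * a j * w x y (e i j))"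
    for n :: nat and a :: "nat \<Rightarrow> real" and e :: "nat \<Rightarrow> nat \<Rightarrow> nat"
  proof -
    have inner: "0 \<le> (\<Sum>i<n. \<Sum>j<n. a i * a j * (\<Sum>k\<le>e i j. r (e i j) k * x ^ k * t (e i j - k)))"
      if "0 \<le> x" for x
    proof (rule nonneg[OF _ \<nu>(1,2)])
      show "has_bochner_integral \<nu> (\<lambda>y. \<Sum>i<n. \<Sum>j<n. a i * a j * w x y (e i j))
          (\<Sum>i<n. \<Sum>j<n. a i * a j * (\<Sum>k\<le>e i j. r (e i j) k * x ^ k * t (e i j - k)))"
        unfolding w_def by (intro has_bochner_integral_sum has_bochner_integral_mult_right \<nu>(3))
    qed (rule pos[OF that])
    show ?thesis
    proof (rule nonneg[OF _ \<mu>(1,2)])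
      have "has_bochner_integral \<mu> (\<lambda>x. r (e i j) k * x ^ k * t (e i j - k)) (r (e i j) k * s k * t (e i j - k))" for i j k
        by (intro has_bochner_integral_mult_left has_bochner_integral_mult_right \<mu>(3))
      then show "has_bochner_integral \<mu>
          (\<lambda>x. \<Sum>i<n. \<Sum>j<n. a i * a j * (\<Sum>k\<le>e i j. r (e i j) k * x ^ k * t (e i j - k)))
          (\<Sum>i<n. \<Sum>j<n. a i * a j * z (e i j))"
        unfolding z_def by (intro has_bochner_integral_sum has_bochner_integral_mult_right)
    qed (rule inner)
  qed
  have "stieltjes_moment z"
  proof (rule stieltjes_momentI)
    fix n and a :: "nat \<Rightarrow> real"
    show "0 \<le> (\<Sum>i<n. \<Sum>j<n. a i * a j * z (i + j))"
      by (rule form[where e = "\<lambda>i j. i + j"])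
        (unfold w_def, rule nonneg_quadratic_form_hankel(1)[OF assms])
    show "0 \<le> (\<Sum>i<n. \<Sum>j<n. a i * a j * z (Suc (i + j)))"
      by (rule form[where e = "\<lambda>i j. Suc (i + j)"])
        (unfold w_def, rule nonneg_quadratic_form_hankel(2)[OF assms])
  qed
  then show "stieltjes_moment (\<lambda>n. \<Sum>k\<le>n. r n k * s k * t (n - k))"
    by (simp only: z_def[abs_def])
qed

theorem theorem5p6:
  fixes f \<phi> \<psi> :: "'x rpoly fps" and \<iota> :: "'x rpoly \<Rightarrow> 'k::field"
  assumes "inj_comm_ring_hom \<iota>"
    and "fps_nth f 0 = 0"
    and "fps_nth (fps_deriv f) 0 \<noteq> 0"
    and "inverse (fps_deriv (fps_inv (map_fps \<iota> f))) = map_fps \<iota> (\<phi> * \<psi>)"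
    and "polya_frequency \<phi>"
    and "polya_frequency \<psi>"
  shows "totally_positive nonneg_lx (R_entry \<phi> f) \<and>
    hankel_totally_positive nonneg_qlx (R_poly \<phi> f) \<and>
    hankel_totally_positive nonneg_qlx (\<lambda>n. reversed_poly n (R_poly \<phi> f n)) \<and>
    hankel_totally_positive nonneg_lx (T_poly \<phi> f) \<and>
    hankel_totally_positive nonneg_lx (\<lambda>n. reversed_poly n (T_poly \<phi> f n)) \<and>
    hankel_totally_positive nonneg_x (\<lambda>n. fact (n + 1) * fps_nth f (n + 1)) \<and>
    (\<forall>l v. 0 \<le> l \<and> (\<forall>i. 0 \<le> v i) \<longrightarrow>
      preserves_stieltjes (\<lambda>n k. rpoly_eval v (poly (R_entry \<phi> f n k) (rconst l))))"
proof -
  interpret inj_comm_ring_hom \<iota> by fact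
  note f0 = assms(2)
  have "fps_deriv (map_fps \<iota> f) = map_fps \<iota> (\<phi> * \<psi>) oo map_fps \<iota> f"
    unfolding assms(4)[symmetric]
    by (rule fps_deriv_of_inverse_deriv_fps_inv) (use assms(2,3) in simp_all)
  then have f': "fps_deriv f = (\<phi> * \<psi>) oo f"
    unfolding map_fps_deriv[symmetric] map_fps_compose[symmetric] map_fps_inject .
  let ?e = "\<lambda>n. rconst (1 / fact n)"

  interpret lx: riordan_production nonneg_lx "\<lambda>a. [:a:]" \<phi> \<psi> f \<iota> "\<lambda>n. [:?e n:]"
  proof (rule riordan_productionI)
    show "nonneg_lx [:a:]" if "nonneg_x a" for a :: "'x rpoly"
      using that nonneg_cone.zero[OF nonneg_cone_nonneg_x]
      by (auto simp: nonneg_lx_def coeff_pCons split: nat.split)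
  qed (use assms f' nonneg_cone_nonneg_lx comm_ring_hom_const_poly in auto)
  have lambda: "nonneg_lx [:0, 1 :: 'x rpoly:]"
    using nonneg_cone.zero[OF nonneg_cone_nonneg_x] nonneg_cone.one[OF nonneg_cone_nonneg_x]
    by (auto simp: nonneg_lx_def coeff_pCons split: nat.split)
  have R_entry: "R_entry \<phi> f n k = [:?e k:] * lx.U [:0, 1:] 1 n k" for n k
    by (rule R_entry_eq_riordan_eval[OF f0])
  have T_poly: "T_poly \<phi> f n = lx.U [:0, 1:] 1 n 0" for n
    using R_entry[of n 0] T_poly_eq_R_entry[of \<phi> f n] by (simp add: rconst_1)

  have i: "totally_positive nonneg_lx (R_entry \<phi> f)"
  proof -
    have "nonneg_lx [:?e k:]" for k
      using nonneg_x_rconst[of "1 / fact k"] nonneg_cone.zero[OF nonneg_cone_nonneg_x]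
      by (auto simp: nonneg_lx_def coeff_pCons split: nat.split)
    from lx.totally_positive_scale_columns[OF lx.totally_positive_U[OF lambda lx.one] this]
    show ?thesis unfolding R_entry[abs_def] .
  qed
  have iiia: "hankel_totally_positive nonneg_lx (T_poly \<phi> f)"
    unfolding T_poly[abs_def] by (rule lx.hankel_totally_positive_U[OF lambda lx.one])
  have iiib: "hankel_totally_positive nonneg_lx (\<lambda>n. reversed_poly n (T_poly \<phi> f n))"
  proof -
    \<comment> \<open>The first column is homogeneous of degree n in its two parameters, so reversal
      exchanges them.\<close>
    have "reversed_poly n (T_poly \<phi> f n) = lx.U 1 [:0, 1:] n 0" for n
    proof -
      have "T_poly \<phi> f n = (\<Sum>j\<le>n. Polynomial.monom (riordan_coeff \<phi> f n j * ?e j) j)"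
        unfolding T_poly riordan_eval_def by (simp add: monom_altdef mult.commute)
      then have "poly.coeff (T_poly \<phi> f n) j = riordan_coeff \<phi> f n j * ?e j" if "j \<le> n" for j
        using that by (simp add: coeff_sum sum.delta)
      then show ?thesis
        unfolding reversed_poly_def riordan_eval_def by (simp add: monom_altdef mult.commute)
    qed
    then show ?thesis
      using lx.hankel_totally_positive_U[OF lx.one lambda] by simp
  qed

  interpret qlx: riordan_production nonneg_qlx "\<lambda>a. [:[:a:]:]" \<phi> \<psi> f \<iota> "\<lambda>n. [:[:?e n:]:]"
  proof (rule riordan_productionI)
    show "nonneg_qlx [:[:a:]:]" if "nonneg_x a" for a :: "'x rpoly"
      using that nonneg_cone.zero[OF nonneg_cone_nonneg_x]
      by (auto simp: nonneg_lx_def nonneg_qlx_def coeff_pCons split: nat.split)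
    show "comm_ring_hom (\<lambda>a::'x rpoly. [:[:a:]:])"
      by (rule comm_ring_hom_compose[OF comm_ring_hom_const_poly comm_ring_hom_const_poly])
  qed (use assms f' nonneg_cone_nonneg_qlx in auto)
  interpret const: comm_ring_hom "\<lambda>a::'x rpoly poly. [:a:]"
    by (rule comm_ring_hom_const_poly)
  have q: "nonneg_qlx [:0, 1 :: 'x rpoly poly:]"
    using lx.zero lx.one by (auto simp: nonneg_qlx_def coeff_pCons split: nat.split)
  have l: "nonneg_qlx [:[:0, 1 :: 'x rpoly:]:]"
    using lx.zero lambda by (auto simp: nonneg_qlx_def coeff_pCons split: nat.split)
  have R_const: "[:R_entry \<phi> f n k:] = [:[:?e k:]:] * qlx.U [:[:0, 1:]:] 1 n k" for n k
    using const.hom_riordan_eval[of "\<lambda>a. [:a:]" "\<lambda>n. [:?e n:]" \<phi> f "[:0, 1:]" 1 n k]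
      const.hom_mult[of "[:?e k:]" "lx.U [:0, 1:] 1 n k"]
    unfolding R_entry by (simp only: const.hom_one)
  have monom: "Polynomial.monom (R_entry \<phi> f n k) m = [:[:?e k:]:] * qlx.U [:[:0, 1:]:] 1 n k * [:0, 1:] ^ m" for n k m
    unfolding R_const[symmetric] monom_altdef by simp
  have iia: "hankel_totally_positive nonneg_qlx (R_poly \<phi> f)"
  proof -
    \<comment> \<open>This is \<open>sum_U_eq\<close> at x = q, y = 1; the reversed polynomials
      below are its case x = 1, y = q.\<close>
    have "R_poly \<phi> f = (\<lambda>n. qlx.U ([:[:0, 1:]:] * 1 + [:0, 1:]) 1 n 0)"
      unfolding R_poly_def[abs_def] monom qlx.sum_U_eq[symmetric] by (simp only: power_one mult_1_right)
    then show ?thesis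
      using qlx.hankel_totally_positive_U[OF qlx.add[OF qlx.mult[OF l qlx.one] q] qlx.one]
      by (simp only:)
  qed
  have iib: "hankel_totally_positive nonneg_qlx (\<lambda>n. reversed_poly n (R_poly \<phi> f n))"
  proof -
    have "reversed_poly n (R_poly \<phi> f n) = qlx.U ([:[:0, 1:]:] * [:0, 1:] + 1) [:0, 1:] n 0" for n
    proof -
      have "poly.coeff (R_poly \<phi> f n) k = R_entry \<phi> f n k" if "k \<le> n" for k
        using that by (simp add: R_poly_def coeff_sum sum.delta)
      then have "reversed_poly n (R_poly \<phi> f n) = (\<Sum>k\<le>n. Polynomial.monom (R_entry \<phi> f n k) (n - k))"
        by (simp add: reversed_poly_def)
      then show ?thesis
        unfolding monom qlx.sum_U_eq[symmetric] by (simp only: power_one mult_1_right)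
    qed
    then show ?thesis
      using qlx.hankel_totally_positive_U[OF qlx.add[OF qlx.mult[OF l q] qlx.one] q] by simp
  qed

  have iv: "hankel_totally_positive nonneg_x (\<lambda>n. fact (n + 1) * fps_nth f (n + 1))"
  proof -
    have x: "riordan_production nonneg_x (\<lambda>a. a) (\<phi> * \<psi>) 1 f \<iota> ?e"
    proof (rule riordan_productionI)
      show "comm_ring_hom (\<lambda>a::'x rpoly. a)" by unfold_locales simp_all
      show "fps_deriv f = (\<phi> * \<psi> * 1) oo f" by (simp add: f')
    qed (rule nonneg_cone_nonneg_x assms polya_frequency_mult polya_frequency_1 | assumption)+
    \<comment> \<open>The parameter \<alpha> = 0 leaves only j = 0, that is n! times the coefficient
      of t^n in (\<phi> \<psi>)(f) = f'.\<close>
    have "riordan_eval (\<lambda>a. a) ?e (\<phi> * \<psi>) f 0 1 n 0 = fact (n + 1) * fps_nth f (n + 1)" for n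
    proof -
      have "riordan_eval (\<lambda>a. a) ?e (\<phi> * \<psi>) f 0 1 n 0 = (\<Sum>j\<in>{0}. riordan_coeff (\<phi> * \<psi>) f n j * ?e j * 0 ^ j)"
        unfolding riordan_eval_def
        by (rule sum.mono_neutral_cong_right) (auto simp: power_0_left)
      also have "\<dots> = riordan_coeff (\<phi> * \<psi>) f n 0"
        by (simp add: rconst_1)
      also have "\<dots> = of_nat (fact n) * fps_nth (fps_deriv f) n"
        unfolding riordan_coeff_def f' by (simp only: power_0 mult_1_right)
      also have "\<dots> = fact (n + 1) * fps_nth f (n + 1)"
        unfolding fps_deriv_nth of_nat_fact Suc_eq_plus1[symmetric] fact_Suc by (simp only: mult_ac)
      finally show ?thesis .
    qed
    then show ?thesis
      using riordan_production.hankel_totally_positive_U[OF x,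
          OF nonneg_cone.zero[OF nonneg_cone_nonneg_x] nonneg_cone.one[OF nonneg_cone_nonneg_x]]
      by simp
  qed

  have v: "preserves_stieltjes (\<lambda>n k. rpoly_eval v (poly (R_entry \<phi> f n k) (rconst l)))"
    if l: "0 \<le> l" and v: "\<And>i. 0 \<le> v i" for l v
  proof -
    let ?\<theta> = "rpoly_eval v"
    interpret r: riordan_production "\<lambda>x::real. 0 \<le> x" ?\<theta> \<phi> \<psi> f \<iota> "\<lambda>n. ?\<theta> (?e n)"
      by (rule riordan_productionI)
        (rule nonneg_cone_real comm_ring_hom_rpoly_eval assms f' | erule rpoly_eval_nonneg[OF _ v])+
    interpret ev: comm_ring_hom "\<lambda>p. ?\<theta> (poly p (rconst l))"
      by (rule comm_ring_hom_compose[OF comm_ring_hom_rpoly_eval comm_ring_hom_poly])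
    have R: "?\<theta> (poly (R_entry \<phi> f n k) (rconst l)) = ?\<theta> (?e k) * r.U l 1 n k" for n k
      unfolding R_entry ev.hom_mult ev.hom_riordan_eval by (simp add: rpoly_eval_rconst)
    \<comment> \<open>For nonnegative numbers \<open>x\<close>, \<open>y\<close> and
      \<open>l\<close>, the two-variable row sum is a first column with the nonnegative parameters
      \<open>l * y + x\<close> and \<open>y\<close>.\<close>
    show ?thesis
    proof (rule preserves_stieltjesI)
      fix x y :: real assume "0 \<le> x" "0 \<le> y"
      then have "hankel_totally_positive (\<lambda>x. 0 \<le> x) (\<lambda>n. r.U (l * y + x) y n 0)"
        using l by (intro r.hankel_totally_positive_U) auto
      then show "hankel_totally_positive (\<lambda>x. 0 \<le> x)
          (\<lambda>n. \<Sum>k\<le>n. ?\<theta> (poly (R_entry \<phi> f n k) (rconst l)) * x ^ k * y ^ (n - k))"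
        unfolding R r.sum_U_eq .
    qed
  qed
  show ?thesis
    by (intro conjI i iia iib iiia iiib iv allI impI v) (elim conjE allE; assumption)+
qed

end
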